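(* Let $A,B\in\mathrm{GL}(2d,\mathbb{R})$ and $\sigma,\rho\in M^\infty(\mathbb{R}^{2d})$. Then $$\sigma^A=\rho^B\quad\Longleftrightarrow\quad \sigma=\frac{|\det A|}{|\det B|}\,\mathcal{F}_2\,\mathfrak{T}_{B^{-1}A}\,\mathcal{F}_2^{-1}\rho .$$
   Context: Brackets $\langle\cdot,\cdot\rangle$ denote the extension of the $L^2$ inner product (conjugate-linear in the second argument) to the duality $M^\infty\times M^1$. $M^p(\mathbb{R}^n)$ ($p=1,\infty$) is the space of tempered distributions $f$ with short-time Fourier transform $V_\varphi f(x,\omega)=\langle f,e^{2\pi i\omega\cdot(\,\cdot\,)}\varphi(\cdot-x)\rangle$ in $L^p(\mathbb{R}^{2n})$ for a fixed nonzero Schwartz window $\varphi$; $M^\infty=(M^1)'$. For $C\in\mathrm{GL}(2d,\mathbb{R})$ and a function $\Phi$ on $\mathbb{R}^{2d}$, $\mathfrak{T}_C\Phi(x,y)=\Phi\big(C(x,y)^{\top}\big)$; on $M^\infty(\mathbb{R}^{2d})$ it is defined by $\langle\mathfrak{T}_Ck,\Phi\rangle=|\det C|^{-1}\langle k,\mathfrak{T}_{C^{-1}}\Phi\rangle$, $\Phi\in M^1(\mathbb{R}^{2d})$. $\mathcal{F}_2$ is the partial Fourier transform in the second variable, $\mathcal{F}_2\Phi(x,\omega)=\int_{\mathbb{R}^d}e^{-2\pi i\omega\cdot t}\Phi(x,t)\,dt$, extended to $M^\infty(\mathbb{R}^{2d})$ by $\langle\mathcal{F}_2k,\Phi\rangle=\langle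 k,\mathcal{F}_2^{-1}\Phi\rangle$. With $f\otimes\overline g(x,y)=f(x)\overline{g(y)}$, the matrix-Wigner distribution associated with $A\in\mathrm{GL}(2d,\mathbb{R})$ is $\mathcal{B}_A(f,g)=\mathcal{F}_2\mathfrak{T}_A(f\otimes\overline g)$, which maps $M^1(\mathbb{R}^d)\times M^1(\mathbb{R}^d)$ into $M^1(\mathbb{R}^{2d})$. For $\sigma\in M^\infty(\mathbb{R}^{2d})$ the operator $\sigma^A:M^1(\mathbb{R}^d)\to M^\infty(\mathbb{R}^d)$ is defined by $\langle\sigma^Af,g\rangle=\langle\sigma,\mathcal{B}_A(g,f)\rangle$ for $f,g\in M^1(\mathbb{R}^d)$. *)

theory Defs
  imports "HOL-Analysis.Analysis"
begin

section \<open>Schwartz functions and tempered distributions\<close>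

definition iter_deriv :: "'a::euclidean_space list \<Rightarrow> ('a \<Rightarrow> complex) \<Rightarrow> 'a \<Rightarrow> complex" where
  "iter_deriv bs f = foldr (\<lambda>b g x. frechet_derivative g (at x) b) bs f"

definition schwartz :: "('a::euclidean_space \<Rightarrow> complex) set" where
  "schwartz = {f. \<forall>bs\<in>lists Basis.
      (\<forall>x. iter_deriv bs f differentiable (at x)) \<and>
      (\<forall>N::nat. \<exists>C. \<forall>x. (1 + norm x) ^ N * norm (iter_deriv bs f x) \<le> C)}"

definition schwartz_seminorm :: "nat \<Rightarrow> ('a::euclidean_space \<Rightarrow> complex) \<Rightarrow> real" where
  "schwartz_seminorm N f =
     (\<Sum>bs | bs \<in> lists Basis \<and> length bs \<le> N.
        SUP x. (1 + norm x) ^ N * norm (iter_deriv bs f x))"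

definition conj_linear_on ::
    "('a \<Rightarrow> complex) set \<Rightarrow> (('a \<Rightarrow> complex) \<Rightarrow> complex) \<Rightarrow> bool" where
  "conj_linear_on X k \<longleftrightarrow>
     (\<forall>f\<in>X. \<forall>g\<in>X. \<forall>a b. k (\<lambda>x. a * f x + b * g x) = cnj a * k f + cnj b * k g)"

text \<open>Since brackets are conjugate-linear in the second argument, a distribution \<open>u\<close> is the
  conjugate-linear functional \<open>\<Phi> \<mapsto> \<langle>u, \<Phi>\<rangle>\<close>. Its values outside \<open>schwartz\<close> are irrelevant here.\<close>

definition tempered :: "(('a::euclidean_space \<Rightarrow> complex) \<Rightarrow> complex) set" where
  "tempered = {u. conj_linear_on schwartz u \<and>
     (\<exists>C N. \<forall>\<Phi>\<in>schwartz. norm (u \<Phi>) \<le> C * schwartz_seminorm N \<Phi>)}"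

definition regular_dist ::
    "('a::euclidean_space \<Rightarrow> complex) \<Rightarrow> ('a \<Rightarrow> complex) \<Rightarrow> complex" where
  "regular_dist f \<Phi> = (LINT x|lborel. f x * cnj (\<Phi> x))"


section \<open>Modulation spaces\<close>

definition stft :: "('a::euclidean_space \<Rightarrow> complex) \<Rightarrow> (('a \<Rightarrow> complex) \<Rightarrow> complex)
    \<Rightarrow> 'a \<times> 'a \<Rightarrow> complex" where
  "stft \<phi> u = (\<lambda>(x, \<omega>). u (\<lambda>t. exp (2 * pi * \<i> * (\<omega> \<bullet> t)) * \<phi> (t - x)))"

definition M1_dist :: "('a::euclidean_space \<Rightarrow> complex) \<Rightarrow> (('a \<Rightarrow> complex) \<Rightarrow> complex) set" where
  "M1_dist \<phi> = {u \<in> tempered. integrable lborel (stft \<phi> u)}"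

definition Minf_dist :: "('a::euclidean_space \<Rightarrow> complex) \<Rightarrow> (('a \<Rightarrow> complex) \<Rightarrow> complex) set" where
  "Minf_dist \<phi> = {u \<in> tempered. stft \<phi> u \<in> borel_measurable lborel \<and>
     (\<exists>C. AE z in lborel. norm (stft \<phi> u z) \<le> C)}"

text \<open>Every distribution in \<open>M1_dist \<phi>\<close> is given by a unique continuous function; \<open>M1 \<phi>\<close>
  consists of these functions.\<close>

definition M1 :: "('a::euclidean_space \<Rightarrow> complex) \<Rightarrow> ('a \<Rightarrow> complex) set" where
  "M1 \<phi> = {f. continuous_on UNIV f \<and>
     (\<forall>\<Phi>\<in>schwartz. integrable lborel (\<lambda>x. f x * cnj (\<Phi> x))) \<and>
     regular_dist f \<in> M1_dist \<phi>}"

definition M1_norm :: "('a::euclidean_space \<Rightarrow> complex) \<Rightarrow> ('a \<Rightarrow> complex) \<Rightarrow> real" where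
  "M1_norm \<phi> f = (LINT z|lborel. norm (stft \<phi> (regular_dist f) z))"

text \<open>A tempered distribution with bounded short-time Fourier transform extends uniquely to a
  bounded conjugate-linear functional on \<open>M1 \<phi>\<close>, because \<open>schwartz\<close> is dense there; this is the
  identification of \<open>M\<^sup>\<infinity>\<close> with the dual of \<open>M\<^sup>1\<close>. Elements of \<open>Minf \<phi>\<close> are these
  extensions, so that \<open>k \<Phi>\<close> is the bracket \<open>\<langle>k, \<Phi>\<rangle>\<close>. The value \<open>0\<close> outside \<open>M1 \<phi>\<close> makes equality
  of elements the equality of functionals on \<open>M1 \<phi>\<close>; the operators below follow this
  convention, also in their arguments from \<open>M1 \<phi>\<close>.\<close>

definition Minf :: "('a::euclidean_space \<Rightarrow> complex) \<Rightarrow> (('a \<Rightarrow> complex) \<Rightarrow> complex) set" where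
  "Minf \<phi> = {k \<in> Minf_dist \<phi>. conj_linear_on (M1 \<phi>) k \<and>
     (\<exists>C. \<forall>\<Phi>\<in>M1 \<phi>. norm (k \<Phi>) \<le> C * M1_norm \<phi> \<Phi>) \<and>
     (\<forall>\<Phi>. \<Phi> \<notin> M1 \<phi> \<longrightarrow> k \<Phi> = 0)}"


section \<open>Coordinate changes and partial Fourier transform\<close>

definition stack :: "(real^'n) \<times> (real^'n) \<Rightarrow> real^('n + 'n)" where
  "stack p = (\<chi> i. case i of Inl j \<Rightarrow> fst p $ j | Inr j \<Rightarrow> snd p $ j)"

definition unstack :: "real^('n + 'n) \<Rightarrow> (real^'n) \<times> (real^'n)" where
  "unstack v = (\<chi> j. v $ Inl j, \<chi> j. v $ Inr j)"

definition coord_change :: "real^('n::finite + 'n)^('n + 'n) \<Rightarrow>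
    ((real^'n) \<times> (real^'n) \<Rightarrow> complex) \<Rightarrow> (real^'n) \<times> (real^'n) \<Rightarrow> complex" where
  "coord_change C \<Phi> p = \<Phi> (unstack (C *v stack p))"

definition fourier2 ::
    "((real^'n) \<times> (real^'n) \<Rightarrow> complex) \<Rightarrow> (real^'n) \<times> (real^'n) \<Rightarrow> complex" where
  "fourier2 \<Phi> = (\<lambda>(x, \<omega>). LINT t|lborel. exp (- 2 * pi * \<i> * (\<omega> \<bullet> t)) * \<Phi> (x, t))"

definition fourier2_inv ::
    "((real^'n) \<times> (real^'n) \<Rightarrow> complex) \<Rightarrow> (real^'n) \<times> (real^'n) \<Rightarrow> complex" where
  "fourier2_inv \<Phi> = (\<lambda>(x, t). LINT \<omega>|lborel. exp (2 * pi * \<i> * (\<omega> \<bullet> t)) * \<Phi> (x, \<omega>))"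

text \<open>The extensions to \<open>Minf \<psi>\<close>.\<close>

definition coord_change_dist :: "((real^'n) \<times> (real^'n) \<Rightarrow> complex) \<Rightarrow>
    real^('n::finite + 'n)^('n + 'n) \<Rightarrow>
    (((real^'n) \<times> (real^'n) \<Rightarrow> complex) \<Rightarrow> complex) \<Rightarrow>
    ((real^'n) \<times> (real^'n) \<Rightarrow> complex) \<Rightarrow> complex" where
  "coord_change_dist \<psi> C k \<Phi> =
     (if \<Phi> \<in> M1 \<psi> then complex_of_real (inverse \<bar>det C\<bar>) * k (coord_change (matrix_inv C) \<Phi>) else 0)"

definition fourier2_dist :: "((real^'n) \<times> (real^'n) \<Rightarrow> complex) \<Rightarrow>
    (((real^'n) \<times> (real^'n) \<Rightarrow> complex) \<Rightarrow> complex) \<Rightarrow>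
    ((real^'n) \<times> (real^'n) \<Rightarrow> complex) \<Rightarrow> complex" where
  "fourier2_dist \<psi> k \<Phi> = (if \<Phi> \<in> M1 \<psi> then k (fourier2_inv \<Phi>) else 0)"

definition fourier2_inv_dist :: "((real^'n) \<times> (real^'n) \<Rightarrow> complex) \<Rightarrow>
    (((real^'n) \<times> (real^'n) \<Rightarrow> complex) \<Rightarrow> complex) \<Rightarrow>
    ((real^'n) \<times> (real^'n) \<Rightarrow> complex) \<Rightarrow> complex" where
  "fourier2_inv_dist \<psi> k \<Phi> = (if \<Phi> \<in> M1 \<psi> then k (fourier2 \<Phi>) else 0)"


section \<open>Matrix-Wigner distributions and the operators \<open>\<sigma>\<^sup>A\<close>\<close>

definition tensor_conj :: "('a \<Rightarrow> complex) \<Rightarrow> ('a \<Rightarrow> complex) \<Rightarrow> 'a \<times> 'a \<Rightarrow> complex" where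
  "tensor_conj f g = (\<lambda>(x, y). f x * cnj (g y))"

definition matrix_wigner :: "real^('n::finite + 'n)^('n + 'n) \<Rightarrow>
    (real^'n \<Rightarrow> complex) \<Rightarrow> (real^'n \<Rightarrow> complex) \<Rightarrow> (real^'n) \<times> (real^'n) \<Rightarrow> complex" where
  "matrix_wigner A f g = fourier2 (coord_change A (tensor_conj f g))"

definition matrix_op :: "(real^'n \<Rightarrow> complex) \<Rightarrow> real^('n::finite + 'n)^('n + 'n) \<Rightarrow>
    (((real^'n) \<times> (real^'n) \<Rightarrow> complex) \<Rightarrow> complex) \<Rightarrow>
    (real^'n \<Rightarrow> complex) \<Rightarrow> (real^'n \<Rightarrow> complex) \<Rightarrow> complex" where
  "matrix_op \<phi> A \<sigma> f g =
     (if f \<in> M1 \<phi> \<and> g \<in> M1 \<phi> then \<sigma> (matrix_wigner A g f) else 0)"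

end

theory Submission
  imports Defs "HOL-Probability.Characteristic_Functions" "HOL-Probability.Sinc_Integral"
begin

text \<open>
  For a Schwartz window \<open>g \<noteq> 0\<close>, Fourier inversion in the frequency variable gives
  \<open>f = c \<integral> V\<^sub>g f(z) \<pi>(z)g dz\<close> with \<open>\<pi>(z)g\<close> the time-frequency shifts of \<open>g\<close>, and
  \<open>\<bar>V\<^sub>h(\<pi>(z)g)\<bar>\<close> is a translate of \<open>\<bar>V\<^sub>h g\<bar>\<close>. Hence an operator that maps the shifts of the Gaussian
  to shifts of a fixed Schwartz function, up to phases, is bounded on \<open>M\<^sup>1\<close>; this applies to the change
  of window, to coordinate changes, to \<open>\<F>\<^sub>2\<close> and to tensor products.

  So \<open>k(F) = \<sigma>(\<F>\<^sub>2 \<TT>\<^sub>A F) - \<rho>(\<F>\<^sub>2 \<TT>\<^sub>B F)\<close> is a bounded functional on \<open>M\<^sup>1\<close>, and \<open>\<sigma>\<^sup>A = \<rho>\<^sup>B\<close>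
  says that it vanishes on tensors. The shifts of the Gaussian are tensors and their span is
  dense, so \<open>k = 0\<close>; evaluate at \<open>F = \<TT>\<^sub>A\<^sup>-\<^sup>1 \<F>\<^sub>2\<^sup>-\<^sup>1 \<Phi>\<close>.
\<close>

section \<open>Product integrals and the Fourier transform of the Gaussian\<close>

text \<open>The window in \<open>M1\<close> is arbitrary, and an element of \<open>M1\<close> is
  only known to be integrable against Schwartz functions. Reconstruction is therefore proved under
  that weak assumption; it identifies \<open>M1 \<phi>\<close> and \<open>M1 \<psi>\<close> with one
  concrete space, \<open>feichtinger gauss\<close>, in which all later estimates take place. The
  Gaussian is chosen because the Fourier transform fixes it and because it factors over products,
  which makes its shifts on the product space tensors. Integrals with values in M^1 are avoided:
  superpositions of shifts are pointwise integrals, and norm bounds come from Fubini applied to the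
  short-time Fourier transform. Fubini for an integrable function controls only almost every fibre,
  whereas the inversion of \<open>fourier2\<close> is wanted at each point; the Gaussian expansion
  closes this gap, since it converges absolutely on every fibre. The quotient of determinants in the
  theorem cancels the normalisation in \<open>coord_change_dist\<close>, so that the right-hand side
  becomes \<open>\<rho>\<close> evaluated at a transformed function.\<close>

lemma lborel_product_integrable:
  fixes f :: "'a::euclidean_space \<Rightarrow> real \<Rightarrow> 'b::{real_normed_field,banach,second_countable_topology}"
  assumes f: "\<And>b. b \<in> Basis \<Longrightarrow> integrable lborel (f b)"
  shows "integrable lborel (\<lambda>x. \<Prod>b\<in>Basis. f b (x \<bullet> b))"
    and "(LINT x|lborel. (\<Prod>b\<in>Basis. f b (x \<bullet> b))) = (\<Prod>b\<in>Basis. integral\<^sup>L lborel (f b))"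
proof -
  interpret product_sigma_finite "\<lambda>_. lborel :: real measure" by standard
  have m: "(\<lambda>x. \<Prod>b\<in>Basis. f b (x \<bullet> b)) \<in> borel_measurable borel"
  proof (intro borel_measurable_prod)
    fix b :: 'a assume "b \<in> Basis"
    from f[OF this] have "f b \<in> borel_measurable borel" by auto
    then show "(\<lambda>x. f b (x \<bullet> b)) \<in> borel_measurable borel"
      by (rule measurable_compose[rotated]) simp
  qed
  \<comment> \<open>\<open>lborel_eq\<close> presents Lebesgue measure as the image, under this
    assembly of a vector from its coordinates, of a finite product of one-dimensional Lebesgue
    measures.\<close>
  have m2: "(\<lambda>g. \<Sum>b\<in>Basis. g b *\<^sub>R b) \<in> (\<Pi>\<^sub>M b\<in>Basis. lborel) \<rightarrow>\<^sub>M (borel :: 'a measure)"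
    by measurable
  have e: "(\<Prod>b\<in>Basis. f b ((\<Sum>c\<in>Basis. g c *\<^sub>R c) \<bullet> b)) = (\<Prod>b\<in>Basis. f b (g b))"
    for g :: "'a \<Rightarrow> real"
    by (intro prod.cong refl) (simp add: inner_sum_left inner_Basis if_distrib cong: if_cong)
  show "integrable lborel (\<lambda>x. \<Prod>b\<in>Basis. f b (x \<bullet> b))"
    by (subst lborel_eq, subst integrable_distr_eq[OF m2 m], unfold e)
      (intro product_integrable_prod finite_Basis f)
  show "(LINT x|lborel. (\<Prod>b\<in>Basis. f b (x \<bullet> b))) = (\<Prod>b\<in>Basis. integral\<^sup>L lborel (f b))"
    by (subst lborel_eq, subst integral_distr[OF m2 m], unfold e)
      (intro product_integral_prod finite_Basis f)
qed

text \<open>The standard integrable majorant, used in position as well as in frequency. The product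
  form reduces its integrability to one dimension and fits bounds obtained one coordinate at a
  time.\<close>

definition wt :: "'a::euclidean_space \<Rightarrow> real" where
  "wt x = (\<Prod>b\<in>Basis. inverse (1 + (x \<bullet> b)\<^sup>2))"

lemma wt_pos: "0 < wt x"
  unfolding wt_def by (intro prod_pos ballI) (simp add: add_pos_nonneg)

lemma integrable_wt: "integrable lborel (wt :: 'a::euclidean_space \<Rightarrow> real)"
proof -
  have "integrable lborel (\<lambda>x::real. inverse (1 + x\<^sup>2))"
    using integrable_inverse_1_plus_square
    by (simp add: set_integrable_def einterval_eq_UNIV)
  from lborel_product_integrable(1)[of "\<lambda>b. \<lambda>x::real. inverse (1 + x\<^sup>2)", OF this]
  show ?thesis unfolding wt_def[abs_def] .
qed

text \<open>Each of the DIM('a) factors is at most (1 + |x|)^2. This turns Schwartz decay of order 2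
  DIM('a) into domination by \<open>wt\<close>.\<close>

lemma inverse_wt_le: "inverse (wt x) \<le> (1 + norm x) ^ (2 * DIM('a))" for x :: "'a::euclidean_space"
proof -
  have "inverse (wt x) = (\<Prod>b\<in>Basis. (1 + (x \<bullet> b)\<^sup>2))"
    unfolding wt_def by (simp add: prod_inversef[symmetric])
  also have "\<dots> \<le> (\<Prod>b\<in>(Basis::'a set). (1 + norm x)\<^sup>2)"
  proof (intro prod_mono conjI)
    fix b :: 'a assume b: "b \<in> Basis"
    have "(x \<bullet> b)\<^sup>2 \<le> (norm x)\<^sup>2"
      using Basis_le_norm[OF b, of x] by (metis abs_le_square_iff abs_norm_cancel)
    also have "1 + (norm x)\<^sup>2 \<le> (1 + norm x)\<^sup>2" by (simp add: power2_eq_square algebra_simps)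
    finally show "1 + (x \<bullet> b)\<^sup>2 \<le> (1 + norm x)\<^sup>2" by simp
  qed (simp add: add_nonneg_nonneg)
  also have "\<dots> = (1 + norm x) ^ (2 * DIM('a))" by (simp add: power_mult)
  finally show ?thesis .
qed

section \<open>Characters and the self-dual Gaussian\<close>

definition ch :: "real \<Rightarrow> complex" where "ch r = cis (2 * pi * r)"

lemma norm_ch [simp]: "norm (ch r) = 1" by (simp add: ch_def)
lemma ch_add: "ch (r + s) = ch r * ch s" by (simp add: ch_def cis_mult distrib_left)
lemma ch_0 [simp]: "ch 0 = 1" by (simp add: ch_def)
lemma cnj_ch [simp]: "cnj (ch r) = ch (- r)" by (simp add: ch_def cis_cnj)
lemma ch_diff: "ch (r - s) = ch r * ch (- s)" by (simp flip: ch_add)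

lemma ch_measurable [measurable]: "ch \<in> borel_measurable borel"
  unfolding ch_def[abs_def] by (intro borel_measurable_continuous_onI continuous_intros)

lemma continuous_on_ch [continuous_intros]: "continuous_on S f \<Longrightarrow> continuous_on S (\<lambda>x. ch (f x))"
  unfolding ch_def by (intro continuous_intros)

lemma exp_eq_ch: "exp (2 * complex_of_real pi * \<i> * complex_of_real r) = ch r"
  "exp (- (2 * complex_of_real pi * \<i> * complex_of_real r)) = ch (- r)"
  by (simp_all add: ch_def cis_conv_exp mult_ac)

text \<open>The factor pi normalises the Gaussian so that it has integral 1 and is its own Fourier
  transform.\<close>

definition gauss :: "'a::euclidean_space \<Rightarrow> complex" where
  "gauss t = of_real (exp (- (pi * (t \<bullet> t))))"

lemma continuous_on_gauss [continuous_intros]: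
  "continuous_on S f \<Longrightarrow> continuous_on S (\<lambda>x. gauss (f x))"
  unfolding gauss_def by (intro continuous_intros)

lemma gauss_measurable [measurable]: "gauss \<in> borel_measurable borel"
  unfolding gauss_def[abs_def] by measurable

lemma cnj_gauss [simp]: "cnj (gauss t) = gauss t" by (simp add: gauss_def)

lemma gauss_minus [simp]: "gauss (- t) = gauss t" by (simp add: gauss_def)

lemma norm_gauss_le: "norm (gauss t) \<le> 1" by (simp add: gauss_def)

text \<open>This is the characteristic function of the standard normal distribution. The
  substitution x = ct with c = sqrt(2 pi) turns exp(-x^2/2) into exp(-pi t^2), and its Jacobian
  absorbs the constant 1/c of the density.\<close>

lemma fourier_gauss_real:
  fixes s :: real
  shows "integrable lborel (\<lambda>t. ch (s * t) * of_real (exp (- (pi * t\<^sup>2))))"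
    and "(LINT t|lborel. ch (s * t) * of_real (exp (- (pi * t\<^sup>2)))) = of_real (exp (- (pi * s\<^sup>2)))"
proof -
  define c where "c = sqrt (2 * pi)"
  have c: "c > 0" "c\<^sup>2 = 2 * pi" by (auto simp: c_def)
  have [measurable]: "cis \<in> borel_measurable borel"
    by (intro borel_measurable_continuous_onI continuous_intros)
  have "integrable lborel (\<lambda>x. std_normal_density x)" by simp
  then have "integrable lborel (\<lambda>x. cis (c * s * x) * of_real (std_normal_density x))"
    by (rule Bochner_Integration.integrable_bound) (auto simp: norm_mult)
  then have i: "integrable lborel (\<lambda>t. cis (c * s * (c * t)) * of_real (std_normal_density (c * t)))"
    using lborel_integrable_real_affine[of "\<lambda>x. cis (c * s * x) * of_real (std_normal_density x)" c 0] c by simp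
  have e: "cis (c * s * (c * t)) * of_real (std_normal_density (c * t)) =
     of_real (1 / c) * (ch (s * t) * of_real (exp (- (pi * t\<^sup>2))))" for t
  proof -
    have 1: "c * s * (c * t) = 2 * pi * (s * t)" unfolding c(2)[symmetric] by (simp add: power2_eq_square)
    have 2: "std_normal_density (c * t) = 1 / c * exp (- (pi * t\<^sup>2))"
      unfolding std_normal_density_def c_def[symmetric] power_mult_distrib c(2) by simp
    show ?thesis unfolding 1 2 ch_def by simp
  qed
  show "integrable lborel (\<lambda>t. ch (s * t) * of_real (exp (- (pi * t\<^sup>2))))"
    using integrable_mult_right[of "of_real c", OF i[unfolded e]] c by simp
  have "of_real (exp (- (pi * s\<^sup>2))) = char std_normal_distribution (c * s)"
    unfolding char_std_normal_distribution using c by (simp add: power_mult_distrib)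
  also have "\<dots> = (LINT x|lborel. cis (c * s * x) * of_real (std_normal_density x))"
    unfolding char_def by (subst integral_density)
      (auto simp: scaleR_conv_of_real mult.commute cis_conv_exp intro!: Bochner_Integration.integral_cong)
  also have "\<dots> = of_real c * (LINT t|lborel. cis (c * s * (c * t)) * of_real (std_normal_density (c * t)))"
    using lborel_integral_real_affine[of c "\<lambda>x. cis (c * s * x) * of_real (std_normal_density x)" 0] c
    by (simp add: scaleR_conv_of_real)
  also have "\<dots> = (LINT t|lborel. ch (s * t) * of_real (exp (- (pi * t\<^sup>2))))"
    unfolding e using c by simp
  finally show "(LINT t|lborel. ch (s * t) * of_real (exp (- (pi * t\<^sup>2)))) = of_real (exp (- (pi * s\<^sup>2)))" ..
qed

lemma ch_sum: "finite I \<Longrightarrow> ch (sum f I) = (\<Prod>i\<in>I. ch (f i))"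
  by (induction I rule: finite_induct) (auto simp: ch_add)

lemma gauss_prod: "gauss t = (\<Prod>b\<in>Basis. of_real (exp (- (pi * (t \<bullet> b)\<^sup>2))))"
  unfolding gauss_def
  by (subst euclidean_inner) (simp add: exp_sum sum_distrib_left power2_eq_square flip: sum_negf of_real_prod)

lemma fourier_gauss:
  fixes s :: "'a::euclidean_space"
  shows "integrable lborel (\<lambda>t. ch (s \<bullet> t) * gauss t)"
    and "(LINT t|lborel. ch (s \<bullet> t) * gauss t) = gauss s"
proof -
  have e: "ch (s \<bullet> t) * gauss t =
      (\<Prod>b\<in>Basis. ch ((s \<bullet> b) * (t \<bullet> b)) * of_real (exp (- (pi * (t \<bullet> b)\<^sup>2))))" for t
    unfolding gauss_prod prod.distrib by (subst euclidean_inner) (simp add: ch_sum)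
  show "integrable lborel (\<lambda>t. ch (s \<bullet> t) * gauss t)"
    unfolding e
    using lborel_product_integrable(1)[of "\<lambda>b x. ch ((s \<bullet> b) * x) * complex_of_real (exp (- (pi * x\<^sup>2)))"]
      fourier_gauss_real(1) by blast
  show "(LINT t|lborel. ch (s \<bullet> t) * gauss t) = gauss s"
    unfolding e
    using lborel_product_integrable(2)[of "\<lambda>b x. ch ((s \<bullet> b) * x) * complex_of_real (exp (- (pi * x\<^sup>2)))"]
      fourier_gauss_real by (simp add: gauss_prod)
qed

lemma integrable_gauss: "integrable lborel (gauss :: 'a::euclidean_space \<Rightarrow> complex)"
  and integral_gauss: "integral\<^sup>L lborel (gauss :: 'a \<Rightarrow> complex) = 1"
  using fourier_gauss[of "0::'a"] by (simp_all add: gauss_def[of 0])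

section \<open>Affine substitutions in Lebesgue integrals\<close>

lemma lborel_affine_integrable:
  fixes f :: "'a::euclidean_space \<Rightarrow> 'b::{banach, second_countable_topology}"
  assumes c: "c \<noteq> 0"
  shows "integrable lborel f \<Longrightarrow> integrable lborel (\<lambda>x. f (t + c *\<^sub>R x))"
    and "integrable lborel f \<Longrightarrow>
      (LINT x|lborel. f x) = \<bar>c\<bar> ^ DIM('a) *\<^sub>R (LINT x|lborel. f (t + c *\<^sub>R x))"
proof -
  assume f: "integrable lborel f"
  then have [measurable]: "f \<in> borel_measurable borel" by auto
  have "integrable (density (distr lborel borel (\<lambda>x. t + c *\<^sub>R x)) (\<lambda>_. \<bar>c\<bar>^DIM('a))) f"
    using f lborel_affine[OF c, of t] by simp
  then have "integrable lborel (\<lambda>x. \<bar>c\<bar> ^ DIM('a) *\<^sub>R f (t + c *\<^sub>R x))"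
    by (simp add: integrable_density integrable_distr_eq)
  from integrable_scaleR_right[of "inverse (\<bar>c\<bar> ^ DIM('a))", OF this]
  show "integrable lborel (\<lambda>x. f (t + c *\<^sub>R x))"
    using c by simp
  show "(LINT x|lborel. f x) = \<bar>c\<bar> ^ DIM('a) *\<^sub>R (LINT x|lborel. f (t + c *\<^sub>R x))"
    by (subst lborel_affine[OF c, of t]) (simp add: integral_density integral_distr)
qed

lemma lborel_translate_integrable:
  fixes f :: "'a::euclidean_space \<Rightarrow> 'b::{banach, second_countable_topology}"
  shows "integrable lborel (\<lambda>x. f (x + t)) \<longleftrightarrow> integrable lborel f"
proof
  show "integrable lborel (\<lambda>x. f (x + t))" if "integrable lborel f"
    using lborel_affine_integrable(1)[of 1 f t, OF _ that] by (simp add: add.commute)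
  show "integrable lborel f" if "integrable lborel (\<lambda>x. f (x + t))"
    using lborel_affine_integrable(1)[of 1 "\<lambda>x. f (x + t)" "-t", OF _ that] by (simp add: add.commute)
qed

lemma lborel_translate_integral:
  fixes f :: "'a::euclidean_space \<Rightarrow> 'b::{banach, second_countable_topology}"
  shows "(LINT x|lborel. f (x + t)) = integral\<^sup>L lborel f"
proof (cases "integrable lborel f")
  case True
  then show ?thesis using lborel_affine_integrable(2)[of 1 f t] by (simp add: add.commute)
next
  \<comment> \<open>Neither function is integrable, so both integrals have the default value
    0.\<close>
  case False
  then show ?thesis by (simp add: not_integrable_integral_eq lborel_translate_integrable)
qed

lemma lborel_reflect_integrable:
  fixes f :: "'a::euclidean_space \<Rightarrow> 'b::{banach, second_countable_topology}"
  shows "integrable lborel (\<lambda>x. f (t - x)) \<longleftrightarrow> integrable lborel f"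
proof
  show "integrable lborel (\<lambda>x. f (t - x))" if "integrable lborel f"
    using lborel_affine_integrable(1)[of "-1" f t, OF _ that] by simp
  show "integrable lborel f" if "integrable lborel (\<lambda>x. f (t - x))"
    using lborel_affine_integrable(1)[of "-1" "\<lambda>x. f (t - x)" "t", OF _ that] by simp
qed

lemma lborel_reflect_integral:
  fixes f :: "'a::euclidean_space \<Rightarrow> 'b::{banach, second_countable_topology}"
  shows "(LINT x|lborel. f (t - x)) = integral\<^sup>L lborel f"
proof (cases "integrable lborel f")
  case True
  then show ?thesis using lborel_affine_integrable(2)[of "-1" f t] by simp
next
  case False
  then show ?thesis by (simp add: not_integrable_integral_eq lborel_reflect_integrable)
qed

section \<open>Fourier inversion\<close>

lemmas lborel_Fubini_integrable = lborel_pair.Fubini_integrable[unfolded lborel_prod]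
  and lborel_integrable_fst = lborel_pair.integrable_fst'[unfolded lborel_prod]
  and lborel_AE_integrable_fst = lborel_pair.AE_integrable_fst'[unfolded lborel_prod]
  and lborel_integral_fst = lborel_pair.integral_fst'[unfolded lborel_prod]
  and lborel_integrable_snd = lborel_pair.integrable_snd[unfolded lborel_prod]
  and lborel_Fubini_integral = lborel_pair.Fubini_integral[unfolded lborel_prod]

lemma lborel_integrable_product:
  fixes u :: "'a::euclidean_space \<Rightarrow> 'c::{real_normed_field, banach, second_countable_topology}"
    and v :: "'b::euclidean_space \<Rightarrow> 'c"
  assumes u: "integrable lborel u" and v: "integrable lborel v"
  shows "integrable lborel (\<lambda>z. u (fst z) * v (snd z))"
proof (rule lborel_Fubini_integrable)
  have [measurable]: "u \<in> borel_measurable borel" "v \<in> borel_measurable borel" using u v by auto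
  show "(\<lambda>z. u (fst z) * v (snd z)) \<in> borel_measurable lborel"
    unfolding measurable_lborel2 borel_prod[symmetric] by measurable
  show "integrable lborel (\<lambda>x. LINT y|lborel. norm (u (fst (x, y)) * v (snd (x, y))))"
    using u v by (simp add: norm_mult)
  show "AE x in lborel. integrable lborel (\<lambda>y. u (fst (x, y)) * v (snd (x, y)))"
    using v by simp
qed

lemma lborel_integrable_product_bound:
  fixes F :: "'a::euclidean_space \<times> 'b::euclidean_space \<Rightarrow> 'c::{banach, second_countable_topology}"
    and u :: "'a \<Rightarrow> real" and v :: "'b \<Rightarrow> real"
  assumes F: "F \<in> borel_measurable borel"
    and uv: "integrable lborel u" "integrable lborel v"
    and le: "\<And>x y. norm (F (x, y)) \<le> u x * v y"
  shows "integrable lborel F"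
proof (rule Bochner_Integration.integrable_bound[OF lborel_integrable_product[OF uv]])
  show "AE z in lborel. norm (F z) \<le> norm (u (fst z) * v (snd z))"
    using le by (intro AE_I2) (smt (verit) prod.collapse real_norm_def)
qed (use F in simp)

lemma continuous_on_lborel_integral:
  fixes f :: "'t::metric_space \<Rightarrow> 'a \<Rightarrow> 'c::{banach, second_countable_topology}"
  assumes m: "\<And>t. f t \<in> borel_measurable M" and w: "integrable M w"
    and le: "\<And>t x. norm (f t x) \<le> w x"
    and c: "\<And>x. continuous_on UNIV (\<lambda>t. f t x)"
  shows "continuous_on UNIV (\<lambda>t. LINT x|M. f t x)"
proof (unfold continuous_on_sequentially, intro allI ballI impI)
  fix X and a :: 't assume X: "(\<forall>n. X n \<in> UNIV) \<and> X \<longlonglongrightarrow> a"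
  show "((\<lambda>t. LINT x|M. f t x) \<circ> X) \<longlonglongrightarrow> (LINT x|M. f a x)"
    unfolding o_def
  proof (rule integral_dominated_convergence[OF m m w])
    show "AE x in M. (\<lambda>i. f (X i) x) \<longlonglongrightarrow> f a x"
      using c X by (intro AE_I2) (auto simp: continuous_on_sequentially o_def)
  qed (use le in auto)
qed

text \<open>Supplies the summability kernel for Fourier inversion: a factor gauss(s/k) in frequency
  amounts to convolution with the approximate identity k^d gauss(k v), where d is the
  dimension.\<close>

lemma gauss_dilation:
  fixes v :: "'a::euclidean_space" and k :: nat
  assumes k: "k > 0"
  shows "integrable lborel (\<lambda>s::'a. gauss (s /\<^sub>R k))"
    and "(LINT s|lborel. ch (s \<bullet> v) * gauss (s /\<^sub>R k)) = of_nat k ^ DIM('a) * gauss (k *\<^sub>R v)"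
proof -
  show "integrable lborel (\<lambda>s::'a. gauss (s /\<^sub>R k))"
    using lborel_affine_integrable(1)[of "inverse k" gauss 0] integrable_gauss k by simp
  have "integrable lborel (\<lambda>s. ch ((k *\<^sub>R v) \<bullet> s) * gauss s)"
    by (rule fourier_gauss)
  from lborel_affine_integrable(1)[of "inverse k", OF _ this, of 0]
  have i: "integrable lborel (\<lambda>s. ch (s \<bullet> v) * gauss (s /\<^sub>R k))"
    using k by (simp add: inner_commute flip: mult.assoc)
  show "(LINT s|lborel. ch (s \<bullet> v) * gauss (s /\<^sub>R k)) = of_nat k ^ DIM('a) * gauss (k *\<^sub>R v)"
    using lborel_affine_integrable(2)[of k, OF _ i, of 0] k fourier_gauss(2)[of "k *\<^sub>R v"]
    by (simp add: scaleR_conv_of_real inner_commute)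
qed

text \<open>At distance at least d from t the kernel is at most k^n exp(-pi d^2 k^2) with n =
  DIM('a), which tends to 0 and multiplies the fixed L^1 norm of \<open>r\<close>.\<close>

lemma gauss_approximation_far:
  fixes r :: "'a::euclidean_space \<Rightarrow> complex"
  assumes r: "integrable lborel r" and d: "0 < d" and z: "\<And>s. dist s t < d \<Longrightarrow> r s = 0"
  shows "(\<lambda>k::nat. LINT s|lborel. r s * (of_nat k ^ DIM('a) * gauss (k *\<^sub>R (t - s)))) \<longlonglongrightarrow> 0"
proof (rule Lim_null_comparison)
  have [measurable]: "r \<in> borel_measurable borel" using r by auto
  define B where "B k = real k ^ DIM('a) * exp (- (pi * d\<^sup>2 * (real k)\<^sup>2))" for k
  define I where "I = (LINT s|lborel. norm (r s))"
  have le: "norm (r s * (of_nat k ^ DIM('a) * gauss (k *\<^sub>R (t - s)))) \<le> B k * norm (r s)" for k s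
  proof (cases "dist s t < d")
    case False
    then have "d\<^sup>2 \<le> (norm (t - s))\<^sup>2"
      using d by (intro power_mono) (auto simp: dist_norm norm_minus_commute)
    then have "pi * d\<^sup>2 * (real k)\<^sup>2 \<le> pi * (norm (t - s))\<^sup>2 * (real k)\<^sup>2"
      by (intro mult_right_mono mult_left_mono) auto
    then have "norm (gauss (k *\<^sub>R (t - s))) \<le> exp (- (pi * d\<^sup>2 * (real k)\<^sup>2))"
      unfolding gauss_def norm_of_real abs_exp_cancel exp_le_cancel_iff
      by (simp add: power2_norm_eq_inner) (simp add: power2_eq_square mult_ac)
    then show ?thesis
      by (simp add: B_def norm_mult norm_power mult.commute mult_left_mono)
  qed (simp add: z)
  show "\<forall>\<^sub>F k in sequentially. norm (LINT s|lborel. r s * (of_nat k ^ DIM('a) * gauss (k *\<^sub>R (t - s)))) \<le> B k * I"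
  proof (intro always_eventually allI)
    fix k
    have "norm (LINT s|lborel. r s * (of_nat k ^ DIM('a) * gauss (k *\<^sub>R (t - s))))
        \<le> (LINT s|lborel. B k * norm (r s))"
    proof (rule Bochner_Integration.integral_norm_bound_integral[OF _ _ le])
      show i: "integrable lborel (\<lambda>s. B k * norm (r s))" using r by simp
      show "integrable lborel (\<lambda>s. r s * (of_nat k ^ DIM('a) * gauss (k *\<^sub>R (t - s))))"
        using le[of _ k] by (intro Bochner_Integration.integrable_bound[OF i] AE_I2)
          (auto intro: order_trans[OF _ abs_ge_self])
    qed
    then show "norm (LINT s|lborel. r s * (of_nat k ^ DIM('a) * gauss (k *\<^sub>R (t - s)))) \<le> B k * I"
      by (simp add: I_def)
  qed
  define c where "c = pi * d\<^sup>2"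
  have c: "c > 0" using d by (simp add: c_def)
  have "filterlim (\<lambda>k. c * (real k)\<^sup>2) at_top sequentially"
    using c by (intro filterlim_tendsto_pos_mult_at_top[OF tendsto_const] filterlim_pow_at_top filterlim_real_sequentially) auto
  from filterlim_compose[OF tendsto_power_div_exp_0[of "DIM('a)"] this]
  have lim: "(\<lambda>k. inverse (c ^ DIM('a)) * ((c * (real k)\<^sup>2) ^ DIM('a) / exp (c * (real k)\<^sup>2))) \<longlonglongrightarrow> 0"
    by (rule tendsto_mult_right_zero)
  have "B \<longlonglongrightarrow> 0"
  proof (rule tendsto_sandwich[OF _ _ tendsto_const lim])
    show "\<forall>\<^sub>F k in sequentially. B k \<le> inverse (c ^ DIM('a)) * ((c * (real k)\<^sup>2) ^ DIM('a) / exp (c * (real k)\<^sup>2))"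
    proof (intro always_eventually allI)
      fix k
      \<comment> \<open>Replacing k^n by (k^2)^n brings the bound into the form y^n / exp y with y =
        c k^2.\<close>
      have "real k \<le> (real k)\<^sup>2" by (cases k) (auto simp: power2_eq_square)
      then have "real k ^ DIM('a) \<le> ((real k)\<^sup>2) ^ DIM('a)" by (intro power_mono) auto
      then show "B k \<le> inverse (c ^ DIM('a)) * ((c * (real k)\<^sup>2) ^ DIM('a) / exp (c * (real k)\<^sup>2))"
        using c by (simp add: B_def c_def[symmetric] exp_minus power_mult_distrib divide_simps)
    qed
  qed (simp add: B_def)
  then show "(\<lambda>k. B k * I) \<longlonglongrightarrow> 0" by (rule tendsto_mult_left_zero)
qed

text \<open>Substituting t - s/k for s moves k from the kernel into the argument of
  \<open>b\<close>. Boundedness of \<open>b\<close> then gives the majorant B |gauss|, and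
  continuity at t the pointwise limit.\<close>

lemma gauss_approximation_bounded:
  fixes b :: "'a::euclidean_space \<Rightarrow> complex"
  assumes b: "integrable lborel b" and bd: "\<And>s. norm (b s) \<le> B" and c: "isCont b t"
  shows "(\<lambda>k::nat. LINT s|lborel. b s * (of_nat k ^ DIM('a) * gauss (k *\<^sub>R (t - s)))) \<longlonglongrightarrow> b t"
proof -
  have [measurable]: "b \<in> borel_measurable borel" using b by auto
  have eq: "(LINT s|lborel. b s * (of_nat k ^ DIM('a) * gauss (k *\<^sub>R (t - s)))) =
      (LINT s|lborel. b (t - s /\<^sub>R k) * gauss s)" if k: "k > 0" for k :: nat
  proof -
    have "integrable lborel (\<lambda>s. gauss ((- real k) *\<^sub>R s + k *\<^sub>R t))"
      using lborel_affine_integrable(1)[of "- real k" gauss "k *\<^sub>R t"] integrable_gauss k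
      by (simp add: add.commute)
    then have i1: "integrable lborel (\<lambda>s. gauss (k *\<^sub>R (t - s)))"
      by (simp add: algebra_simps)
    then have "integrable lborel (\<lambda>s. (B * of_nat k ^ DIM('a)) * gauss (k *\<^sub>R (t - s)))"
      by simp
    then have i: "integrable lborel (\<lambda>s. b s * (of_nat k ^ DIM('a) * gauss (k *\<^sub>R (t - s))))"
      by (rule Bochner_Integration.integrable_bound)
        (auto simp: norm_mult norm_power abs_mult mult.assoc intro!: AE_I2 mult_right_mono order_trans[OF bd abs_ge_self])
    have e: "b (t + (- inverse (real k)) *\<^sub>R s) * (of_nat k ^ DIM('a) * gauss (k *\<^sub>R (t - (t + (- inverse (real k)) *\<^sub>R s))))
        = of_nat k ^ DIM('a) * (b (t - s /\<^sub>R k) * gauss s)" for s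
      using k by simp
    show ?thesis
      using lborel_affine_integrable(2)[of "- inverse (real k)", OF _ i, of t] k
      unfolding e by (simp add: scaleR_conv_of_real power_inverse)
  qed
  have "(\<lambda>k::nat. LINT s|lborel. b (t - s /\<^sub>R k) * gauss s) \<longlonglongrightarrow> (LINT s|lborel. b t * gauss (s::'a))"
  proof (rule integral_dominated_convergence)
    show "integrable lborel (\<lambda>s. B * norm (gauss s))" using integrable_gauss by (intro integrable_mult_right integrable_norm)
    show "AE s in lborel. (\<lambda>k::nat. b (t - s /\<^sub>R k) * gauss s) \<longlonglongrightarrow> b t * gauss s"
    proof (intro AE_I2 tendsto_mult tendsto_const isCont_tendsto_compose[OF c])
      fix s :: 'a
      have "(\<lambda>k. t - inverse (real k) *\<^sub>R s) \<longlonglongrightarrow> t - 0 *\<^sub>R s"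
        by (intro tendsto_intros lim_inverse_n)
      then show "(\<lambda>k. t - s /\<^sub>R real k) \<longlonglongrightarrow> t" by simp
    qed
    show "AE s in lborel. norm (b (t - s /\<^sub>R k) * gauss s) \<le> B * norm (gauss s)" for k :: nat
      using bd by (auto simp: norm_mult intro!: AE_I2 mult_right_mono)
  qed measurable
  also have "(LINT s|lborel. b t * gauss (s::'a)) = b t" by (simp add: integral_gauss)
  finally show ?thesis
    by (rule Lim_transform_eventually) (use eq in \<open>auto simp: eventually_sequentially intro!: exI[of _ 1]\<close>)
qed

text \<open>Since \<open>h\<close> may be unbounded, it is cut at a small ball around \<open>t\<close>: the far part is killed by
  the decay of the dilated Gaussian, the near part is bounded.\<close>

lemma gauss_approximation:
  fixes h :: "'a::euclidean_space \<Rightarrow> complex"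
  assumes h: "integrable lborel h" and c: "continuous_on UNIV h"
  shows "(\<lambda>k::nat. LINT s|lborel. h s * (of_nat k ^ DIM('a) * gauss (k *\<^sub>R (t - s)))) \<longlonglongrightarrow> h t"
proof -
  have [measurable]: "h \<in> borel_measurable borel" using h by auto
  have "isCont h t" using c by (simp add: continuous_on_eq_continuous_at)
  then obtain d where d: "d > 0" and dd: "\<And>s. dist s t < d \<Longrightarrow> dist (h s) (h t) < 1"
    unfolding continuous_at_eps_delta by (meson zero_less_one)
  define b where "b s = indicator (ball t d) s *\<^sub>R h s" for s
  define r where "r s = indicator (- ball t d) s *\<^sub>R h s" for s
  have ib: "integrable lborel b" and ir: "integrable lborel r"
    unfolding b_def r_def by (intro integrable_mult_indicator h; simp)+
  have hbr: "h s = b s + r s" for s by (simp add: b_def r_def indicator_def)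
  have "norm (b s) \<le> norm (h t) + 1" for s
    using dd[of s] norm_triangle_ineq2[of "h s" "h t"]
    by (auto simp: b_def indicator_def dist_commute dist_norm add_nonneg_nonneg norm_minus_commute)
  moreover have "isCont b t"
  proof -
    have "\<forall>\<^sub>F s in nhds t. b s = h s"
      unfolding eventually_nhds using d by (intro exI[of _ "ball t d"]) (auto simp: b_def)
    then show ?thesis using \<open>isCont h t\<close> isCont_cong by blast
  qed
  ultimately have 1: "(\<lambda>k::nat. LINT s|lborel. b s * (of_nat k ^ DIM('a) * gauss (k *\<^sub>R (t - s)))) \<longlonglongrightarrow> b t"
    by (intro gauss_approximation_bounded[OF ib])
  have 2: "(\<lambda>k::nat. LINT s|lborel. r s * (of_nat k ^ DIM('a) * gauss (k *\<^sub>R (t - s)))) \<longlonglongrightarrow> 0"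
    by (rule gauss_approximation_far[OF ir d]) (auto simp: r_def dist_commute)
  have i: "integrable lborel (\<lambda>s. f s * (of_nat k ^ DIM('a) * gauss (k *\<^sub>R (t - s))))"
    if f: "integrable lborel f" for k :: nat and f :: "'a \<Rightarrow> complex"
  proof (rule Bochner_Integration.integrable_bound)
    show "integrable lborel (\<lambda>s. f s * of_nat k ^ DIM('a))" using f by simp
    have [measurable]: "f \<in> borel_measurable borel" using f by auto
    show "(\<lambda>s. f s * (of_nat k ^ DIM('a) * gauss (k *\<^sub>R (t - s)))) \<in> borel_measurable lborel" by measurable
  qed (auto simp: norm_mult norm_power intro!: AE_I2 mult_left_mono mult_left_le norm_gauss_le)
  have e: "h s * c = b s * c + r s * c" for s c by (simp add: hbr distrib_right)
  have "b t = h t" using d by (simp add: b_def)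
  then show ?thesis
    using tendsto_add[OF 1 2] unfolding e Bochner_Integration.integral_add[OF i[OF ib] i[OF ir]] by simp
qed

text \<open>Gaussian summation: with the factor gauss(\<omega>/k) inserted, the k-th integral is a
  convolution of \<open>h\<close> with an approximate identity. It tends to the inversion integral
  by domination with \<open>H\<close>, and to h(t) at every point by continuity.\<close>

lemma fourier_inversion:
  fixes h :: "'a::euclidean_space \<Rightarrow> complex"
  assumes c: "continuous_on UNIV h" and h: "integrable lborel h"
  defines "H \<equiv> \<lambda>\<omega>. LINT s|lborel. h s * ch (- (\<omega> \<bullet> s))"
  assumes H: "integrable lborel H"
  shows "(LINT \<omega>|lborel. H \<omega> * ch (\<omega> \<bullet> t)) = h t"
proof -
  have [measurable]: "h \<in> borel_measurable borel" "H \<in> borel_measurable borel" using h H by auto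
  have "(\<lambda>k::nat. LINT \<omega>|lborel. H \<omega> * ch (\<omega> \<bullet> t) * gauss (\<omega> /\<^sub>R k)) \<longlonglongrightarrow> (LINT \<omega>|lborel. H \<omega> * ch (\<omega> \<bullet> t) * gauss (0::'a))"
  proof (rule integral_dominated_convergence)
    show "integrable lborel (\<lambda>\<omega>. norm (H \<omega>))" using H by simp
    show "AE \<omega> in lborel. (\<lambda>k::nat. H \<omega> * ch (\<omega> \<bullet> t) * gauss (\<omega> /\<^sub>R k)) \<longlonglongrightarrow> H \<omega> * ch (\<omega> \<bullet> t) * gauss (0::'a)"
    proof (intro AE_I2 tendsto_mult tendsto_const)
      fix \<omega> :: 'a
      have "(\<lambda>k. inverse (real k) *\<^sub>R \<omega>) \<longlonglongrightarrow> 0 *\<^sub>R \<omega>"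
        by (intro tendsto_intros lim_inverse_n)
      moreover have "isCont gauss (0 *\<^sub>R \<omega>)"
        using continuous_on_gauss[OF continuous_on_id, of "UNIV::'a set"] by (simp add: continuous_on_eq_continuous_at)
      ultimately show "(\<lambda>k. gauss (\<omega> /\<^sub>R real k)) \<longlonglongrightarrow> gauss (0::'a)"
        using isCont_tendsto_compose by fastforce
    qed
    show "AE \<omega> in lborel. norm (H \<omega> * ch (\<omega> \<bullet> t) * gauss (\<omega> /\<^sub>R k)) \<le> norm (H \<omega>)" for k :: nat
      by (auto simp: norm_mult intro!: mult_left_le norm_gauss_le)
  qed measurable
  also have "gauss (0::'a) = 1" by (simp add: gauss_def)
  finally have 1: "(\<lambda>k::nat. LINT \<omega>|lborel. H \<omega> * ch (\<omega> \<bullet> t) * gauss (\<omega> /\<^sub>R k)) \<longlonglongrightarrow> (LINT \<omega>|lborel. H \<omega> * ch (\<omega> \<bullet> t))"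
    by simp
  have eq: "(LINT \<omega>|lborel. H \<omega> * ch (\<omega> \<bullet> t) * gauss (\<omega> /\<^sub>R k)) =
      (LINT s|lborel. h s * (of_nat k ^ DIM('a) * gauss (k *\<^sub>R (t - s))))" if k: "k > 0" for k :: nat
  proof -
    let ?F = "\<lambda>\<omega> s. h s * ch (\<omega> \<bullet> (t - s)) * gauss (\<omega> /\<^sub>R k)"
    \<comment> \<open>The Gaussian factor supplies the decay in \<omega> that the double integral
      behind \<open>H\<close> lacks; this is what permits Fubini.\<close>
    have i: "integrable lborel (\<lambda>(\<omega>, s). ?F \<omega> s)"
    proof (rule lborel_integrable_product_bound)
      show "integrable lborel (\<lambda>\<omega>::'a. norm (gauss (\<omega> /\<^sub>R k) :: complex))" by (rule integrable_norm[OF gauss_dilation(1)[OF k]])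
      show "integrable lborel (\<lambda>s. norm (h s))" using h by simp
    qed (auto simp: norm_mult borel_prod[symmetric])
    have "(LINT \<omega>|lborel. H \<omega> * ch (\<omega> \<bullet> t) * gauss (\<omega> /\<^sub>R k)) = (LINT \<omega>|lborel. LINT s|lborel. ?F \<omega> s)"
      unfolding H_def integral_mult_left_zero[symmetric]
      by (intro Bochner_Integration.integral_cong refl) (simp add: inner_diff_right mult_ac flip: ch_add)
    also have "\<dots> = (LINT s|lborel. LINT \<omega>|lborel. ?F \<omega> s)"
      using lborel_Fubini_integral[OF i] by simp
    also have "\<dots> = (LINT s|lborel. h s * (of_nat k ^ DIM('a) * gauss (k *\<^sub>R (t - s))))"
      by (simp add: mult.assoc gauss_dilation(2)[OF k])
    finally show ?thesis .
  qed
  from 1 have "(\<lambda>k::nat. LINT s|lborel. h s * (of_nat k ^ DIM('a) * gauss (k *\<^sub>R (t - s)))) \<longlonglongrightarrow> (LINT \<omega>|lborel. H \<omega> * ch (\<omega> \<bullet> t))"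
    by (rule Lim_transform_eventually) (use eq in \<open>auto simp: eventually_sequentially intro!: exI[of _ 1]\<close>)
  then show ?thesis using gauss_approximation[OF h c] by (rule LIMSEQ_unique)
qed

section \<open>Short-time Fourier transforms of Schwartz functions\<close>

text \<open>The time-frequency shift of \<open>g\<close>. Position and frequency are packed into one
  point of phase space, so that covariance becomes plain subtraction in
  \<open>norm_stf_atom\<close>.\<close>

definition atom :: "('a::euclidean_space \<Rightarrow> complex) \<Rightarrow> 'a \<times> 'a \<Rightarrow> 'a \<Rightarrow> complex" where
  "atom g z t = ch (snd z \<bullet> t) * g (t - fst z)"

text \<open>The short-time Fourier transform of a function as an integral, in contrast to
  \<open>stft\<close>, which acts on distributions.\<close>

definition stf :: "('a::euclidean_space \<Rightarrow> complex) \<Rightarrow> ('a \<Rightarrow> complex) \<Rightarrow> 'a \<times> 'a \<Rightarrow> complex" where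
  "stf g f z = (LINT t|lborel. f t * cnj (atom g z t))"

lemma stft_regular_dist: "stft g (regular_dist f) = stf g f"
  unfolding stft_def regular_dist_def stf_def[abs_def] atom_def
  by (auto simp: exp_eq_ch)

text \<open>Any class closed under basis derivatives consists of Schwartz functions once its members
  are differentiable and rapidly decreasing. This spares explicit formulas for iterated
  derivatives.\<close>

lemma schwartzI:
  assumes "f \<in> P"
    and diff: "\<And>h x. h \<in> P \<Longrightarrow> h differentiable (at x)"
    and deriv: "\<And>h b. h \<in> P \<Longrightarrow> b \<in> Basis \<Longrightarrow> (\<lambda>x. frechet_derivative h (at x) b) \<in> P"
    and decay: "\<And>h N. h \<in> P \<Longrightarrow> \<exists>C. \<forall>x. (1 + norm x) ^ N * norm (h x) \<le> C"
  shows "f \<in> schwartz"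
proof -
  have "iter_deriv bs f \<in> P" if "bs \<in> lists Basis" for bs
    using that by (induction bs) (use assms(1) deriv in \<open>auto simp: iter_deriv_def\<close>)
  then show ?thesis using diff decay unfolding schwartz_def by blast
qed

lemma schwartz_deriv:
  assumes f: "f \<in> schwartz" and b: "b \<in> Basis"
  shows "(\<lambda>x. frechet_derivative f (at x) b) \<in> schwartz"
proof -
  \<comment> \<open>\<open>foldr\<close> applies the last list entry first, so differentiating
    \<open>f\<close> beforehand appends a direction at the end.\<close>
  have "iter_deriv bs (\<lambda>x. frechet_derivative f (at x) b) = iter_deriv (bs @ [b]) f" for bs
    by (simp add: iter_deriv_def)
  moreover have "bs @ [b] \<in> lists Basis" if "bs \<in> lists Basis" for bs
    using that b by auto
  ultimately show ?thesis using f unfolding schwartz_def mem_Collect_eq by metis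
qed

lemma schwartz_differentiable: "f \<in> schwartz \<Longrightarrow> f differentiable (at x)"
  unfolding schwartz_def mem_Collect_eq by (drule bspec[where x="[]"]) (auto simp: iter_deriv_def)

lemma schwartz_decay: "f \<in> schwartz \<Longrightarrow> \<exists>C. \<forall>x. (1 + norm x) ^ N * norm (f x) \<le> C"
  unfolding schwartz_def mem_Collect_eq by (drule bspec[where x="[]"]) (auto simp: iter_deriv_def)

lemma schwartz_continuous: "f \<in> schwartz \<Longrightarrow> continuous_on UNIV f"
  by (meson differentiable_imp_continuous_on differentiable_on_def differentiable_at_withinI schwartz_differentiable)

lemma schwartz_measurable: "f \<in> schwartz \<Longrightarrow> f \<in> borel_measurable borel"
  by (simp add: borel_measurable_continuous_onI schwartz_continuous)

text \<open>Peetre's inequality 1 + |x| <= (1 + |t|)(1 + |t - x|) converts decay in t and t - x into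
  decay in x and t.\<close>

lemma schwartz_two_point_bound:
  fixes u v :: "'a::euclidean_space \<Rightarrow> complex"
  assumes u: "u \<in> schwartz" and v: "v \<in> schwartz"
  shows "\<exists>K. \<forall>x t. norm (u t * v (t - x)) \<le> K * wt x * wt t"
proof -
  define m where "m = 2 * DIM('a)"
  \<comment> \<open>The order is doubled because the decay of \<open>u\<close> pays for
    \<open>wt t\<close> and also for its share of \<open>wt x\<close>.\<close>
  obtain A where A: "\<And>x. (1 + norm x) ^ (2 * m) * norm (u x) \<le> A" using schwartz_decay[OF u] by blast
  obtain B where B: "\<And>x. (1 + norm x) ^ m * norm (v x) \<le> B" using schwartz_decay[OF v] by blast
  have A0: "A \<ge> 0" using A[of 0] by (auto intro: order_trans[OF norm_ge_zero])
  have "norm (u t * v (t - x)) \<le> A * B * wt x * wt t" for x t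
  proof -
    have "1 + norm x \<le> 1 + (norm t + norm (t - x))"
      using norm_triangle_ineq4[of t "t - x"] by simp
    also have "\<dots> \<le> (1 + norm t) * (1 + norm (t - x))" by (simp add: algebra_simps)
    finally have "(1 + norm x) ^ m \<le> ((1 + norm t) * (1 + norm (t - x))) ^ m" by (intro power_mono) auto
    then have "inverse (wt x) \<le> ((1 + norm t) * (1 + norm (t - x))) ^ m"
      using inverse_wt_le[of x] unfolding m_def by linarith
    moreover have "inverse (wt t) \<le> (1 + norm t) ^ m" using inverse_wt_le[of t] unfolding m_def .
    ultimately have "inverse (wt x) * inverse (wt t) \<le> ((1 + norm t) * (1 + norm (t - x))) ^ m * (1 + norm t) ^ m"
      using wt_pos[of t] by (intro mult_mono) auto
    then have "inverse (wt x) * inverse (wt t) * norm (u t * v (t - x)) \<le>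
       ((1 + norm t) * (1 + norm (t - x))) ^ m * (1 + norm t) ^ m * norm (u t * v (t - x))"
      by (rule mult_right_mono) simp
    also have "\<dots> = ((1 + norm t) ^ (2 * m) * norm (u t)) * ((1 + norm (t - x)) ^ m * norm (v (t - x)))"
      by (simp add: norm_mult power_mult_distrib mult_2 power_add)
    also have "\<dots> \<le> A * B" by (intro mult_mono A B A0) auto
    finally show ?thesis using wt_pos[of x] wt_pos[of t] by (simp add: field_simps)
  qed
  then show ?thesis by (iprover intro: exI[of _ "A * B"] allI)
qed

lemma schwartz_le_wt:
  fixes u :: "'a::euclidean_space \<Rightarrow> complex"
  assumes u: "u \<in> schwartz"
  shows "\<exists>K. \<forall>t. norm (u t) \<le> K * wt t"
proof -
  obtain A where A: "\<And>x. (1 + norm x) ^ (2 * DIM('a)) * norm (u x) \<le> A" using schwartz_decay[OF u] by blast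
  have "norm (u t) \<le> A * wt t" for t
  proof -
    have "inverse (wt t) * norm (u t) \<le> (1 + norm t) ^ (2 * DIM('a)) * norm (u t)"
      by (intro mult_right_mono inverse_wt_le) auto
    then have "inverse (wt t) * norm (u t) \<le> A" using A[of t] by linarith
    then show ?thesis using wt_pos[of t] by (simp add: field_simps)
  qed
  then show ?thesis by iprover
qed

lemma integrable_le_wt:
  fixes u :: "'a::euclidean_space \<Rightarrow> complex"
  assumes "u \<in> borel_measurable borel" "\<And>t. norm (u t) \<le> K * wt t"
  shows "integrable lborel u"
proof (rule Bochner_Integration.integrable_bound)
  show "integrable lborel (\<lambda>t::'a. K * wt t)" by (intro integrable_mult_right integrable_wt)
qed (use assms in \<open>auto intro: order_trans[OF _ abs_ge_self]\<close>)

lemma schwartz_integrable: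
  assumes u: "u \<in> schwartz"
  shows "integrable lborel u"
proof -
  obtain K where "\<forall>t. norm (u t) \<le> K * wt t" using schwartz_le_wt[OF u] by (elim exE)
  then have "norm (u t) \<le> K * wt t" for t by (rule spec)
  then show ?thesis by (rule integrable_le_wt[OF schwartz_measurable[OF u]])
qed

lemma schwartz_translate:
  assumes f: "f \<in> schwartz"
  shows "(\<lambda>t. f (t - x)) \<in> schwartz"
\<comment> \<open>Translation commutes with differentiation, so the translates by x of all Schwartz
  functions form a closed class.\<close>
proof (rule schwartzI[where P="{\<lambda>t. f (t - x) | f. f \<in> schwartz}"])
  fix h and b :: 'a assume "h \<in> {\<lambda>t. f (t - x) |f. f \<in> schwartz}"
  then obtain f where h: "h = (\<lambda>t. f (t - x))" and f: "f \<in> schwartz" by auto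
  have d: "(h has_derivative frechet_derivative f (at (t - x))) (at t)" for t
  proof -
    have "(f has_derivative frechet_derivative f (at (t - x))) (at (t - x))"
      using schwartz_differentiable[OF f] unfolding frechet_derivative_works .
    moreover have "((\<lambda>t. t - x) has_derivative (\<lambda>v. v)) (at t)"
      using has_derivative_diff[OF has_derivative_ident has_derivative_const, of x "at t"] by simp
    ultimately show ?thesis unfolding h by (rule has_derivative_compose[rotated])
  qed
  then show "h differentiable (at t)" for t unfolding differentiable_def by blast
  show "(\<lambda>t. frechet_derivative h (at t) b) \<in> {\<lambda>t. f (t - x) |f. f \<in> schwartz}" if "b \<in> Basis"
    using schwartz_deriv[OF f that] by (auto simp: frechet_derivative_at[OF d, symmetric])
  show "\<exists>C. \<forall>t. (1 + norm t) ^ N * norm (h t) \<le> C" for N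
  proof -
    obtain C where C: "\<And>t. (1 + norm t) ^ N * norm (f t) \<le> C" using schwartz_decay[OF f] by blast
    have "(1 + norm t) ^ N * norm (h t) \<le> (1 + norm x) ^ N * C" for t
    proof -
      have "1 + norm t \<le> 1 + (norm x + norm (t - x))" using norm_triangle_sub[of t x] by simp
      also have "\<dots> \<le> (1 + norm x) * (1 + norm (t - x))" by (simp add: algebra_simps)
      finally have "(1 + norm t) ^ N * norm (h t) \<le> ((1 + norm x) * (1 + norm (t - x))) ^ N * norm (h t)"
        by (intro mult_right_mono power_mono) auto
      also have "\<dots> = (1 + norm x) ^ N * ((1 + norm (t - x)) ^ N * norm (f (t - x)))"
        by (simp add: h power_mult_distrib)
      also have "\<dots> \<le> (1 + norm x) ^ N * C" by (intro mult_left_mono C) auto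
      finally show ?thesis .
    qed
    then show ?thesis by blast
  qed
qed (use f in auto)

text \<open>The integral over \<open>x\<close> of \<open>h (x + b) - h x = \<integral>\<^sub>0\<^sup>1 k (x + s b) ds\<close> vanishes by translation
  invariance.\<close>

lemma integral_directional_derivative:
  fixes h k :: "'a::euclidean_space \<Rightarrow> complex"
  assumes d: "\<And>x. ((\<lambda>s. h (x + s *\<^sub>R b)) has_vector_derivative k x) (at 0)"
    and h: "integrable lborel h" and k: "integrable lborel k" and c: "continuous_on UNIV k"
  shows "integral\<^sup>L lborel k = 0"
proof -
  have [measurable]: "h \<in> borel_measurable borel" "k \<in> borel_measurable borel" using h k by auto
  let ?F = "\<lambda>s x. indicator {0..1::real} s *\<^sub>R k (x + s *\<^sub>R b)"
  have d': "((\<lambda>s. h (x + s *\<^sub>R b)) has_vector_derivative k (x + s *\<^sub>R b)) (at s)" for x s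
  proof -
    have "((\<lambda>r. r - s) has_vector_derivative 1) (at s)"
      by (auto simp: has_vector_derivative_def intro!: derivative_eq_intros)
    moreover have "((\<lambda>r. h ((x + s *\<^sub>R b) + r *\<^sub>R b)) has_vector_derivative k (x + s *\<^sub>R b)) (at (s - s))"
      using d[of "x + s *\<^sub>R b"] by simp
    ultimately have "((\<lambda>r. h ((x + s *\<^sub>R b) + r *\<^sub>R b)) \<circ> (\<lambda>r. r - s) has_vector_derivative 1 *\<^sub>R k (x + s *\<^sub>R b)) (at s)"
      by (rule vector_diff_chain_at)
    then show ?thesis by (simp add: o_def scaleR_left_diff_distrib)
  qed
  have 1: "(LINT s|lborel. ?F s x) = h (x + b) - h x" for x
    using integral_FTC_Icc[of 0 1 "\<lambda>s. h (x + s *\<^sub>R b)" "\<lambda>s. k (x + s *\<^sub>R b)"]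
    by (simp add: d' has_vector_derivative_at_within continuous_on_compose2[OF c] continuous_intros)
  have i: "integrable lborel (\<lambda>(s, x). ?F s x)"
  proof (rule lborel_Fubini_integrable)
    have "(\<lambda>s. LINT x|lborel. norm (?F s x)) = (\<lambda>s. indicator {0..1} s *\<^sub>R (LINT x|lborel. norm (k x)))"
      using lborel_translate_integral[of "\<lambda>x. norm (k x)"] by (auto simp: indicator_def)
    then show "integrable lborel (\<lambda>s. LINT x|lborel. norm (case (s, x) of (s, x) \<Rightarrow> ?F s x))"
      by simp
    show "AE s in lborel. integrable lborel (\<lambda>x. case (s, x) of (s, x) \<Rightarrow> ?F s x)"
      using k lborel_translate_integrable[of k] by auto
    show "(\<lambda>(s, x). ?F s x) \<in> borel_measurable lborel"
      unfolding measurable_lborel2 borel_prod[symmetric] by measurable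
  qed
  have "(LINT x|lborel. h (x + b) - h x) = 0"
    using h lborel_translate_integrable[of h b] lborel_translate_integral[of h b] by simp
  then have "0 = (LINT x|lborel. LINT s|lborel. ?F s x)" by (simp add: 1)
  also have "\<dots> = (LINT s|lborel. LINT x|lborel. ?F s x)"
    by (rule lborel_Fubini_integral[OF i])
  also have "\<dots> = (LINT s|lborel. indicator {0..1::real} s *\<^sub>R integral\<^sup>L lborel k)"
    using lborel_translate_integral[of k] by simp
  also have "\<dots> = integral\<^sup>L lborel k" by simp
  finally show ?thesis by simp
qed

text \<open>Integration by parts against a character: the derivative of h(t) ch(-\<omega>.t) in
  direction \<open>b\<close> has integral 0, and the product rule splits it into the two
  sides.\<close>

lemma fourier_directional_derivative:
  fixes h k :: "'a::euclidean_space \<Rightarrow> complex"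
  assumes d: "\<And>x. ((\<lambda>s. h (x + s *\<^sub>R b)) has_vector_derivative k x) (at 0)"
    and h: "integrable lborel h" and k: "integrable lborel k"
    and c: "continuous_on UNIV h" "continuous_on UNIV k"
  shows "(LINT t|lborel. k t * ch (- (\<omega> \<bullet> t))) = 2 * pi * \<i> * (\<omega> \<bullet> b) * (LINT t|lborel. h t * ch (- (\<omega> \<bullet> t)))"
proof -
  have [measurable]: "h \<in> borel_measurable borel" "k \<in> borel_measurable borel" using h k by auto
  have i: "integrable lborel (\<lambda>t. f t * ch (- (\<omega> \<bullet> t)))" if f: "integrable lborel f" for f
    using f by (rule Bochner_Integration.integrable_bound) (use f in \<open>auto simp: norm_mult\<close>)
  have e: "((\<lambda>s. ch (- (\<omega> \<bullet> (t + s *\<^sub>R b)))) has_vector_derivative - (2 * pi * \<i> * (\<omega> \<bullet> b)) * ch (- (\<omega> \<bullet> t))) (at 0)" for t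
  proof -
    have "((\<lambda>s. 2 * pi * (- (\<omega> \<bullet> (t + s *\<^sub>R b)))) has_derivative (\<lambda>s. 2 * pi * (- (\<omega> \<bullet> (s *\<^sub>R b))))) (at 0)"
      by (intro derivative_eq_intros refl) auto
    from has_derivative_cis[OF this]
    show ?thesis unfolding ch_def has_vector_derivative_def
      by (rule back_subst[where P="\<lambda>D. (_ has_derivative D) (at 0)"]) (auto simp: scaleR_conv_of_real mult_ac)
  qed
  have "(LINT t|lborel. h t * (- (2 * pi * \<i> * (\<omega> \<bullet> b)) * ch (- (\<omega> \<bullet> t))) + k t * ch (- (\<omega> \<bullet> t))) = 0"
  proof (rule integral_directional_derivative[where h="\<lambda>t. h t * ch (- (\<omega> \<bullet> t))" and b=b])
    show "((\<lambda>s. h (x + s *\<^sub>R b) * ch (- (\<omega> \<bullet> (x + s *\<^sub>R b)))) has_vector_derivative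
         h x * (- (2 * pi * \<i> * (\<omega> \<bullet> b)) * ch (- (\<omega> \<bullet> x))) + k x * ch (- (\<omega> \<bullet> x))) (at 0)" for x
      using has_vector_derivative_mult[OF d[of x] e[of x]] by simp
    show "integrable lborel (\<lambda>t. h t * (- (2 * pi * \<i> * (\<omega> \<bullet> b)) * ch (- (\<omega> \<bullet> t))) + k t * ch (- (\<omega> \<bullet> t)))"
      using i[OF h] i[OF k] integrable_mult_right[OF i[OF h], of "- (2 * pi * \<i> * (\<omega> \<bullet> b))"]
      by (intro Bochner_Integration.integrable_add) (auto simp: mult_ac)
    show "continuous_on UNIV (\<lambda>t. h t * (- (2 * pi * \<i> * (\<omega> \<bullet> b)) * ch (- (\<omega> \<bullet> t))) + k t * ch (- (\<omega> \<bullet> t)))"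
      by (intro continuous_intros c)
  qed (rule i[OF h])
  also have "(\<lambda>t. h t * (- (2 * pi * \<i> * (\<omega> \<bullet> b)) * ch (- (\<omega> \<bullet> t))) + k t * ch (- (\<omega> \<bullet> t))) =
     (\<lambda>t. k t * ch (- (\<omega> \<bullet> t)) - (2 * pi * \<i> * (\<omega> \<bullet> b)) * (h t * ch (- (\<omega> \<bullet> t))))"
    by (auto simp: algebra_simps)
  finally show ?thesis
    using i[OF h] i[OF k] by (subst (asm) Bochner_Integration.integral_diff) auto
qed

text \<open>Families indexed by the position \<open>x\<close> of the window, with bounds uniform in \<open>x\<close>. The class is closed
  under the operators \<open>1 - \<partial>\<^sub>b\<^sup>2\<close>, which multiply the Fourier transform by \<open>1 + (2\<pi>\<omega>\<^sub>b)\<^sup>2\<close>; applying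
  all of them yields an integrable bound in \<open>\<omega>\<close>.\<close>

inductive_set translate_products :: "('a::euclidean_space \<Rightarrow> 'a \<Rightarrow> complex) set" where
  base: "u \<in> schwartz \<Longrightarrow> v \<in> schwartz \<Longrightarrow> (\<lambda>x t. u t * cnj (v (t - x))) \<in> translate_products"
| add: "H \<in> translate_products \<Longrightarrow> K \<in> translate_products \<Longrightarrow> (\<lambda>x t. H x t + K x t) \<in> translate_products"
| scale: "H \<in> translate_products \<Longrightarrow> (\<lambda>x t. c * H x t) \<in> translate_products"

lemma translate_products_continuous: "H \<in> translate_products \<Longrightarrow> continuous_on UNIV (H x)"
proof (induction rule: translate_products.induct)
  case (base u v)
  then show ?case by (intro continuous_on_mult continuous_on_cnj schwartz_continuous schwartz_translate)
qed (auto intro!: continuous_on_add continuous_on_mult_left)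

lemma translate_products_bound: "H \<in> translate_products \<Longrightarrow> \<exists>K. \<forall>x t. norm (H x t) \<le> K * wt x * wt t"
proof (induction rule: translate_products.induct)
  case (base u v)
  then obtain K where "\<And>x t. norm (u t * v (t - x)) \<le> K * wt x * wt t"
    using schwartz_two_point_bound by blast
  then show ?case by (auto simp: norm_mult)
next
  case (add H K)
  then obtain A B where AB: "\<And>x t. norm (H x t) \<le> A * wt x * wt t" "\<And>x t. norm (K x t) \<le> B * wt x * wt t" by blast
  then have "norm (H x t + K x t) \<le> (A + B) * wt x * wt t" for x t
  proof -
    have "norm (H x t + K x t) \<le> A * wt x * wt t + B * wt x * wt t"
      by (intro norm_triangle_le add_mono AB)
    then show ?thesis by (simp add: distrib_right)
  qed
  then show ?case by iprover
next
  case (scale H c)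
  then obtain A where A: "\<And>x t. norm (H x t) \<le> A * wt x * wt t" by blast
  have "norm (c * H x t) \<le> (norm c * A) * wt x * wt t" for x t
    using mult_left_mono[OF A[of x t] norm_ge_zero[of c]] by (simp add: norm_mult mult.assoc)
  then show ?case by iprover
qed

lemma translate_products_integrable: "H \<in> translate_products \<Longrightarrow> integrable lborel (H x)"
proof -
  assume H: "H \<in> translate_products"
  then obtain K where "\<And>t. norm (H x t) \<le> (K * wt x) * wt t" using translate_products_bound by blast
  then show ?thesis
    by (rule integrable_le_wt[rotated]) (simp add: borel_measurable_continuous_onI translate_products_continuous[OF H])
qed

lemma translate_products_deriv:
  assumes b: "b \<in> Basis"
  shows "H \<in> translate_products \<Longrightarrow> \<exists>K\<in>translate_products. \<forall>x t. ((\<lambda>s. H x (t + s *\<^sub>R b)) has_vector_derivative K x t) (at 0)"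
proof (induction rule: translate_products.induct)
  case (base u v)
  define du where "du t = frechet_derivative u (at t) b" for t
  define dv where "dv t = frechet_derivative v (at t) b" for t
  have s: "du \<in> schwartz" "dv \<in> schwartz" unfolding du_def[abs_def] dv_def[abs_def] using schwartz_deriv b base by auto
  have d: "((\<lambda>s. f (t + s *\<^sub>R b)) has_vector_derivative frechet_derivative f (at t) b) (at 0)"
    if "f \<in> schwartz" for f :: "'a \<Rightarrow> complex" and t
  proof -
    have f: "(f has_derivative frechet_derivative f (at t)) (at t)"
      using schwartz_differentiable[OF that] by (simp add: frechet_derivative_works)
    then have l: "linear (frechet_derivative f (at t))" by (simp add: has_derivative_linear)
    have "((\<lambda>s. f (t + s *\<^sub>R b)) has_derivative (\<lambda>s. frechet_derivative f (at t) (s *\<^sub>R b))) (at 0)"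
      by (rule has_derivative_compose[where f="\<lambda>s. t + s *\<^sub>R b"]) (use f in \<open>auto intro!: derivative_eq_intros\<close>)
    then show ?thesis unfolding has_vector_derivative_def linear_scale[OF l] .
  qed
  have "((\<lambda>s. u (t + s *\<^sub>R b) * cnj (v (t + s *\<^sub>R b - x))) has_vector_derivative
      u t * cnj (dv (t - x)) + du t * cnj (v (t - x))) (at 0)" for x t
    using has_vector_derivative_mult[OF d[OF base(1), of t]
        bounded_linear.has_vector_derivative[OF bounded_linear_cnj d[OF base(2), of "t - x"]]]
    by (simp add: du_def dv_def algebra_simps)
  then show ?case
    by (intro bexI[of _ "\<lambda>x t. u t * cnj (dv (t - x)) + du t * cnj (v (t - x))"] translate_products.intros s base) auto
next
  case (add H K)
  then obtain H' K' where "H' \<in> translate_products" "\<And>x t. ((\<lambda>s. H x (t + s *\<^sub>R b)) has_vector_derivative H' x t) (at 0)"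
    "K' \<in> translate_products" "\<And>x t. ((\<lambda>s. K x (t + s *\<^sub>R b)) has_vector_derivative K' x t) (at 0)" by blast
  then show ?case
    by (intro bexI[of _ "\<lambda>x t. H' x t + K' x t"] allI has_vector_derivative_add translate_products.add) auto
next
  case (scale H c)
  then obtain H' where "H' \<in> translate_products" "\<And>x t. ((\<lambda>s. H x (t + s *\<^sub>R b)) has_vector_derivative H' x t) (at 0)"
    by blast
  then show ?case
    by (intro bexI[of _ "\<lambda>x t. c * H' x t"] allI has_vector_derivative_mult_right translate_products.scale) auto
qed

lemma translate_products_fourier_factor:
  assumes H: "H \<in> translate_products" and b: "b \<in> Basis"
  shows "\<exists>K\<in>translate_products. \<forall>x \<omega>. (LINT t|lborel. K x t * ch (- (\<omega> \<bullet> t))) =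
     (1 + (2 * pi * (\<omega> \<bullet> b))\<^sup>2) * (LINT t|lborel. H x t * ch (- (\<omega> \<bullet> t)))"
proof -
  obtain H1 where H1: "H1 \<in> translate_products" "\<And>x t. ((\<lambda>s. H x (t + s *\<^sub>R b)) has_vector_derivative H1 x t) (at 0)"
    using translate_products_deriv[OF b H] by blast
  obtain H2 where H2: "H2 \<in> translate_products" "\<And>x t. ((\<lambda>s. H1 x (t + s *\<^sub>R b)) has_vector_derivative H2 x t) (at 0)"
    using translate_products_deriv[OF b H1(1)] by blast
  have i: "integrable lborel (\<lambda>t. F x t * ch (- (\<omega> \<bullet> t)))" if F: "F \<in> translate_products" for F x and \<omega> :: 'a
    using translate_products_integrable[OF F, of x] by (rule Bochner_Integration.integrable_bound)
      (use translate_products_integrable[OF F, of x] in \<open>auto simp: norm_mult\<close>)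
  \<comment> \<open>Two derivatives multiply the transform by (2 pi i \<omega>.b)^2 = -(2 pi
    \<omega>.b)^2; the coefficient -1 makes the total factor at least 1.\<close>
  have "(LINT t|lborel. (H x t + (-1) * H2 x t) * ch (- (\<omega> \<bullet> t))) =
     (1 + (2 * pi * (\<omega> \<bullet> b))\<^sup>2) * (LINT t|lborel. H x t * ch (- (\<omega> \<bullet> t)))" for x \<omega>
  proof -
    have "(LINT t|lborel. (H x t + (-1) * H2 x t) * ch (- (\<omega> \<bullet> t))) =
        (LINT t|lborel. H x t * ch (- (\<omega> \<bullet> t))) - (LINT t|lborel. H2 x t * ch (- (\<omega> \<bullet> t)))"
      by (subst Bochner_Integration.integral_diff[symmetric, OF i[OF H] i[OF H2(1)]]) (simp add: algebra_simps)
    also have "(LINT t|lborel. H2 x t * ch (- (\<omega> \<bullet> t))) = 2 * pi * \<i> * (\<omega> \<bullet> b) * (LINT t|lborel. H1 x t * ch (- (\<omega> \<bullet> t)))"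
      using H1 H2 by (intro fourier_directional_derivative) (auto simp: translate_products_integrable translate_products_continuous)
    also have "(LINT t|lborel. H1 x t * ch (- (\<omega> \<bullet> t))) = 2 * pi * \<i> * (\<omega> \<bullet> b) * (LINT t|lborel. H x t * ch (- (\<omega> \<bullet> t)))"
      using H H1 by (intro fourier_directional_derivative) (auto simp: translate_products_integrable translate_products_continuous)
    finally show ?thesis by (simp add: power2_eq_square algebra_simps)
  qed
  moreover have "(\<lambda>x t. H x t + (-1) * H2 x t) \<in> translate_products" by (intro translate_products.add translate_products.scale H H2(1))
  ultimately show ?thesis by (rule_tac bexI[of _ "\<lambda>x t. H x t + (-1) * H2 x t"]) iprover+
qed

text \<open>Multiplying the transform by all the factors gives the transform of another family
  \<open>F\<close>, which is bounded by the L^1 norm of \<open>F x\<close>. That norm still carries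
  \<open>wt x\<close>, and dividing by the factors contributes \<open>wt \<omega>\<close>.\<close>

lemma translate_products_fourier_bound:
  assumes H: "(H :: 'a::euclidean_space \<Rightarrow> _) \<in> translate_products"
  shows "\<exists>K. \<forall>x \<omega>. norm (LINT t|lborel. H x t * ch (- (\<omega> \<bullet> t))) \<le> K * wt x * wt \<omega>"
proof -
  have "\<exists>F\<in>translate_products. \<forall>x \<omega>. (LINT t|lborel. F x t * ch (- (\<omega> \<bullet> t))) =
     (\<Prod>b\<in>S. 1 + (2 * pi * (\<omega> \<bullet> b))\<^sup>2) * (LINT t|lborel. H x t * ch (- (\<omega> \<bullet> t)))"
    if "finite S" "S \<subseteq> Basis" for S
    using that
  proof (induction S rule: finite_induct)
    case empty
    then show ?case using H by auto
  next
    case (insert b S)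
    then obtain F where F: "F \<in> translate_products" "\<And>x \<omega>. (LINT t|lborel. F x t * ch (- (\<omega> \<bullet> t))) =
       (\<Prod>b\<in>S. 1 + (2 * pi * (\<omega> \<bullet> b))\<^sup>2) * (LINT t|lborel. H x t * ch (- (\<omega> \<bullet> t)))" by auto
    obtain G where "G \<in> translate_products" "\<And>x \<omega>. (LINT t|lborel. G x t * ch (- (\<omega> \<bullet> t))) =
       (1 + (2 * pi * (\<omega> \<bullet> b))\<^sup>2) * (LINT t|lborel. F x t * ch (- (\<omega> \<bullet> t)))"
      using translate_products_fourier_factor[OF F(1), of b] insert by auto
    then show ?case using F insert by (intro bexI[of _ G]) (auto simp: mult.assoc)
  qed
  from this[OF finite_Basis] obtain F where F: "F \<in> translate_products" "\<And>x \<omega>. (LINT t|lborel. F x t * ch (- (\<omega> \<bullet> t))) =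
     (\<Prod>b\<in>Basis. 1 + (2 * pi * (\<omega> \<bullet> b))\<^sup>2) * (LINT t|lborel. H x t * ch (- (\<omega> \<bullet> t)))" by auto
  obtain K where K: "\<And>x t. norm (F x t) \<le> K * wt x * wt t" using translate_products_bound[OF F(1)] by blast
  define I where "I = (LINT t|lborel. wt (t::'a))"
  have "norm (LINT t|lborel. H x t * ch (- (\<omega> \<bullet> t))) \<le> (K * I) * wt x * wt \<omega>" for x \<omega>
  proof -
    define p where "p = (\<Prod>b\<in>Basis. 1 + (2 * pi * (\<omega> \<bullet> b))\<^sup>2)"
    have "inverse (wt \<omega>) = (\<Prod>b\<in>Basis. 1 + (\<omega> \<bullet> b)\<^sup>2)"
      unfolding wt_def by (simp add: prod_inversef[symmetric])
    also have "\<dots> \<le> p" unfolding p_def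
    proof (intro prod_mono conjI)
      fix b :: 'a
      \<comment> \<open>Since 2 pi >= 1, the product of the factors dominates the inverse of
        \<open>wt \<omega>\<close>.\<close>
      have "1 \<le> (2 * pi)\<^sup>2" using pi_ge_two by (intro one_le_power) linarith
      then have "1 * (\<omega> \<bullet> b)\<^sup>2 \<le> (2 * pi)\<^sup>2 * (\<omega> \<bullet> b)\<^sup>2" by (intro mult_right_mono) auto
      then show "1 + (\<omega> \<bullet> b)\<^sup>2 \<le> 1 + (2 * pi * (\<omega> \<bullet> b))\<^sup>2" by (simp add: power_mult_distrib)
    qed (simp add: add_nonneg_nonneg)
    finally have p: "inverse (wt \<omega>) \<le> p" .
    have "p * norm (LINT t|lborel. H x t * ch (- (\<omega> \<bullet> t))) = norm (LINT t|lborel. F x t * ch (- (\<omega> \<bullet> t)))"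
    proof -
      have "0 \<le> p" unfolding p_def by (intro prod_nonneg) (simp add: add_nonneg_nonneg)
      moreover have "(\<Prod>b\<in>Basis. 1 + (2 * pi * (\<omega> \<bullet> b))\<^sup>2) = complex_of_real p" unfolding p_def by simp
      ultimately show ?thesis unfolding F(2) norm_mult by (simp only: norm_of_real abs_of_nonneg)
    qed
    also have "\<dots> \<le> (LINT t|lborel. K * wt x * wt (t::'a))"
    proof (rule Bochner_Integration.integral_norm_bound_integral)
      show "integrable lborel (\<lambda>t. F x t * ch (- (\<omega> \<bullet> t)))"
        using translate_products_integrable[OF F(1), of x] by (rule Bochner_Integration.integrable_bound)
          (use translate_products_integrable[OF F(1), of x] in \<open>auto simp: norm_mult\<close>)
    qed (use K in \<open>auto simp: norm_mult intro!: integrable_mult_right integrable_wt\<close>)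
    also have "\<dots> = K * I * wt x" by (simp add: I_def)
    finally have "p * norm (LINT t|lborel. H x t * ch (- (\<omega> \<bullet> t))) \<le> K * I * wt x" .
    moreover have "inverse (wt \<omega>) * norm (LINT t|lborel. H x t * ch (- (\<omega> \<bullet> t))) \<le> p * norm (LINT t|lborel. H x t * ch (- (\<omega> \<bullet> t)))"
      using p by (intro mult_right_mono) auto
    ultimately have "inverse (wt \<omega>) * norm (LINT t|lborel. H x t * ch (- (\<omega> \<bullet> t))) \<le> K * I * wt x"
      by linarith
    then show ?thesis using wt_pos[of \<omega>] by (simp add: field_simps)
  qed
  then show ?thesis by iprover
qed

lemma cnj_measurable [measurable]: "cnj \<in> borel_measurable borel"
  by (intro borel_measurable_continuous_onI continuous_intros)

lemma stf_measurable:
  assumes [measurable]: "g \<in> borel_measurable borel" "f \<in> borel_measurable borel"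
  shows "stf g f \<in> borel_measurable borel"
proof -
  have "(\<lambda>(z, t). f t * cnj (atom g z t)) \<in> borel_measurable (borel \<Otimes>\<^sub>M lborel)"
    unfolding atom_def borel_prod[symmetric] by measurable
  then show ?thesis unfolding stf_def[abs_def] by (rule lborel.borel_measurable_lebesgue_integral)
qed

text \<open>For fixed x this is the Fourier transform of a base member of
  \<open>translate_products\<close>. It discharges the integrability condition on pairs of windows
  in every change of window and every synthesis.\<close>

lemma stf_schwartz_integrable:
  fixes u v :: "'a::euclidean_space \<Rightarrow> complex"
  assumes u: "u \<in> schwartz" and v: "v \<in> schwartz"
  shows "integrable lborel (stf v u)"
proof -
  obtain K where K: "\<And>x \<omega>. norm (LINT t|lborel. u t * cnj (v (t - x)) * ch (- (\<omega> \<bullet> t))) \<le> K * wt x * wt \<omega>"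
    using translate_products_fourier_bound[OF translate_products.base[OF u v]] by blast
  show ?thesis
  proof (rule lborel_integrable_product_bound)
    show "stf v u \<in> borel_measurable borel" by (intro stf_measurable schwartz_measurable u v)
    show "integrable lborel (\<lambda>x::'a. K * wt x)" "integrable lborel (wt :: 'a \<Rightarrow> real)" by (intro integrable_mult_right integrable_wt)+
    show "norm (stf v u (x, y)) \<le> K * wt x * wt y" for x y
      using K[of x y] by (simp add: stf_def atom_def mult_ac)
  qed
qed

section \<open>Reconstruction and synthesis\<close>

lemma power_le_exp:
  fixes x :: real
  assumes "0 \<le> x"
  shows "x ^ n \<le> real n ^ n * exp x"
proof (cases "n = 0")
  case False
  have "(x / n) ^ n \<le> exp (x / n) ^ n"
    using assms exp_ge_add_one_self[of "x / n"] by (intro power_mono) (linarith, simp)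
  also have "\<dots> = exp x" using False by (simp flip: exp_of_nat_mult)
  finally show ?thesis using False by (simp add: power_divide divide_simps mult.commute)
qed (use assms in simp)

text \<open>Polynomials times the Gaussian composed with \<open>L\<close>, given by generators:
  differentiation only brings down linear factors and so stays inside.\<close>

inductive_set gauss_polys :: "('a::euclidean_space \<Rightarrow> 'a) \<Rightarrow> ('a \<Rightarrow> complex) set" for L where
  base: "(\<lambda>t. gauss (L t)) \<in> gauss_polys L"
| lin: "h \<in> gauss_polys L \<Longrightarrow> (\<lambda>t. of_real (v \<bullet> t) * h t) \<in> gauss_polys L"
| add: "h \<in> gauss_polys L \<Longrightarrow> k \<in> gauss_polys L \<Longrightarrow> (\<lambda>t. h t + k t) \<in> gauss_polys L"
| scale: "h \<in> gauss_polys L \<Longrightarrow> (\<lambda>t. c * h t) \<in> gauss_polys L"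

lemma gauss_polys_deriv:
  fixes L :: "'a::euclidean_space \<Rightarrow> 'a"
  assumes L: "linear L"
  shows "h \<in> gauss_polys L \<Longrightarrow>
    \<exists>D. (\<forall>t. (h has_derivative D t) (at t)) \<and> (\<forall>b. (\<lambda>t. D t b) \<in> gauss_polys L)"
proof (induction rule: gauss_polys.induct)
  case base
  have bl: "bounded_linear L" using L by (simp add: linear_conv_bounded_linear)
  \<comment> \<open>The derivative of -pi Lt.Lt in direction b is -2 pi Lt.Lb; the adjoint of
    \<open>L\<close> exposes it as a linear form in t, as the rule \<open>lin\<close>
    requires.\<close>
  define D where "D t b = complex_of_real (- (2 * pi)) * (of_real (adjoint L (L b) \<bullet> t) * gauss (L t))" for t b
  have "((\<lambda>t. gauss (L t)) has_derivative D t) (at t)" for t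
  proof -
    have l: "(L has_derivative L) (at t)" by (rule bounded_linear_imp_has_derivative[OF bl])
    have "((\<lambda>t. exp (- (pi * (L t \<bullet> L t)))) has_derivative
        (\<lambda>b. exp (- (pi * (L t \<bullet> L t))) * (- (pi * (L t \<bullet> L b + L b \<bullet> L t))))) (at t)"
      by (auto intro!: derivative_eq_intros l simp: algebra_simps)
    then have "((\<lambda>t. complex_of_real (exp (- (pi * (L t \<bullet> L t))))) has_derivative
        (\<lambda>b. of_real (exp (- (pi * (L t \<bullet> L t))) * (- (pi * (L t \<bullet> L b + L b \<bullet> L t)))))) (at t)"
      by (rule has_derivative_of_real)
    moreover have "adjoint L (L b) \<bullet> t = L t \<bullet> L b" for b
      using adjoint_works[OF L, of t "L b"] by (simp add: inner_commute)
    ultimately show ?thesis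
      unfolding gauss_def D_def by (simp add: inner_commute mult_ac)
  qed
  moreover have "(\<lambda>t. D t b) \<in> gauss_polys L" for b
    unfolding D_def by (intro gauss_polys.intros)
  ultimately show ?case by (intro exI[of _ D] conjI allI)
next
  case (lin h v)
  then obtain D where D: "\<And>t. (h has_derivative D t) (at t)" "\<And>b. (\<lambda>t. D t b) \<in> gauss_polys L" by blast
  have "((\<lambda>t. complex_of_real (v \<bullet> t)) has_derivative (\<lambda>b. of_real (v \<bullet> b))) (at t)" for t
    by (intro derivative_intros)
  from has_derivative_mult[OF this D(1)]
  have "((\<lambda>t. of_real (v \<bullet> t) * h t) has_derivative (\<lambda>b. of_real (v \<bullet> t) * D t b + of_real (v \<bullet> b) * h t)) (at t)" for t .
  moreover have "(\<lambda>t. of_real (v \<bullet> t) * D t b + of_real (v \<bullet> b) * h t) \<in> gauss_polys L" for b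
    by (intro gauss_polys.intros D lin)
  ultimately show ?case
    by (intro exI[of _ "\<lambda>t b. of_real (v \<bullet> t) * D t b + of_real (v \<bullet> b) * h t"] conjI allI)
next
  case (add h k)
  then obtain D E where D: "\<And>t. (h has_derivative D t) (at t)" "\<And>b. (\<lambda>t. D t b) \<in> gauss_polys L"
    and E: "\<And>t. (k has_derivative E t) (at t)" "\<And>b. (\<lambda>t. E t b) \<in> gauss_polys L" by blast
  show ?case
    by (intro exI[of _ "\<lambda>t b. D t b + E t b"] conjI allI has_derivative_add D E gauss_polys.add)
next
  case (scale h c)
  then obtain D where D: "\<And>t. (h has_derivative D t) (at t)" "\<And>b. (\<lambda>t. D t b) \<in> gauss_polys L" by blast
  show ?case
    by (intro exI[of _ "\<lambda>t b. c * D t b"] conjI allI has_derivative_mult_right D gauss_polys.scale)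
qed

lemma gauss_polys_decay:
  fixes L :: "'a::euclidean_space \<Rightarrow> 'a"
  assumes L: "linear L" "inj L"
  shows "h \<in> gauss_polys L \<Longrightarrow> \<exists>C. \<forall>t. (1 + norm t) ^ N * norm (h t) \<le> C"
proof (induction arbitrary: N rule: gauss_polys.induct)
  case base
  \<comment> \<open>Injectivity enters here: |Lt| is bounded below by a multiple of |t|, so the
    composed Gaussian decays at least like exp(-a |t|^2) with a = pi c^2.\<close>
  obtain c where c: "c > 0" "\<And>t. c * norm t \<le> norm (L t)" using linear_inj_bounded_below_pos[OF L] by metis
  define a where "a = pi * c\<^sup>2"
  have a: "a > 0" using c by (simp add: a_def)
  have "(1 + norm t) ^ N * norm (gauss (L t)) \<le> (2 / a) ^ N * (real N ^ N * exp a)" for t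
  proof -
    define y where "y = norm t"
    have "(c * y)\<^sup>2 \<le> (norm (L t))\<^sup>2" unfolding y_def using c by (intro power_mono) auto
    then have "a * y\<^sup>2 \<le> pi * (L t \<bullet> L t)"
      by (simp add: a_def power_mult_distrib mult_left_mono power2_norm_eq_inner)
    then have g: "norm (gauss (L t)) \<le> exp (- (a * y\<^sup>2))" by (simp add: gauss_def)
    \<comment> \<open>The target is a bound of (1 + y)^N by a multiple of exp(a(1 + y^2)), whose
      dependence on y cancels against exp(-a y^2). Hence 1 + y is estimated by 2(1 + y^2) before
      \<open>power_le_exp\<close> is applied.\<close>
    have "0 \<le> (y - 1)\<^sup>2" by simp
    then have "2 * y \<le> y\<^sup>2 + 1" by (simp add: power2_diff)
    moreover have "0 \<le> y\<^sup>2" by simp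
    ultimately have "1 + y \<le> 2 * (1 + y\<^sup>2)" by argo
    also have "\<dots> = (2 / a) * (a * (1 + y\<^sup>2))" using a by simp
    finally have "(1 + y) ^ N \<le> ((2 / a) * (a * (1 + y\<^sup>2))) ^ N"
      by (intro power_mono) (auto simp: y_def)
    also have "\<dots> \<le> (2 / a) ^ N * (real N ^ N * exp (a * (1 + y\<^sup>2)))"
      unfolding power_mult_distrib[of "2 / a"] using a
      by (intro mult_left_mono power_le_exp) (auto intro!: mult_nonneg_nonneg add_nonneg_nonneg)
    finally have "(1 + y) ^ N * norm (gauss (L t)) \<le> (2 / a) ^ N * (real N ^ N * exp (a * (1 + y\<^sup>2))) * exp (- (a * y\<^sup>2))"
      using g a by (intro mult_mono) auto
    also have "\<dots> = (2 / a) ^ N * (real N ^ N * exp a)"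
      by (simp add: distrib_left exp_add exp_minus)
    finally show ?thesis by (simp add: y_def)
  qed
  then show ?case by iprover
next
  case (lin h v)
  \<comment> \<open>The linear factor costs one power of 1 + |t|, which the induction hypothesis at
    \<open>Suc N\<close> provides.\<close>
  obtain C where C: "\<And>t. (1 + norm t) ^ Suc N * norm (h t) \<le> C" using lin.IH by blast
  have "(1 + norm t) ^ N * norm (of_real (v \<bullet> t) * h t) \<le> norm v * C" for t
  proof -
    have "\<bar>v \<bullet> t\<bar> \<le> norm v * (1 + norm t)"
      using add_mono[OF norm_ge_zero[of v] Cauchy_Schwarz_ineq2[of v t]] by (simp add: distrib_left)
    then have "(1 + norm t) ^ N * norm (of_real (v \<bullet> t) * h t) \<le> (1 + norm t) ^ N * (norm v * (1 + norm t) * norm (h t))"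
      unfolding norm_mult norm_of_real by (intro mult_left_mono mult_right_mono) auto
    also have "\<dots> = norm v * ((1 + norm t) ^ Suc N * norm (h t))" by simp
    also have "\<dots> \<le> norm v * C" by (intro mult_left_mono C) auto
    finally show ?thesis .
  qed
  then show ?case by iprover
next
  case (add h k)
  obtain A B where AB: "\<And>t. (1 + norm t) ^ N * norm (h t) \<le> A" "\<And>t. (1 + norm t) ^ N * norm (k t) \<le> B"
    using add.IH by blast
  have "(1 + norm t) ^ N * norm (h t + k t) \<le> A + B" for t
  proof -
    have "(1 + norm t) ^ N * norm (h t + k t) \<le> (1 + norm t) ^ N * (norm (h t) + norm (k t))"
      by (intro mult_left_mono norm_triangle_ineq) auto
    also have "\<dots> \<le> A + B" unfolding distrib_left by (intro add_mono AB)
    finally show ?thesis .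
  qed
  then show ?case by iprover
next
  case (scale h c)
  obtain A where A: "\<And>t. (1 + norm t) ^ N * norm (h t) \<le> A"
    using scale.IH by blast
  have "(1 + norm t) ^ N * norm (c * h t) \<le> norm c * A" for t
    using mult_left_mono[OF A[of t] norm_ge_zero[of c]] by (simp add: norm_mult mult.left_commute)
  then show ?case by iprover
qed

lemma gauss_linear_schwartz:
  fixes L :: "'a::euclidean_space \<Rightarrow> 'a"
  assumes L: "linear L" "inj L"
  shows "(\<lambda>t. gauss (L t)) \<in> schwartz"
proof (rule schwartzI[OF gauss_polys.base[of L]])
  fix h assume h: "h \<in> gauss_polys L"
  obtain D where D: "\<And>t. (h has_derivative D t) (at t)" "\<And>b. (\<lambda>t. D t b) \<in> gauss_polys L"
    using gauss_polys_deriv[OF L(1) h] by blast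
  show "h differentiable (at t)" for t using D(1) unfolding differentiable_def by blast
  have "frechet_derivative h (at t) = D t" for t using frechet_derivative_at[OF D(1)] by simp
  then show "(\<lambda>t. frechet_derivative h (at t) b) \<in> gauss_polys L" for b using D(2) by simp
  show "\<exists>C. \<forall>t. (1 + norm t) ^ N * norm (h t) \<le> C" for N by (rule gauss_polys_decay[OF L h])
qed

lemma gauss_schwartz: "(gauss :: 'a::euclidean_space \<Rightarrow> complex) \<in> schwartz"
  using gauss_linear_schwartz[of "\<lambda>x::'a. x"] by (simp add: linear_iff inj_on_def)

text \<open>For fixed x the transform is the Fourier transform of f(t) cnj(g(t - x)). Inverting it,
  multiplying by g(t - x) and integrating over x produces the squared norm of \<open>g\<close>.
  Integrability is asked of the windowed products, which is what membership in \<open>M1\<close>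
  yields.\<close>

lemma stf_fourier_inversion:
  fixes f g :: "'a::euclidean_space \<Rightarrow> complex"
  assumes f: "continuous_on UNIV f" and g: "continuous_on UNIV g" and bd: "\<And>t. norm (g t) \<le> B"
    and i: "\<And>x. integrable lborel (\<lambda>t. f t * cnj (g (t - x)))"
    and V: "integrable lborel (stf g f)"
  shows "f t * (LINT s|lborel. g s * cnj (g s)) = (LINT z|lborel. stf g f z * atom g z t)"
proof -
  have [measurable]: "f \<in> borel_measurable borel" "g \<in> borel_measurable borel"
    using f g by (auto intro: borel_measurable_continuous_onI)
  have [measurable]: "stf g f \<in> borel_measurable borel" by (rule stf_measurable) measurable
  have m: "(\<lambda>z. stf g f z * atom g z t) \<in> borel_measurable borel"
  proof (rule borel_measurable_times)
    show "(\<lambda>z. atom g z t) \<in> borel_measurable (borel :: ('a \<times> 'a) measure)"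
      unfolding atom_def borel_prod[symmetric] by measurable
  qed measurable
  have i2: "integrable lborel (\<lambda>z. stf g f z * atom g z t)"
  proof (rule Bochner_Integration.integrable_bound)
    show "integrable lborel (\<lambda>z. of_real B * stf g f z)" using V by simp
    show "AE z in lborel. norm (stf g f z * atom g z t) \<le> norm (of_real B * stf g f z)"
      using bd by (intro AE_I2) (auto simp: norm_mult atom_def mult.commute intro!: mult_right_mono order_trans[OF bd abs_ge_self])
  qed (use m in simp)
  \<comment> \<open>Fubini gives integrability in \<omega> only for almost all x, which is enough
    because x is integrated next.\<close>
  have "AE x in lborel. f t * (g (t - x) * cnj (g (t - x))) = (LINT \<omega>|lborel. stf g f (x, \<omega>) * atom g (x, \<omega>) t)"
    using lborel_AE_integrable_fst[OF V]
  proof eventually_elim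
    fix x assume V: "integrable lborel (\<lambda>\<omega>. stf g f (x, \<omega>))"
    define h where "h t = f t * cnj (g (t - x))" for t
    have e: "stf g f (x, \<omega>) = (LINT s|lborel. h s * ch (- (\<omega> \<bullet> s)))" for \<omega>
      by (simp add: stf_def atom_def h_def mult_ac)
    have "continuous_on UNIV h" unfolding h_def
      by (intro continuous_intros f continuous_on_compose2[OF g]) auto
    then have "(LINT \<omega>|lborel. (LINT s|lborel. h s * ch (- (\<omega> \<bullet> s))) * ch (\<omega> \<bullet> t)) = h t"
      by (rule fourier_inversion) (use i V e in \<open>auto simp: h_def[abs_def]\<close>)
    then have "f t * cnj (g (t - x)) * g (t - x) = (LINT \<omega>|lborel. stf g f (x, \<omega>) * ch (\<omega> \<bullet> t)) * g (t - x)"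
      by (simp add: e h_def)
    also have "\<dots> = (LINT \<omega>|lborel. stf g f (x, \<omega>) * atom g (x, \<omega>) t)"
      by (simp add: atom_def flip: integral_mult_left_zero mult.assoc)
    finally show "f t * (g (t - x) * cnj (g (t - x))) = (LINT \<omega>|lborel. stf g f (x, \<omega>) * atom g (x, \<omega>) t)"
      by (simp add: mult_ac)
  qed
  then have "(LINT x|lborel. f t * (g (t - x) * cnj (g (t - x)))) = (LINT x|lborel. LINT \<omega>|lborel. stf g f (x, \<omega>) * atom g (x, \<omega>) t)"
    using lborel_integrable_fst[OF i2] by (intro integral_cong_AE) auto
  also have "\<dots> = (LINT z|lborel. stf g f z * atom g z t)"
    by (rule lborel_integral_fst[OF i2])
  finally show ?thesis
    using lborel_reflect_integral[of "\<lambda>s. g s * cnj (g s)" t] by simp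
qed

lemma stf_family_measurable:
  fixes u :: "'z::euclidean_space \<Rightarrow> 'a::euclidean_space \<Rightarrow> complex"
  assumes um: "case_prod u \<in> borel_measurable borel" and [measurable]: "g \<in> borel_measurable borel"
  shows "(\<lambda>p. stf g (u (fst p)) (snd p)) \<in> borel_measurable borel"
    and "(\<lambda>z. LINT w|lborel. norm (stf g (u z) w)) \<in> borel_measurable borel"
proof -
  have um': "(\<lambda>p. u (fst p) (snd p)) \<in> borel_measurable (borel \<Otimes>\<^sub>M borel)"
    using um by (simp add: borel_prod split_beta')
  \<comment> \<open>Passes the joint measurability of the curried \<open>u\<close> to the
    measurability prover, for both arguments depending on the same point.\<close>
  have [measurable (raw)]: "(\<lambda>p. u (f p) (h p)) \<in> borel_measurable M"
    if "f \<in> borel_measurable M" "h \<in> borel_measurable M" for f h and M :: "'p measure"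
    using measurable_compose[OF measurable_Pair[OF that] um'] by simp
  have "(\<lambda>(p, t). u (fst p) t * cnj (atom g (snd p) t)) \<in> borel_measurable (borel \<Otimes>\<^sub>M lborel)"
    unfolding borel_prod[symmetric] atom_def by measurable
  then show 1: "(\<lambda>p. stf g (u (fst p)) (snd p)) \<in> borel_measurable borel"
    unfolding stf_def by (rule lborel.borel_measurable_lebesgue_integral)
  have "(\<lambda>z. LINT w|lborel. norm (stf g (u z) w)) \<in> borel_measurable lborel"
    using 1 by (intro lborel.borel_measurable_lebesgue_integral) (simp add: split_beta' lborel_prod)
  then show "(\<lambda>z. LINT w|lborel. norm (stf g (u z) w)) \<in> borel_measurable borel" by simp
qed

text \<open>Minkowski's integral inequality for the M^1 norm: Fubini moves the transform inside the
  superposition, and the triangle inequality does the rest. The bound keeps the norm of each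
  \<open>u z\<close> under the integral instead of \<open>K\<close>, since the density argument
  needs these norms to tend to 0 pointwise.\<close>

lemma synthesis:
  fixes a :: "'z::euclidean_space \<Rightarrow> complex" and u :: "'z \<Rightarrow> 'a::euclidean_space \<Rightarrow> complex"
  assumes a: "integrable lborel a"
    and um: "case_prod u \<in> borel_measurable borel"
    and uc: "\<And>z. continuous_on UNIV (u z)"
    and ub: "\<And>z t. norm (u z t) \<le> B"
    and ui: "\<And>z. integrable lborel (u z)" "\<And>z. (LINT t|lborel. norm (u z t)) \<le> B1"
    and g: "g \<in> borel_measurable borel" "\<And>t. norm (g t) \<le> Bg"
    and uV: "\<And>z. integrable lborel (stf g (u z))" "\<And>z. (LINT w|lborel. norm (stf g (u z) w)) \<le> K"
  defines "F \<equiv> \<lambda>t. LINT z|lborel. a z * u z t"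
  shows "continuous_on UNIV F" "integrable lborel F" "integrable lborel (stf g F)"
    and "(LINT w|lborel. norm (stf g F w)) \<le> (LINT z|lborel. norm (a z) * (LINT w|lborel. norm (stf g (u z) w)))"
proof -
  have [measurable]: "a \<in> borel_measurable borel" "g \<in> borel_measurable borel" using a g by auto
  have um': "(\<lambda>p. u (fst p) (snd p)) \<in> borel_measurable (borel \<Otimes>\<^sub>M borel)"
    using um by (simp add: borel_prod split_beta')
  have [measurable (raw)]: "(\<lambda>p. u (f p) (h p)) \<in> borel_measurable M"
    if "f \<in> borel_measurable M" "h \<in> borel_measurable M" for f h and M :: "'p measure"
    using measurable_compose[OF measurable_Pair[OF that] um'] by simp
  have uz [measurable]: "u z \<in> borel_measurable borel" for z
    using uc by (rule borel_measurable_continuous_onI)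
  show "continuous_on UNIV F" unfolding F_def
  proof (rule continuous_on_lborel_integral)
    show "integrable lborel (\<lambda>z. norm (a z) * B)" using a by simp
    show "norm (a z * u z t) \<le> norm (a z) * B" for z t
      unfolding norm_mult by (intro mult_left_mono ub) auto
  qed (auto intro!: continuous_intros uc)
  have J: "integrable lborel (\<lambda>(z, t). a z * u z t)"
  proof (rule lborel_Fubini_integrable)
    show "(\<lambda>(z, t). a z * u z t) \<in> borel_measurable lborel"
      unfolding measurable_lborel2 borel_prod[symmetric] by measurable
    show "AE z in lborel. integrable lborel (\<lambda>t. case (z, t) of (z, t) \<Rightarrow> a z * u z t)"
      using ui by simp
    have "integrable lborel (\<lambda>z. norm (a z) * (LINT t|lborel. norm (u z t)))"
    proof (rule Bochner_Integration.integrable_bound)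
      show "integrable lborel (\<lambda>z. norm (a z) * B1)" using a by simp
      show "AE z in lborel. norm (norm (a z) * (LINT t|lborel. norm (u z t))) \<le> norm (norm (a z) * B1)"
        using ui(2) by (intro AE_I2) (auto simp: abs_mult intro!: mult_left_mono order_trans[OF ui(2) abs_ge_self])
    qed measurable
    then show "integrable lborel (\<lambda>z. LINT t|lborel. norm (case (z, t) of (z, t) \<Rightarrow> a z * u z t))"
      by (simp add: norm_mult)
  qed
  from lborel_integrable_snd[OF this] show "integrable lborel F" by (simp add: F_def)
  have Jm: "(\<lambda>(z, t). a z * u z t * cnj (atom g w t)) \<in> borel_measurable borel" for w
    unfolding borel_prod[symmetric] atom_def by measurable
  have Jw: "integrable lborel (\<lambda>(z, t). a z * u z t * cnj (atom g w t))" for w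
  proof (rule Bochner_Integration.integrable_bound)
    show "integrable lborel (\<lambda>p. of_real Bg * (case p of (z, t) \<Rightarrow> a z * u z t))" using J by simp
    show "AE p in lborel. norm (case p of (z, t) \<Rightarrow> a z * u z t * cnj (atom g w t))
        \<le> norm (of_real Bg * (case p of (z, t) \<Rightarrow> a z * u z t))"
      by (intro AE_I2) (auto simp: norm_mult atom_def mult.commute intro!: mult_right_mono order_trans[OF g(2) abs_ge_self])
  qed (use Jm in simp)
  \<comment> \<open>Boundedness of the window makes the triple product jointly integrable, so the
    superposition and the transform may be interchanged.\<close>
  have V: "stf g F w = (LINT z|lborel. a z * stf g (u z) w)" for w
  proof -
    have "stf g F w = (LINT t|lborel. LINT z|lborel. a z * u z t * cnj (atom g w t))"
      by (simp add: stf_def F_def)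
    also have "\<dots> = (LINT z|lborel. LINT t|lborel. a z * u z t * cnj (atom g w t))"
      by (rule lborel_Fubini_integral[OF Jw])
    also have "\<dots> = (LINT z|lborel. a z * stf g (u z) w)"
      by (simp add: stf_def mult.assoc)
    finally show ?thesis .
  qed
  note Vm = stf_family_measurable(1)[OF um g(1)]
  have JV: "integrable lborel (\<lambda>(z, w). a z * stf g (u z) w)"
  proof (rule lborel_Fubini_integrable)
    have "(\<lambda>p. a (fst p) * stf g (u (fst p)) (snd p)) \<in> borel_measurable borel"
    proof (rule borel_measurable_times[OF _ Vm])
      show "(\<lambda>p. a (fst p)) \<in> borel_measurable (borel :: ('z \<times> ('a \<times> 'a)) measure)"
        unfolding borel_prod[symmetric] by measurable
    qed
    then show "(\<lambda>(z, w). a z * stf g (u z) w) \<in> borel_measurable lborel"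
      by (simp add: split_beta')
    show "AE z in lborel. integrable lborel (\<lambda>w. case (z, w) of (z, w) \<Rightarrow> a z * stf g (u z) w)"
      using uV by simp
    note m = stf_family_measurable(2)[OF um g(1)]
    have "integrable lborel (\<lambda>z. norm (a z) * (LINT t|lborel. norm (stf g (u z) t)))"
    proof (rule Bochner_Integration.integrable_bound)
      show "integrable lborel (\<lambda>z. norm (a z) * K)" using a by simp
      show "AE z in lborel. norm (norm (a z) * (LINT t|lborel. norm (stf g (u z) t))) \<le> norm (norm (a z) * K)"
        by (intro AE_I2) (auto simp: abs_mult intro!: mult_left_mono order_trans[OF uV(2) abs_ge_self])
    qed (use m in measurable)
    then show "integrable lborel (\<lambda>z. LINT w|lborel. norm (case (z, w) of (z, w) \<Rightarrow> a z * stf g (u z) w))"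
      by (simp add: norm_mult)
  qed
  from lborel_integrable_snd[OF this] show iV: "integrable lborel (stf g F)" by (simp add: V[abs_def])
  have nJV: "integrable lborel (\<lambda>(z, w). norm (a z * stf g (u z) w))"
    using integrable_norm[OF JV] by (simp add: split_beta')
  have "(LINT w|lborel. norm (stf g F w)) \<le> (LINT w|lborel. LINT z|lborel. norm (a z * stf g (u z) w))"
    unfolding V using lborel_integrable_snd[OF JV] lborel_integrable_snd[OF nJV]
    by (intro integral_mono) auto
  also have "\<dots> = (LINT z|lborel. LINT w|lborel. norm (a z * stf g (u z) w))"
    by (rule lborel_Fubini_integral[OF nJV])
  also have "\<dots> = (LINT z|lborel. norm (a z) * (LINT w|lborel. norm (stf g (u z) w)))"
    by (simp add: norm_mult)
  finally show "(LINT w|lborel. norm (stf g F w)) \<le> (LINT z|lborel. norm (a z) * (LINT w|lborel. norm (stf g (u z) w)))" .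
qed

section \<open>Independence of the window\<close>

definition window :: "('a::euclidean_space \<Rightarrow> complex) \<Rightarrow> bool" where
  "window v \<longleftrightarrow> continuous_on UNIV v \<and> integrable lborel v \<and> (\<exists>B. \<forall>t. norm (v t) \<le> B)"

definition stf_norm :: "('a::euclidean_space \<Rightarrow> complex) \<Rightarrow> ('a \<Rightarrow> complex) \<Rightarrow> real" where
  "stf_norm g f = (LINT w|lborel. norm (stf g f w))"

text \<open>Feichtinger's algebra as a set of functions. Integrability of \<open>f\<close> is
  included so that its transform with any bounded continuous window converges absolutely; for
  members of \<open>M1\<close> it is derived in \<open>change_window\<close>.\<close>

definition feichtinger :: "('a::euclidean_space \<Rightarrow> complex) \<Rightarrow> ('a \<Rightarrow> complex) set" where
  "feichtinger g = {f. continuous_on UNIV f \<and> integrable lborel f \<and> integrable lborel (stf g f)}"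

lemma windowD:
  assumes "window v"
  shows "continuous_on UNIV v" "integrable lborel v" "v \<in> borel_measurable borel" "\<exists>B. \<forall>t. norm (v t) \<le> B"
  using assms by (auto simp: window_def intro: borel_measurable_continuous_onI)

lemma feichtingerD:
  assumes "f \<in> feichtinger g"
  shows "continuous_on UNIV f" "integrable lborel f" "integrable lborel (stf g f)" "f \<in> borel_measurable borel"
  using assms by (auto simp: feichtinger_def intro: borel_measurable_continuous_onI)

lemma schwartz_bounded:
  assumes "f \<in> schwartz"
  shows "\<exists>B. \<forall>t. norm (f t) \<le> B"
  using schwartz_decay[OF assms, of 0] by simp

lemma schwartz_window: "v \<in> schwartz \<Longrightarrow> window v"
  by (simp add: window_def schwartz_bounded schwartz_continuous schwartz_integrable)

lemma window_gauss: "window gauss"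
  by (intro schwartz_window gauss_schwartz)

section \<open>Atoms and their invariance under time-frequency shifts\<close>

lemma integrable_times_bounded:
  fixes f g :: "'a::euclidean_space \<Rightarrow> complex"
  assumes f: "integrable lborel f" and g: "g \<in> borel_measurable borel" "\<And>t. norm (g t) \<le> B"
  shows "integrable lborel (\<lambda>t. f t * g t)"
proof (rule Bochner_Integration.integrable_bound)
  show "integrable lborel (\<lambda>t. of_real B * f t)" using f by simp
  show "AE t in lborel. norm (f t * g t) \<le> norm (of_real B * f t)"
    unfolding norm_mult norm_of_real mult.commute[of "norm (f _)"]
    by (intro AE_I2 mult_right_mono order_trans[OF g(2) abs_ge_self] norm_ge_zero)
qed (use f g in auto)

lemma atom_measurable:
  assumes [measurable]: "v \<in> borel_measurable borel"
  shows "atom v z \<in> borel_measurable borel"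
  unfolding atom_def[abs_def] by measurable

lemma atom_family_measurable:
  fixes s :: "'z::euclidean_space \<Rightarrow> 'a::euclidean_space \<times> 'a"
  assumes [measurable]: "v \<in> borel_measurable borel" and s: "s \<in> borel_measurable borel"
  shows "(\<lambda>p. atom v (s (fst p)) (snd p)) \<in> borel_measurable (borel :: ('z \<times> 'a) measure)"
proof -
  have [measurable]: "(\<lambda>z. fst (s z)) \<in> borel_measurable borel" "(\<lambda>z. snd (s z)) \<in> borel_measurable borel"
    by (rule measurable_compose[OF s borel_measurable_continuous_onI[OF continuous_on_fst[OF continuous_on_id]]],
        rule measurable_compose[OF s borel_measurable_continuous_onI[OF continuous_on_snd[OF continuous_on_id]]])
  show ?thesis unfolding atom_def borel_prod[symmetric] by measurable
qed

lemma continuous_on_atom: "continuous_on UNIV v \<Longrightarrow> continuous_on UNIV (atom v z)"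
  unfolding atom_def[abs_def]
  by (intro continuous_on_mult continuous_on_ch continuous_on_compose2[of UNIV v "UNIV" "\<lambda>t. t - fst z"])
    (auto intro!: continuous_intros)

lemma norm_atom: "norm (atom v z t) = norm (v (t - fst z))"
  by (simp add: atom_def norm_mult)

lemma integrable_atom:
  assumes v: "integrable lborel v"
  shows "integrable lborel (atom v z)"
proof (rule Bochner_Integration.integrable_bound)
  show "integrable lborel (\<lambda>t. v (t - fst z))" using lborel_translate_integrable[of v "- fst z"] v by simp
  show "atom v z \<in> borel_measurable lborel" using v by (simp add: atom_measurable)
qed (simp add: norm_atom)

lemma integral_norm_atom: "(LINT t|lborel. norm (atom v z t)) = (LINT t|lborel. norm (v t))"
  using lborel_translate_integral[of "\<lambda>t. norm (v t)" "- fst z"] by (simp add: norm_atom)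

lemma integrable_stf_integrand:
  assumes g: "window g" and f: "integrable lborel f"
  shows "integrable lborel (\<lambda>t. f t * cnj (atom g z t))"
proof -
  obtain B where B: "\<And>t. norm (g t) \<le> B" using windowD(4)[OF g] by blast
  have "(\<lambda>t. cnj (atom g z t)) \<in> borel_measurable borel"
    using measurable_compose[OF atom_measurable cnj_measurable] windowD(3)[OF g] by blast
  then show ?thesis by (rule integrable_times_bounded[OF f, where B=B]) (simp add: norm_atom B)
qed

lemma stf_add_scale:
  assumes g: "window g" and f: "integrable lborel f" "integrable lborel h"
  shows "stf g (\<lambda>t. a * f t + b * h t) z = a * stf g f z + b * stf g h z"
  using integrable_stf_integrand[OF g f(1), of z] integrable_stf_integrand[OF g f(2), of z]
  by (simp add: stf_def distrib_right mult.assoc)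

lemma feichtinger_add_scale:
  assumes g: "window g" and f: "f \<in> feichtinger g" "h \<in> feichtinger g"
  shows "(\<lambda>t. a * f t + b * h t) \<in> feichtinger g"
proof -
  have "stf g (\<lambda>t. a * f t + b * h t) = (\<lambda>z. a * stf g f z + b * stf g h z)"
    by (rule ext) (intro stf_add_scale g feichtingerD(2)[OF f(1)] feichtingerD(2)[OF f(2)])
  then show ?thesis
    unfolding feichtinger_def mem_Collect_eq using feichtingerD[OF f(1)] feichtingerD[OF f(2)]
    by (auto intro!: continuous_on_add continuous_on_mult_left)
qed

text \<open>Covariance: translating the integration variable by \<open>fst z\<close> merges the two
  shifts into one by w - z, up to a phase constant in t. Hence all atoms of a function have the same
  M^1 norm.\<close>

lemma norm_stf_atom:
  "norm (stf g (atom u z) w) = norm (stf g u (w - z))"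
proof -
  have e: "atom u z (t + fst z) * cnj (atom g w (t + fst z)) =
      ch ((snd z - snd w) \<bullet> fst z) * (u t * cnj (atom g (w - z) t))" for t
  proof -
    have "ch (snd z \<bullet> (t + fst z)) * ch (- (snd w \<bullet> (t + fst z))) =
        ch ((snd z - snd w) \<bullet> fst z) * ch (- (snd (w - z) \<bullet> t))"
      by (simp flip: ch_add) (simp add: inner_add_right inner_diff_left algebra_simps)
    moreover have gg: "t + fst z - fst w = t - (fst w - fst z)" by simp
    ultimately show ?thesis by (simp add: atom_def gg mult_ac)
  qed
  have "stf g (atom u z) w = (LINT t|lborel. atom u z (t + fst z) * cnj (atom g w (t + fst z)))"
    unfolding stf_def by (rule lborel_translate_integral[symmetric])
  also have "\<dots> = ch ((snd z - snd w) \<bullet> fst z) * stf g u (w - z)"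
    unfolding e by (simp add: stf_def)
  finally show ?thesis by (simp add: norm_mult)
qed

lemma stf_atom_integrable:
  assumes g: "g \<in> borel_measurable borel" and v: "v \<in> borel_measurable borel" "integrable lborel (stf g v)"
  shows "integrable lborel (stf g (atom v z))"
proof (rule Bochner_Integration.integrable_bound)
  show "integrable lborel (\<lambda>w. stf g v (w - z))"
    using lborel_translate_integrable[of "stf g v" "- z"] v by simp
  show "stf g (atom v z) \<in> borel_measurable lborel"
    using stf_measurable[OF g atom_measurable[OF v(1)]] by simp
qed (simp add: norm_stf_atom)

lemma stf_norm_atom: "stf_norm g (atom v z) = stf_norm g v"
  using lborel_translate_integral[of "\<lambda>w. norm (stf g v w)" "- z"]
  by (simp add: stf_norm_def norm_stf_atom)

lemma stf_norm_nonneg: "0 \<le> stf_norm g f"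
  by (simp add: stf_norm_def)

lemma atom_feichtinger:
  assumes "window g" "window v" "integrable lborel (stf g v)"
  shows "atom v z \<in> feichtinger g"
  using assms by (simp add: feichtinger_def windowD continuous_on_atom integrable_atom stf_atom_integrable)

text \<open>Unimodular factors and shifts change none of the norms that \<open>synthesis\<close>
  wants bounded uniformly in z. So \<open>s\<close> may be any measurable map: a linear one for
  operators, a step function for the density argument.\<close>

lemma atomic_synthesis:
  fixes a c :: "'z::euclidean_space \<Rightarrow> complex" and s :: "'z \<Rightarrow> 'a::euclidean_space \<times> 'a"
  assumes a: "integrable lborel a" and s: "s \<in> borel_measurable borel"
    and c: "c \<in> borel_measurable borel" "\<And>z. norm (c z) = 1"
    and g: "window g" and v: "window v" "integrable lborel (stf g v)"
  defines "F \<equiv> \<lambda>t. LINT z|lborel. a z * (c z * atom v (s z) t)"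
  shows "F \<in> feichtinger g" "stf_norm g F \<le> stf_norm g v * (LINT z|lborel. norm (a z))"
proof -
  obtain B where B: "\<And>t. norm (v t) \<le> B" using windowD(4)[OF v(1)] by blast
  obtain Bg where Bg: "\<And>t. norm (g t) \<le> Bg" using windowD(4)[OF g] by blast
  have n: "norm (stf g (\<lambda>t. c z * atom v (s z) t) w) = norm (stf g (atom v (s z)) w)" for z w
    using c(2) by (simp add: stf_def mult.assoc norm_mult)
  have K: "(LINT w|lborel. norm (stf g (\<lambda>t. c z * atom v (s z) t) w)) = stf_norm g v" for z
    unfolding n stf_norm_def[symmetric] by (rule stf_norm_atom)
  have um: "(\<lambda>(z, t). c z * atom v (s z) t) \<in> borel_measurable borel"
  proof -
    have "(\<lambda>p. c (fst p)) \<in> borel_measurable (borel :: ('z \<times> 'a) measure)"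
      using c(1) unfolding borel_prod[symmetric] by measurable
    from borel_measurable_times[OF this atom_family_measurable[OF windowD(3)[OF v(1)] s]]
    show ?thesis by (simp add: split_beta')
  qed
  have um2: "(\<lambda>t. c z * atom v (s z) t) \<in> borel_measurable borel" for z
    using atom_measurable[OF windowD(3)[OF v(1)], of "s z"] by simp
  have "stf g (\<lambda>t. c z * atom v (s z) t) \<in> borel_measurable borel" for z
    by (intro stf_measurable um2 windowD g)
  then have uV: "integrable lborel (stf g (\<lambda>t. c z * atom v (s z) t))" for z
    by (intro Bochner_Integration.integrable_bound[OF stf_atom_integrable[OF windowD(3)[OF g] windowD(3)[OF v(1)] v(2), of "s z"]])
      (auto simp: n)
  note S = synthesis[of a "\<lambda>z t. c z * atom v (s z) t" B "LINT t|lborel. norm (v t)" g Bg "stf_norm g v", OF a um _ _ _ _ windowD(3)[OF g] Bg uV]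
  have p1: "continuous_on UNIV (\<lambda>t. c z * atom v (s z) t)" for z
    by (intro continuous_intros continuous_on_atom windowD v)
  have p2: "norm (c z * atom v (s z) t) \<le> B" for z t by (simp add: norm_mult c norm_atom B)
  have p3: "integrable lborel (\<lambda>t. c z * atom v (s z) t)" for z
    using integrable_atom[OF windowD(2)[OF v(1)]] by simp
  have p4: "(LINT t|lborel. norm (c z * atom v (s z) t)) \<le> (LINT t|lborel. norm (v t))" for z
    by (simp add: norm_mult c integral_norm_atom)
  have p5: "(LINT w|lborel. norm (stf g (\<lambda>t. c z * atom v (s z) t) w)) \<le> stf_norm g v" for z
    by (simp add: K)
  show "F \<in> feichtinger g"
    unfolding feichtinger_def F_def using S(1-3)[OF p1 p2 p3 p4 p5] by simp
  show "stf_norm g F \<le> stf_norm g v * (LINT z|lborel. norm (a z))"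
    using S(4)[OF p1 p2 p3 p4 p5] unfolding F_def[symmetric] K
    by (simp add: stf_norm_def mult.commute)
qed

text \<open>If the integral vanished, the zero set of \<open>g\<close> would be closed and of full
  measure, hence everything.\<close>

lemma integral_norm_square_nonzero:
  fixes g :: "'a::euclidean_space \<Rightarrow> complex"
  assumes g: "window g" and nz: "g \<noteq> (\<lambda>t. 0)"
  shows "(LINT t|lborel. g t * cnj (g t)) \<noteq> 0"
proof
  obtain B where B: "\<And>t. norm (g t) \<le> B" using windowD(4)[OF g] by blast
  have "integrable lborel (\<lambda>t. g t * cnj (g t))"
    using windowD(3)[OF g] by (intro integrable_times_bounded[OF windowD(2)[OF g], where B=B]) (auto simp: B)
  from integrable_norm[OF this] have i: "integrable lborel (\<lambda>t. (norm (g t))\<^sup>2)"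
    by (simp add: norm_mult power2_eq_square)
  assume "(LINT t|lborel. g t * cnj (g t)) = 0"
  then have "(LINT t|lborel. (norm (g t))\<^sup>2) = 0"
    by (simp add: complex_norm_square[symmetric] flip: of_real_power)
  then have "AE t in lborel. g t = 0"
    using integral_nonneg_eq_0_iff_AE[OF i] by simp
  then have "AE t in lebesgue. t \<in> {t. g t = 0}" by (simp add: AE_completion)
  moreover have "closed {t. g t = 0}"
    using windowD(1)[OF g] by (intro closed_Collect_eq) auto
  ultimately have "t \<in> {t. g t = 0}" for t by (intro mem_closed_if_AE_lebesgue)
  then show False using nz by auto
qed

text \<open>The reconstruction of \<open>f\<close> from its transform with window \<open>g\<close>
  is read as a superposition of atoms of \<open>g\<close>, whose norms are measured with
  \<open>h\<close>. Integrability of \<open>f\<close> is gained on the way.\<close>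

lemma change_window:
  fixes f g :: "'a::euclidean_space \<Rightarrow> complex"
  assumes f: "continuous_on UNIV f" and i: "\<And>x. integrable lborel (\<lambda>t. f t * cnj (g (t - x)))"
    and V: "integrable lborel (stf g f)"
    and g: "window g" "g \<noteq> (\<lambda>t. 0)" and h: "window h" "integrable lborel (stf h g)"
  shows "f \<in> feichtinger h"
    and "stf_norm h f \<le> stf_norm h g / norm (LINT t|lborel. g t * cnj (g t)) * stf_norm g f"
proof -
  define c where "c = (LINT t|lborel. g t * cnj (g t))"
  have c: "c \<noteq> 0" unfolding c_def by (rule integral_norm_square_nonzero[OF g])
  obtain B where B: "\<And>t. norm (g t) \<le> B" using windowD(4)[OF g(1)] by blast
  have "f t = (LINT z|lborel. (stf g f z / c) * (1 * atom g z t))" for t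
    using stf_fourier_inversion[OF f windowD(1)[OF g(1)] B i V, of t] c by (simp add: c_def field_simps)
  \<comment> \<open>Here \<open>s\<close> is the identity and the phase is 1; folding this equation
    turns the conclusions of \<open>atomic_synthesis\<close> into statements about
    \<open>f\<close>.\<close>
  then have e: "f = (\<lambda>t. LINT z|lborel. (stf g f z / c) * (1 * atom g z t))" by auto
  note S = atomic_synthesis[of "\<lambda>z. stf g f z / c" "\<lambda>z. z" "\<lambda>z. 1" h g, OF _ _ _ _ h(1) g(1) h(2), folded e]
  show "f \<in> feichtinger h" by (rule S(1)) (use V in auto)
  have "stf_norm h f \<le> stf_norm h g * (LINT z|lborel. norm (stf g f z / c))" by (rule S(2)) (use V in auto)
  then show "stf_norm h f \<le> stf_norm h g / norm c * stf_norm g f" unfolding c_def[symmetric]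
    by (simp add: norm_divide stf_norm_def)
qed

lemma measurable_cnj_translate:
  assumes "window g" shows "(\<lambda>t. cnj (g (t - x))) \<in> borel_measurable borel"
proof -
  have [measurable]: "g \<in> borel_measurable borel" using windowD(3)[OF assms] .
  show ?thesis by measurable
qed

lemma integrable_times_translate:
  assumes f: "integrable lborel f" and g: "window g"
  shows "integrable lborel (\<lambda>t. f t * cnj (g (t - x)))"
proof -
  obtain B where B: "\<And>t. norm (g t) \<le> B" using windowD(4)[OF g] by blast
  show ?thesis
    by (rule integrable_times_bounded[OF f measurable_cnj_translate[OF g], where B=B]) (simp add: B)
qed

lemma gauss_nonzero: "gauss \<noteq> (\<lambda>t. 0)"
proof
  assume "gauss = (\<lambda>t::'a. 0)"
  from fun_cong[OF this, of 0] show False by (simp add: gauss_def)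
qed

section \<open>Identification of \<open>M1\<close> and expansion into Gaussian atoms\<close>

lemma schwartz_seminorm_0: "schwartz_seminorm 0 \<Phi> = (SUP x. norm (\<Phi> x))"
proof -
  have "{bs. bs \<in> lists Basis \<and> length bs \<le> 0} = {[] :: 'a list}" by auto
  then show ?thesis by (simp add: schwartz_seminorm_def iter_deriv_def)
qed

text \<open>An integrable function is a distribution of order 0: the supremum norm, which is the
  seminorm of index 0, controls it.\<close>

lemma regular_dist_tempered:
  fixes f :: "'a::euclidean_space \<Rightarrow> complex"
  assumes f: "integrable lborel f"
  shows "regular_dist f \<in> tempered"
proof -
  have i: "integrable lborel (\<lambda>t. f t * cnj (\<Phi> t))" if "\<Phi> \<in> schwartz" for \<Phi>
    using integrable_times_translate[OF f schwartz_window[OF that], of 0] by simp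
  have "conj_linear_on schwartz (regular_dist f)"
    unfolding conj_linear_on_def
  proof (intro ballI allI)
    fix \<Phi> \<Psi> :: "'a \<Rightarrow> complex" and a b assume s: "\<Phi> \<in> schwartz" "\<Psi> \<in> schwartz"
    have e: "f x * cnj (a * \<Phi> x + b * \<Psi> x) = cnj a * (f x * cnj (\<Phi> x)) + cnj b * (f x * cnj (\<Psi> x))" for x
      by (simp add: algebra_simps)
    show "regular_dist f (\<lambda>x. a * \<Phi> x + b * \<Psi> x) = cnj a * regular_dist f \<Phi> + cnj b * regular_dist f \<Psi>"
      unfolding regular_dist_def e using i[OF s(1)] i[OF s(2)] by simp
  qed
  moreover have "norm (regular_dist f \<Phi>) \<le> (LINT t|lborel. norm (f t)) * schwartz_seminorm 0 \<Phi>"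
    if s: "\<Phi> \<in> schwartz" for \<Phi>
  proof -
    have "bdd_above (range (\<lambda>x. norm (\<Phi> x)))" using schwartz_bounded[OF s] by (auto simp: bdd_above_def)
    then have le: "norm (\<Phi> t) \<le> schwartz_seminorm 0 \<Phi>" for t
      unfolding schwartz_seminorm_0 by (rule cSUP_upper[rotated]) simp
    have "norm (regular_dist f \<Phi>) \<le> (LINT t|lborel. norm (f t) * schwartz_seminorm 0 \<Phi>)"
      unfolding regular_dist_def
      by (rule Bochner_Integration.integral_norm_bound_integral[OF i[OF s]])
        (use f le in \<open>auto simp: norm_mult intro!: mult_left_mono\<close>)
    then show ?thesis by simp
  qed
  ultimately show ?thesis unfolding tempered_def by blast
qed

text \<open>The window is changed to the Gaussian in one direction and from the Gaussian in the
  other. The conditions on distributions follow from the integrability built into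
  \<open>feichtinger\<close>.\<close>

lemma M1_eq_feichtinger:
  assumes \<phi>: "\<phi> \<in> schwartz" "\<phi> \<noteq> (\<lambda>x. 0)"
  shows "M1 \<phi> = feichtinger gauss"
proof (intro equalityI subsetI)
  fix f assume f: "f \<in> M1 \<phi>"
  have "\<forall>\<Phi>\<in>schwartz. integrable lborel (\<lambda>t. f t * cnj (\<Phi> t))" using f by (simp add: M1_def)
  \<comment> \<open>Translates of \<phi> are test functions themselves, so the integrability
    required in \<open>M1\<close> covers the windowed products at every position.\<close>
  from bspec[OF this schwartz_translate[OF \<phi>(1)]]
  have i: "integrable lborel (\<lambda>t. f t * cnj (\<phi> (t - x)))" for x .
  have c: "continuous_on UNIV f" "integrable lborel (stf \<phi> f)"
    using f by (auto simp: M1_def M1_dist_def stft_regular_dist)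
  show "f \<in> feichtinger gauss"
    by (rule change_window(1)[OF c(1) i c(2) schwartz_window[OF \<phi>(1)] \<phi>(2) window_gauss
        stf_schwartz_integrable[OF \<phi>(1) gauss_schwartz]])
next
  fix f :: "'a \<Rightarrow> complex" assume f: "f \<in> feichtinger gauss"
  have f': "f \<in> feichtinger \<phi>"
    by (rule change_window(1)[OF feichtingerD(1)[OF f] integrable_times_translate[OF feichtingerD(2)[OF f] window_gauss]
        feichtingerD(3)[OF f] window_gauss gauss_nonzero schwartz_window[OF \<phi>(1)] stf_schwartz_integrable[OF gauss_schwartz \<phi>(1)]])
  have "integrable lborel (\<lambda>t. f t * cnj (\<Phi> t))" if "\<Phi> \<in> schwartz" for \<Phi>
    using integrable_times_translate[OF feichtingerD(2)[OF f] schwartz_window[OF that], of 0] by simp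
  then show "f \<in> M1 \<phi>"
    unfolding M1_def M1_dist_def mem_Collect_eq stft_regular_dist
    using feichtingerD[OF f'] regular_dist_tempered[OF feichtingerD(2)[OF f]] by blast
qed

text \<open>Moves the bound of a functional in \<open>Minf\<close> from the defining window to the
  Gaussian.\<close>

lemma M1_norm_le_stf_norm:
  fixes \<phi> :: "'a::euclidean_space \<Rightarrow> complex"
  assumes \<phi>: "\<phi> \<in> schwartz"
  obtains C where "0 \<le> C" "\<forall>f\<in>feichtinger gauss. M1_norm \<phi> f \<le> C * stf_norm gauss f"
proof
  show "0 \<le> stf_norm \<phi> gauss / norm (LINT t|lborel. gauss (t::'a) * cnj (gauss t))"
    by (simp add: stf_norm_nonneg)
  show "\<forall>f\<in>feichtinger gauss. M1_norm \<phi> f \<le> stf_norm \<phi> gauss / norm (LINT t|lborel. gauss (t::'a) * cnj (gauss t)) * stf_norm gauss f"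
  proof
    fix f :: "'a \<Rightarrow> complex" assume f: "f \<in> feichtinger gauss"
    have "stf_norm \<phi> f \<le> stf_norm \<phi> gauss / norm (LINT t|lborel. gauss (t::'a) * cnj (gauss t)) * stf_norm gauss f"
      by (rule change_window(2)[OF feichtingerD(1)[OF f] integrable_times_translate[OF feichtingerD(2)[OF f] window_gauss]
        feichtingerD(3)[OF f] window_gauss gauss_nonzero schwartz_window[OF \<phi>] stf_schwartz_integrable[OF gauss_schwartz \<phi>]])
    then show "M1_norm \<phi> f \<le> stf_norm \<phi> gauss / norm (LINT t|lborel. gauss (t::'a) * cnj (gauss t)) * stf_norm gauss f"
      by (simp add: M1_norm_def stft_regular_dist stf_norm_def)
  qed
qed

definition gcoef :: "('a::euclidean_space \<Rightarrow> complex) \<Rightarrow> 'a \<times> 'a \<Rightarrow> complex" where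
  "gcoef f z = stf gauss f z / (LINT t|lborel. gauss (t::'a) * cnj (gauss t))"

lemma gauss_expansion:
  fixes f :: "'a::euclidean_space \<Rightarrow> complex"
  assumes f: "f \<in> feichtinger gauss"
  shows "integrable lborel (gcoef f)" and "f t = (LINT z|lborel. gcoef f z * atom gauss z t)"
    and "(LINT z|lborel. norm (gcoef f z)) = stf_norm gauss f / norm (LINT t|lborel. gauss (t::'a) * cnj (gauss t))"
proof -
  show "integrable lborel (gcoef f)" unfolding gcoef_def[abs_def] using feichtingerD(3)[OF f] by simp
  have c: "(LINT t|lborel. gauss (t::'a) * cnj (gauss t)) \<noteq> 0"
    by (rule integral_norm_square_nonzero[OF window_gauss gauss_nonzero])
  have "f t * (LINT s|lborel. gauss (s::'a) * cnj (gauss s)) = (LINT z|lborel. stf gauss f z * atom gauss z t)"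
    by (rule stf_fourier_inversion[OF feichtingerD(1)[OF f] windowD(1)[OF window_gauss] norm_gauss_le
        integrable_times_translate[OF feichtingerD(2)[OF f] window_gauss] feichtingerD(3)[OF f]])
  then show "f t = (LINT z|lborel. gcoef f z * atom gauss z t)"
    using c by (simp add: gcoef_def field_simps del: cnj_gauss)
  show "(LINT z|lborel. norm (gcoef f z)) = stf_norm gauss f / norm (LINT t|lborel. gauss (t::'a) * cnj (gauss t))"
    by (simp add: gcoef_def norm_divide stf_norm_def del: cnj_gauss)
qed

section \<open>Partial Fourier transform, coordinate changes and tensor products\<close>

text \<open>Boundedness on M^1 alone; linearity enters as a separate premise of
  \<open>conj_linear_bounded_compose\<close>.\<close>

definition stf_bounded :: "(('a::euclidean_space \<Rightarrow> complex) \<Rightarrow> 'b::euclidean_space \<Rightarrow> complex) \<Rightarrow> bool" where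
  "stf_bounded T \<longleftrightarrow> (\<exists>C\<ge>0. \<forall>f\<in>feichtinger gauss. T f \<in> feichtinger gauss \<and> stf_norm gauss (T f) \<le> C * stf_norm gauss f)"

lemma stf_boundedD: "stf_bounded T \<Longrightarrow> f \<in> feichtinger gauss \<Longrightarrow> T f \<in> feichtinger gauss"
  by (auto simp: stf_bounded_def)

lemma stf_bounded_compose:
  assumes S: "stf_bounded S" and T: "stf_bounded T"
  shows "stf_bounded (\<lambda>f. S (T f))"
proof -
  obtain C where C: "C \<ge> 0" "\<And>f. f \<in> feichtinger gauss \<Longrightarrow> S f \<in> feichtinger gauss"
    "\<And>f. f \<in> feichtinger gauss \<Longrightarrow> stf_norm gauss (S f) \<le> C * stf_norm gauss f" using S unfolding stf_bounded_def by blast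
  obtain D where D: "D \<ge> 0" "\<And>f. f \<in> feichtinger gauss \<Longrightarrow> T f \<in> feichtinger gauss"
    "\<And>f. f \<in> feichtinger gauss \<Longrightarrow> stf_norm gauss (T f) \<le> D * stf_norm gauss f" using T unfolding stf_bounded_def by blast
  have "stf_norm gauss (S (T f)) \<le> (C * D) * stf_norm gauss f" if f: "f \<in> feichtinger gauss" for f
    using order_trans[OF C(3)[OF D(2)[OF f]] mult_left_mono[OF D(3)[OF f] C(1)]] by (simp add: mult.assoc)
  then show ?thesis unfolding stf_bounded_def using C D by (intro exI[of _ "C * D"]) simp
qed

lemma stf_bounded_atomic:
  fixes s :: "'a::euclidean_space \<times> 'a \<Rightarrow> 'b::euclidean_space \<times> 'b"
  assumes s: "s \<in> borel_measurable borel" and c: "c \<in> borel_measurable borel" "\<And>z. norm (c z) = 1"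
    and v: "v \<in> schwartz"
    and T: "\<And>f t. f \<in> feichtinger gauss \<Longrightarrow> T f t = (LINT z|lborel. gcoef f z * (c z * atom v (s z) t))"
  shows "stf_bounded T"
proof -
  define n where "n = norm (LINT t|lborel. gauss (t::'a) * cnj (gauss t))"
  have "T f \<in> feichtinger gauss \<and> stf_norm gauss (T f) \<le> stf_norm gauss v / n * stf_norm gauss f"
    if f: "f \<in> feichtinger gauss" for f
  proof -
    have "T f = (\<lambda>t. LINT z|lborel. gcoef f z * (c z * atom v (s z) t))" using T[OF f] by auto
    then show ?thesis
      using atomic_synthesis[OF gauss_expansion(1)[OF f] s c window_gauss schwartz_window[OF v] stf_schwartz_integrable[OF v gauss_schwartz]]
      unfolding gauss_expansion(3)[OF f] n_def by simp
  qed
  then show ?thesis unfolding stf_bounded_def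
    by (intro exI[of _ "stf_norm gauss v / n"]) (simp add: n_def stf_norm_nonneg)
qed

text \<open>An atom evaluated at Lt is ch(\<omega>.Lt) gauss(Lt - x), that is, the atom of the
  Schwartz function gauss(Lt) at position Mx and frequency L* \<omega>.\<close>

lemma stf_bounded_linear_change:
  fixes L M :: "'a::euclidean_space \<Rightarrow> 'a"
  assumes L: "linear L" "linear M" and LM: "\<And>x. L (M x) = x" "\<And>x. M (L x) = x"
  shows "stf_bounded (\<lambda>f t. f (L t))"
proof (rule stf_bounded_atomic[where c="\<lambda>z. 1" and v="\<lambda>t. gauss (L t)" and s="\<lambda>z. (M (fst z), adjoint L (snd z))"])
  have "linear (\<lambda>z. (M (fst z), adjoint L (snd z)))"
    using L(2) adjoint_linear[OF L(1)] by (simp add: linear_iff)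
  then show "(\<lambda>z. (M (fst z), adjoint L (snd z))) \<in> borel_measurable borel"
    by (intro borel_measurable_continuous_onI linear_continuous_on) (simp add: linear_conv_bounded_linear)
  show "(\<lambda>t. gauss (L t)) \<in> schwartz" by (rule gauss_linear_schwartz[OF L(1)]) (metis LM(2) injI)
  fix f :: "'a \<Rightarrow> complex" and t assume f: "f \<in> feichtinger gauss"
  have "L (t - M x) = L t - x" for x by (simp add: linear_diff[OF L(1)] LM)
  then show "f (L t) = (LINT z|lborel. gcoef f z * (1 * atom (\<lambda>t. gauss (L t)) (M (fst z), adjoint L (snd z)) t))"
    unfolding gauss_expansion(2)[OF f, of "L t"]
    by (simp add: atom_def adjoint_clauses(2)[OF L(1)])
qed auto

lemma gauss_Pair: "gauss (x, y) = gauss x * gauss y"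
  unfolding gauss_def of_real_mult[symmetric] exp_add[symmetric] by (simp add: algebra_simps)

lemma fourier2_ch: "fourier2 \<Phi> = (\<lambda>(x, \<omega>). LINT t|lborel. ch (- (\<omega> \<bullet> t)) * \<Phi> (x, t))"
  unfolding fourier2_def by (simp add: exp_eq_ch)

lemma fourier2_inv_ch: "fourier2_inv \<Phi> = (\<lambda>(x, t). LINT \<omega>|lborel. ch (\<omega> \<bullet> t) * \<Phi> (x, \<omega>))"
  unfolding fourier2_inv_def by (simp add: exp_eq_ch)

text \<open>Reflecting the second variable after \<open>fourier2\<close>, or before it as in
  \<open>fourier2_reflect\<close>, gives the inverse transform. Boundedness of the inverse and the
  second inversion identity are obtained from this.\<close>

lemma fourier2_inv_eq: "fourier2_inv \<Phi> p = fourier2 \<Phi> (fst p, - snd p)"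
  by (simp add: fourier2_ch fourier2_inv_ch split_beta' inner_commute)

lemma fourier2_reflect:
  fixes \<Phi> :: "(real^'n) \<times> (real^'n) \<Rightarrow> complex"
  shows "fourier2 (\<lambda>p. \<Phi> (fst p, - snd p)) = fourier2_inv \<Phi>"
proof
  fix p :: "(real^'n) \<times> (real^'n)"
  have "(LINT t|lborel. ch (- (snd p \<bullet> t)) * \<Phi> (fst p, - t)) = (LINT t|lborel. ch (snd p \<bullet> t) * \<Phi> (fst p, t))"
    using lborel_reflect_integral[of "\<lambda>t. ch (snd p \<bullet> t) * \<Phi> (fst p, t)" 0] by simp
  then show "fourier2 (\<lambda>p. \<Phi> (fst p, - snd p)) p = fourier2_inv \<Phi> p"
    by (simp add: fourier2_ch fourier2_inv_ch split_beta' inner_commute)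
qed

text \<open>In the transformed variable, modulation by \<tau> becomes translation by \<tau>, and
  translation by t0 becomes modulation by -t0; the Gaussian is reproduced, and reordering the two
  operations leaves the phase.\<close>

lemma fourier2_atom_gauss:
  fixes z :: "((real^'n) \<times> (real^'n)) \<times> ((real^'n) \<times> (real^'n))"
  shows "fourier2 (atom gauss z) p =
    ch (snd (snd z) \<bullet> snd (fst z)) * atom gauss ((fst (fst z), snd (snd z)), (fst (snd z), - snd (fst z))) p"
proof -
  obtain x0 t0 \<xi> \<tau> where z: "z = ((x0, t0), (\<xi>, \<tau>))" by (metis prod.collapse)
  obtain x \<omega> where p: "p = (x, \<omega>)" by (metis prod.collapse)
  let ?A = "ch (\<xi> \<bullet> x) * gauss (x - x0) * ch ((\<tau> - \<omega>) \<bullet> t0)"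
  have e: "ch (- (\<omega> \<bullet> (t + t0))) * atom gauss z (x, t + t0) = ?A * (ch ((\<tau> - \<omega>) \<bullet> t) * gauss t)" for t
  proof -
    have "ch (- (\<omega> \<bullet> (t + t0))) * ch (\<xi> \<bullet> x + \<tau> \<bullet> (t + t0)) = ch (\<xi> \<bullet> x) * ch ((\<tau> - \<omega>) \<bullet> t0) * ch ((\<tau> - \<omega>) \<bullet> t)"
      by (simp flip: ch_add) (simp add: inner_add_right inner_diff_left algebra_simps)
    then show ?thesis by (simp add: atom_def z gauss_Pair mult_ac)
  qed
  have "fourier2 (atom gauss z) p = (LINT t|lborel. ch (- (\<omega> \<bullet> t)) * atom gauss z (x, t))"
    by (simp add: fourier2_ch p)
  also have "\<dots> = (LINT t|lborel. ch (- (\<omega> \<bullet> (t + t0))) * atom gauss z (x, t + t0))"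
    by (rule lborel_translate_integral[symmetric])
  also have "\<dots> = ?A * gauss (\<tau> - \<omega>)"
    unfolding e by (simp add: fourier_gauss(2))
  also have "\<dots> = ch (\<tau> \<bullet> t0) * atom gauss ((x0, \<tau>), (\<xi>, - t0)) (x, \<omega>)"
  proof -
    have "ch (\<xi> \<bullet> x) * ch ((\<tau> - \<omega>) \<bullet> t0) = ch (\<tau> \<bullet> t0) * ch (\<xi> \<bullet> x - t0 \<bullet> \<omega>)"
      by (simp flip: ch_add) (simp add: inner_diff_left inner_commute algebra_simps)
    moreover have "gauss (\<tau> - \<omega>) = gauss (\<omega> - \<tau>)" using gauss_minus[of "\<omega> - \<tau>"] by simp
    ultimately show ?thesis by (simp add: atom_def gauss_Pair mult_ac)
  qed
  finally show ?thesis by (simp add: z p)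
qed

text \<open>Restricted to a fibre, every Gaussian atom has L^1 norm at most that of one Gaussian,
  uniformly in z. So the expansion is absolutely integrable on every fibre, not just on almost every
  one.\<close>

lemma gauss_expansion_fiber:
  fixes f :: "(real^'n) \<times> (real^'n) \<Rightarrow> complex"
  assumes f: "f \<in> feichtinger gauss"
  shows "integrable lborel (\<lambda>(z, t). gcoef f z * atom gauss z (x, t))"
proof (rule lborel_Fubini_integrable)
  have a: "integrable lborel (gcoef f)" by (rule gauss_expansion(1)[OF f])
  have [measurable]: "gcoef f \<in> borel_measurable borel" using a by auto
  have 1: "(\<lambda>p. gcoef f (fst p)) \<in> borel_measurable (borel :: (_ \<times> (real^'n)) measure)"
    unfolding borel_prod[symmetric, where 'b="real^'n"] by measurable
  have "(\<lambda>p. (fst p, (x, snd p))) \<in> borel_measurable (borel :: ((((real^'n) \<times> (real^'n)) \<times> ((real^'n) \<times> (real^'n))) \<times> (real^'n)) measure)"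
    by (intro borel_measurable_continuous_onI continuous_intros)
  from measurable_compose[OF this atom_family_measurable[OF gauss_measurable measurable_ident_sets[OF refl]]]
  have 2: "(\<lambda>p. atom gauss (fst p) (x, snd p)) \<in> borel_measurable (borel :: (_ \<times> (real^'n)) measure)" by simp
  show "(\<lambda>(z, t). gcoef f z * atom gauss z (x, t)) \<in> borel_measurable lborel"
    using borel_measurable_times[OF 1 2] by (simp add: split_beta')
  have n: "norm (atom gauss z (x, t)) = norm (gauss (x - fst (fst z))) * norm (gauss (t - snd (fst z)))" for z and t :: "real^'n"
    by (cases "fst z") (simp add: norm_atom gauss_Pair norm_mult)
  have g: "integrable lborel (\<lambda>t. gauss (t - y))" for y :: "real^'n"
    using lborel_translate_integrable[of gauss "- y"] integrable_gauss by simp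
  have m: "(\<lambda>t::real^'n. atom gauss z (x, t)) \<in> borel_measurable borel" for z
    using measurable_compose[OF borel_measurable_continuous_onI[OF continuous_on_Pair[OF continuous_on_const continuous_on_id]] atom_measurable[OF gauss_measurable]] .
  have i: "integrable lborel (\<lambda>t::real^'n. atom gauss z (x, t))" for z
  proof (rule Bochner_Integration.integrable_bound[OF g[of "snd (fst z)"]])
    show "AE t in lborel. norm (atom gauss z (x, t)) \<le> norm (gauss (t - snd (fst z)))"
      unfolding n using norm_gauss_le by (intro AE_I2 mult_left_le_one_le) auto
  qed (use m in simp)
  then show "AE z in lborel. integrable lborel (\<lambda>t. case (z, t) of (z, t) \<Rightarrow> gcoef f z * atom gauss z (x, t))"
    by simp
  define I where "I = (LINT t|lborel. norm (gauss (t::real^'n)))"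
  have I: "I \<ge> 0" by (simp add: I_def)
  have "(LINT t|lborel. norm (atom gauss z (x, t::real^'n))) = norm (gauss (x - fst (fst z))) * I" for z
    using lborel_translate_integral[of "\<lambda>t::real^'n. norm (gauss t)" "- snd (fst z)"] by (simp add: n I_def)
  then have e: "(LINT t|lborel. norm (gcoef f z * atom gauss z (x, t::real^'n))) = norm (gcoef f z) * (norm (gauss (x - fst (fst z))) * I)" for z
    by (simp add: norm_mult)
  have "(\<lambda>z. gauss (x - fst (fst z))) \<in> borel_measurable (borel :: (((real^'n) \<times> (real^'n)) \<times> ((real^'n) \<times> (real^'n))) measure)"
    by (intro borel_measurable_continuous_onI continuous_intros)
  then have "integrable lborel (\<lambda>z. norm (gcoef f z) * (norm (gauss (x - fst (fst z))) * I))"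
    using I norm_gauss_le
    by (intro Bochner_Integration.integrable_bound[OF integrable_mult_right[OF integrable_norm[OF a], of I]] AE_I2)
      (auto simp: mult.commute[of I] intro!: mult_left_mono mult_left_le_one_le)
  then show "integrable lborel (\<lambda>z. LINT t|lborel. norm (case (z, t) of (z, t) \<Rightarrow> gcoef f z * atom gauss z (x, t)))"
    by (simp add: e)
qed

lemma feichtinger_fiber_integrable:
  fixes f :: "(real^'n) \<times> (real^'n) \<Rightarrow> complex"
  assumes f: "f \<in> feichtinger gauss"
  shows "integrable lborel (\<lambda>t. f (x, t))"
  using lborel_integrable_snd[OF gauss_expansion_fiber[OF f, of x]] by (simp add: gauss_expansion(2)[OF f, symmetric])

lemma fourier2_gauss_expansion:
  fixes f :: "(real^'n) \<times> (real^'n) \<Rightarrow> complex"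
  assumes f: "f \<in> feichtinger gauss"
  shows "fourier2 f p = (LINT z|lborel. gcoef f z * fourier2 (atom gauss z) p)"
proof -
  obtain x \<omega> where p: "p = (x, \<omega>)" by (metis prod.collapse)
  have m: "(\<lambda>q. ch (- (\<omega> \<bullet> snd q))) \<in> borel_measurable (borel :: ((((real^'n) \<times> (real^'n)) \<times> ((real^'n) \<times> (real^'n))) \<times> (real^'n)) measure)"
    by (intro borel_measurable_continuous_onI continuous_intros)
  have i: "integrable lborel (\<lambda>(z, t). gcoef f z * (ch (- (\<omega> \<bullet> t)) * atom gauss z (x, t)))"
    using integrable_times_bounded[OF gauss_expansion_fiber[OF f, of x] m, of 1]
    by (simp add: split_beta' mult_ac)
  have "fourier2 f p = (LINT t|lborel. ch (- (\<omega> \<bullet> t)) * (LINT z|lborel. gcoef f z * atom gauss z (x, t)))"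
    by (simp add: fourier2_ch p gauss_expansion(2)[OF f, symmetric])
  also have "\<dots> = (LINT t|lborel. LINT z|lborel. gcoef f z * (ch (- (\<omega> \<bullet> t)) * atom gauss z (x, t)))"
    by (simp add: mult.left_commute flip: integral_mult_right_zero)
  also have "\<dots> = (LINT z|lborel. LINT t|lborel. gcoef f z * (ch (- (\<omega> \<bullet> t)) * atom gauss z (x, t)))"
    by (rule lborel_Fubini_integral[OF i])
  also have "\<dots> = (LINT z|lborel. gcoef f z * fourier2 (atom gauss z) p)"
    by (simp add: fourier2_ch p)
  finally show ?thesis .
qed

lemma stf_bounded_fourier2: "stf_bounded (fourier2 :: ((real^'n) \<times> (real^'n) \<Rightarrow> complex) \<Rightarrow> _)"
proof (rule stf_bounded_atomic[where v="gauss :: (real^'n) \<times> (real^'n) \<Rightarrow> complex" and c="\<lambda>z :: ((real^'n) \<times> (real^'n)) \<times> ((real^'n) \<times> (real^'n)). ch (snd (snd z) \<bullet> snd (fst z))"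
      and s="\<lambda>z. ((fst (fst z), snd (snd z)), (fst (snd z), - snd (fst z)))"])
  fix f :: "(real^'n) \<times> (real^'n) \<Rightarrow> complex" and p
  assume f: "f \<in> feichtinger gauss"
  show "fourier2 f p = (LINT z|lborel. gcoef f z * (ch (snd (snd z) \<bullet> snd (fst z)) *
      atom gauss ((fst (fst z), snd (snd z)), fst (snd z), - snd (fst z)) p))"
    unfolding fourier2_gauss_expansion[OF f] fourier2_atom_gauss ..
qed (auto intro!: borel_measurable_continuous_onI continuous_intros gauss_schwartz)

lemma stf_bounded_fourier2_inv: "stf_bounded (fourier2_inv :: ((real^'n) \<times> (real^'n) \<Rightarrow> complex) \<Rightarrow> _)"
proof -
  have "linear (\<lambda>p::(real^'n) \<times> (real^'n). (fst p, - snd p))" by (simp add: linear_iff)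
  then have "stf_bounded (\<lambda>(f :: (real^'n) \<times> (real^'n) \<Rightarrow> complex) p. f (fst p, - snd p))"
    by (intro stf_bounded_linear_change) auto
  from stf_bounded_compose[OF this stf_bounded_fourier2]
  show ?thesis by (simp add: fourier2_inv_eq[abs_def])
qed

text \<open>One-variable inversion on each fibre. Both \<open>f\<close> and its partial transform
  lie in the Feichtinger space, so both have integrable restrictions for every x.\<close>

lemma fourier2_inv_fourier2:
  fixes f :: "(real^'n) \<times> (real^'n) \<Rightarrow> complex"
  assumes f: "f \<in> feichtinger gauss"
  shows "fourier2_inv (fourier2 f) = f"
proof
  fix p :: "(real^'n) \<times> (real^'n)"
  obtain x t where p: "p = (x, t)" by (metis prod.collapse)
  define h where "h t = f (x, t)" for t
  have c: "continuous_on UNIV h" unfolding h_def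
    by (rule continuous_on_compose2[OF feichtingerD(1)[OF f]]) (auto intro!: continuous_intros)
  have i: "integrable lborel h" unfolding h_def by (rule feichtinger_fiber_integrable[OF f])
  have F: "fourier2 f (x, \<omega>) = (LINT s|lborel. h s * ch (- (\<omega> \<bullet> s)))" for \<omega>
    by (simp add: fourier2_ch h_def mult.commute)
  have "integrable lborel (\<lambda>\<omega>. fourier2 f (x, \<omega>))"
    by (rule feichtinger_fiber_integrable[OF stf_boundedD[OF stf_bounded_fourier2 f]])
  from fourier_inversion[OF c i this[unfolded F], of t]
  show "fourier2_inv (fourier2 f) p = f p"
    by (simp add: fourier2_inv_ch p F h_def mult.commute)
qed

lemma fourier2_fourier2_inv:
  fixes f :: "(real^'n) \<times> (real^'n) \<Rightarrow> complex"
  assumes f: "f \<in> feichtinger gauss"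
  shows "fourier2 (fourier2_inv f) = f"
  using fourier2_reflect[of "fourier2 f"] fourier2_inv_fourier2[OF f] by (simp add: fourier2_inv_eq[abs_def])

lemma fourier2_add_scale:
  fixes f h :: "(real^'n) \<times> (real^'n) \<Rightarrow> complex"
  assumes f: "f \<in> feichtinger gauss" and h: "h \<in> feichtinger gauss"
  shows "fourier2 (\<lambda>p. a * f p + b * h p) = (\<lambda>p. a * fourier2 f p + b * fourier2 h p)"
proof
  fix p :: "(real^'n) \<times> (real^'n)"
  obtain x \<omega> where p: "p = (x, \<omega>)" by (metis prod.collapse)
  have i: "integrable lborel (\<lambda>t. ch (- (\<omega> \<bullet> t)) * f (x, t))" if "f \<in> feichtinger gauss" for f
    using integrable_times_bounded[OF feichtinger_fiber_integrable[OF that, of x], of "\<lambda>t. ch (- (\<omega> \<bullet> t))" 1]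
    by (simp add: mult.commute)
  have e: "ch (- (\<omega> \<bullet> t)) * (a * f (x, t) + b * h (x, t)) =
      a * (ch (- (\<omega> \<bullet> t)) * f (x, t)) + b * (ch (- (\<omega> \<bullet> t)) * h (x, t))" for t
    by (simp add: algebra_simps)
  show "fourier2 (\<lambda>p. a * f p + b * h p) p = a * fourier2 f p + b * fourier2 h p"
    using i[OF f] i[OF h] by (simp add: fourier2_ch p e)
qed

text \<open>The product of the two expansions is an expansion into Gaussian atoms on the product
  space. Positions and frequencies are regrouped, and conjugation reverses the second frequency;
  this is the map \<open>s\<close>.\<close>

lemma tensor_conj_feichtinger:
  fixes f g :: "'a::euclidean_space \<Rightarrow> complex"
  assumes f: "f \<in> feichtinger gauss" and g: "g \<in> feichtinger gauss"
  shows "tensor_conj f g \<in> feichtinger gauss"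
proof -
  define a where "a p = gcoef f (fst p) * cnj (gcoef g (snd p))" for p
  define s :: "('a \<times> 'a) \<times> ('a \<times> 'a) \<Rightarrow> ('a \<times> 'a) \<times> ('a \<times> 'a)"
    where "s p = ((fst (fst p), fst (snd p)), (snd (fst p), - snd (snd p)))" for p
  have ig: "integrable lborel (\<lambda>z. cnj (gcoef g z))" using gauss_expansion(1)[OF g] by simp
  have ia: "integrable lborel a"
    unfolding a_def by (rule lborel_integrable_product[OF gauss_expansion(1)[OF f] ig])
  have "tensor_conj f g q = (LINT p|lborel. a p * (1 * atom gauss (s p) q))" for q
  proof -
    obtain x y where q: "q = (x, y)" by (metis prod.collapse)
    have b: "integrable lborel (\<lambda>z. gcoef h z * atom gauss z x)"
      if h: "h \<in> feichtinger gauss" for h :: "'a \<Rightarrow> complex" and x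
    proof (rule integrable_times_bounded[OF gauss_expansion(1)[OF h], where B=1])
      show "(\<lambda>z. atom gauss z x) \<in> borel_measurable borel"
        unfolding atom_def by (intro borel_measurable_continuous_onI continuous_intros)
    qed (simp add: norm_atom norm_gauss_le)
    have b': "integrable lborel (\<lambda>z. cnj (gcoef g z * atom gauss z y))" using b[OF g, of y] by (simp del: complex_cnj_mult)
    have e: "a p * (1 * atom gauss (s p) q) = (gcoef f (fst p) * atom gauss (fst p) x) * cnj (gcoef g (snd p) * atom gauss (snd p) y)" for p
      by (simp add: a_def s_def q atom_def gauss_Pair ch_diff mult_ac)
    have "tensor_conj f g q = (LINT z|lborel. gcoef f z * atom gauss z x) * (LINT z|lborel. cnj (gcoef g z * atom gauss z y))"
      unfolding q tensor_conj_def prod.case gauss_expansion(2)[OF f, of x] gauss_expansion(2)[OF g, of y]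
      by (simp del: complex_cnj_mult)
    also have "\<dots> = (LINT z|lborel. LINT w|lborel. (gcoef f z * atom gauss z x) * cnj (gcoef g w * atom gauss w y))"
      by (simp only: integral_mult_right_zero integral_mult_left_zero)
    also have "\<dots> = (LINT p|lborel. (gcoef f (fst p) * atom gauss (fst p) x) * cnj (gcoef g (snd p) * atom gauss (snd p) y))"
      using lborel_integral_fst[OF lborel_integrable_product[OF b[OF f] b']] by simp
    finally show ?thesis unfolding e .
  qed
  then have "tensor_conj f g = (\<lambda>q. LINT p|lborel. a p * (1 * atom gauss (s p) q))" by auto
  moreover have "(\<lambda>q. LINT p|lborel. a p * (1 * atom gauss (s p) q)) \<in> feichtinger gauss"
  proof (rule atomic_synthesis(1)[OF ia _ _ _ window_gauss window_gauss stf_schwartz_integrable[OF gauss_schwartz gauss_schwartz]])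
    show "s \<in> borel_measurable borel"
      unfolding s_def[abs_def] by (intro borel_measurable_continuous_onI continuous_intros)
  qed auto
  ultimately show ?thesis by simp
qed

text \<open>The frequency of the second factor is negated because \<open>tensor_conj\<close>
  conjugates that factor.\<close>

lemma atom_gauss_tensor:
  "atom gauss ((x, y), (\<omega>, \<eta>)) = tensor_conj (atom gauss (x, \<omega>)) (atom gauss (y, - \<eta>))"
  by (auto simp: fun_eq_iff tensor_conj_def atom_def gauss_Pair ch_add mult_ac)

section \<open>Density of the span of Gaussian atoms\<close>

text \<open>Gives one majorant for all atoms near a point. The constant comes from 3(1 + (s - r)^2)
  - (1 + s^2) = (s - 2r)^2 + (s - r)^2 + 2(1 - r^2), which is nonnegative for |r| <= 1.\<close>

lemma wt_shift:
  fixes x d :: "'a::euclidean_space"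
  assumes d: "norm d \<le> 1"
  shows "wt (x - d) \<le> 3 ^ DIM('a) * wt x"
proof -
  have "wt (x - d) \<le> (\<Prod>b\<in>(Basis::'a set). 3 * inverse (1 + (x \<bullet> b)\<^sup>2))"
    unfolding wt_def
  proof (intro prod_mono conjI)
    fix b :: 'a assume b: "b \<in> Basis"
    define s r where "s = x \<bullet> b" and "r = d \<bullet> b"
    have "\<bar>r\<bar> \<le> 1" using Basis_le_norm[OF b, of d] d by (simp add: r_def)
    then have "r\<^sup>2 \<le> 1" by (simp add: abs_square_le_1)
    moreover have "0 \<le> (s - 2 * r)\<^sup>2" by simp
    then have "0 \<le> s\<^sup>2 - 4 * s * r + 4 * r\<^sup>2" by (simp add: power2_diff power_mult_distrib mult_ac)
    moreover have "0 \<le> (s - r)\<^sup>2" by simp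
    moreover have "(s - r)\<^sup>2 = s\<^sup>2 - 2 * s * r + r\<^sup>2" by (simp add: power2_diff)
    ultimately have "1 + s\<^sup>2 \<le> 3 * (1 + (s - r)\<^sup>2)" by argo
    moreover have "0 < 1 + s\<^sup>2" "0 < 1 + (s - r)\<^sup>2" by (simp_all add: add_pos_nonneg)
    ultimately have "inverse (1 + (s - r)\<^sup>2) \<le> 3 * inverse (1 + s\<^sup>2)" by (simp add: divide_simps)
    then show "inverse (1 + ((x - d) \<bullet> b)\<^sup>2) \<le> 3 * inverse (1 + (x \<bullet> b)\<^sup>2)"
      by (simp add: s_def r_def inner_diff_left)
  qed (simp add: add_nonneg_nonneg)
  also have "\<dots> = 3 ^ DIM('a) * wt x" by (simp add: prod.distrib wt_def)
  finally show ?thesis .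
qed

lemma stf_atom_diff:
  fixes z q w :: "'a::euclidean_space \<times> 'a"
  shows "stf gauss (\<lambda>t. atom gauss z t - atom gauss q t) w = stf gauss (atom gauss z) w - stf gauss (atom gauss q) w"
  using stf_add_scale[OF window_gauss integrable_atom[OF integrable_gauss, of z] integrable_atom[OF integrable_gauss, of q], of 1 "-1" w]
  by simp

lemma atom_gauss_feichtinger: "atom gauss z \<in> feichtinger gauss"
  by (rule atom_feichtinger[OF window_gauss window_gauss stf_schwartz_integrable[OF gauss_schwartz gauss_schwartz]])

lemma continuous_on_stf_atom: "continuous_on UNIV (\<lambda>q. stf gauss (atom gauss q) w)"
  unfolding stf_def
proof (rule continuous_on_lborel_integral)
  show "integrable lborel (\<lambda>t. norm (atom gauss w t))" by (rule integrable_norm[OF integrable_atom[OF integrable_gauss]])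
  show "norm (atom gauss q t * cnj (atom gauss w t)) \<le> norm (atom gauss w t)" for q t
    by (simp add: norm_mult norm_atom norm_gauss_le mult_left_le_one_le)
  show "(\<lambda>t. atom gauss q t * cnj (atom gauss w t)) \<in> borel_measurable lborel" for q
    using borel_measurable_times[OF atom_measurable[OF gauss_measurable, of q]
        measurable_compose[OF atom_measurable[OF gauss_measurable, of w] cnj_measurable]] by simp
  show "continuous_on UNIV (\<lambda>q. atom gauss q t * cnj (atom gauss w t))" for t
    unfolding atom_def by (intro continuous_intros)
qed

text \<open>Strong continuity of the shifts, tested on the Gaussian. The transforms converge
  pointwise, and shifts by points within distance 1 of z share an integrable majorant.\<close>

lemma stf_norm_atom_diff_tendsto:
  fixes z :: "'a::euclidean_space \<times> 'a"
  assumes q: "q \<longlonglongrightarrow> z"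
  shows "(\<lambda>m. stf_norm gauss (\<lambda>t. atom gauss z t - atom gauss (q m) t)) \<longlonglongrightarrow> 0"
proof -
  have "\<exists>K. \<forall>x \<omega>. norm (stf gauss (gauss :: 'a \<Rightarrow> complex) (x, \<omega>)) \<le> K * wt x * wt \<omega>"
    using translate_products_fourier_bound[OF translate_products.base[OF gauss_schwartz gauss_schwartz]] by (simp add: stf_def atom_def mult_ac)
  then obtain K where K: "\<And>x \<omega>. norm (stf gauss (gauss :: 'a \<Rightarrow> complex) (x, \<omega>)) \<le> K * wt x * wt \<omega>"
    by blast
  have K0: "0 \<le> K"
  proof -
    have "0 \<le> K * wt (0::'a) * wt (0::'a)" using K[of 0 0] norm_ge_zero order_trans by blast
    then show ?thesis using wt_pos[of "0::'a"] by (simp add: zero_le_mult_iff)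
  qed
  define D :: real where "D = 3 ^ DIM('a)"
  \<comment> \<open>Each of the two atoms contributes K D D: one D for the shift in position and one
    for the shift in frequency.\<close>
  define W where "W w = (2 * K * D * D) * (wt (fst (w - z)) * wt (snd (w - z)))" for w
  have "integrable lborel (\<lambda>w :: 'a \<times> 'a. wt (fst w) * wt (snd w))"
    by (rule lborel_integrable_product[OF integrable_wt integrable_wt])
  then have iW: "integrable lborel W"
    unfolding W_def using lborel_translate_integrable[of "\<lambda>w :: 'a \<times> 'a. wt (fst w) * wt (snd w)" "- z"] by simp
  have b: "norm (stf gauss (atom gauss p) w) \<le> K * D * D * (wt (fst (w - z)) * wt (snd (w - z)))"
    if p: "norm (p - z) \<le> 1" for p w
  proof -
    have "norm (fst (p - z)) \<le> 1" "norm (snd (p - z)) \<le> 1"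
      using order_trans[OF norm_fst_le[of "fst (p - z)" "snd (p - z)"]] order_trans[OF norm_snd_le[of "snd (p - z)" "fst (p - z)"]] p
      unfolding prod.collapse by blast+
    then have "wt (fst (w - z) - fst (p - z)) \<le> D * wt (fst (w - z))" "wt (snd (w - z) - snd (p - z)) \<le> D * wt (snd (w - z))"
      unfolding D_def by (auto intro!: wt_shift simp del: fst_diff snd_diff)
    then have "wt (fst (w - p)) \<le> D * wt (fst (w - z))" "wt (snd (w - p)) \<le> D * wt (snd (w - z))" by simp_all
    then have "wt (fst (w - p)) * wt (snd (w - p)) \<le> (D * wt (fst (w - z))) * (D * wt (snd (w - z)))"
      by (intro mult_mono) (auto simp: less_imp_le[OF wt_pos] D_def)
    from mult_left_mono[OF this K0]
    have le: "K * wt (fst (w - p)) * wt (snd (w - p)) \<le> K * D * D * (wt (fst (w - z)) * wt (snd (w - z)))"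
      by (simp add: mult_ac)
    show ?thesis unfolding norm_stf_atom
      by (rule order_trans[OF K[of "fst (w - p)" "snd (w - p)", unfolded prod.collapse] le])
  qed
  \<comment> \<open>The majorant is valid only near z, so the sequence is started at M;
    \<open>LIMSEQ_offset\<close> undoes this at the end.\<close>
  obtain M where M: "\<And>m. m \<ge> M \<Longrightarrow> norm (q m - z) < 1"
    using LIMSEQ_D[OF q, of 1] by auto
  have "(\<lambda>m. LINT w|lborel. norm (stf gauss (\<lambda>t. atom gauss z t - atom gauss (q (m + M)) t) w)) \<longlonglongrightarrow> (LINT w|lborel. (0::real) * norm (w :: 'a \<times> 'a))"
  proof (rule integral_dominated_convergence[OF _ _ iW])
    fix m
    have "(\<lambda>t. atom gauss z t - atom gauss (q (m + M)) t) \<in> borel_measurable borel"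
      using atom_measurable[OF gauss_measurable] by (intro borel_measurable_diff)
    from stf_measurable[OF gauss_measurable this]
    show "(\<lambda>w. norm (stf gauss (\<lambda>t. atom gauss z t - atom gauss (q (m + M)) t) w)) \<in> borel_measurable lborel" by simp
    show "AE w in lborel. norm (norm (stf gauss (\<lambda>t. atom gauss z t - atom gauss (q (m + M)) t) w)) \<le> W w"
    proof (rule AE_I2)
      fix w
      have "norm (stf gauss (atom gauss z) w - stf gauss (atom gauss (q (m + M))) w) \<le>
        K * D * D * (wt (fst (w - z)) * wt (snd (w - z))) + K * D * D * (wt (fst (w - z)) * wt (snd (w - z)))"
        by (rule order_trans[OF norm_triangle_ineq4 add_mono[OF b b]]) (use M[of "m + M"] in auto)
      then show "norm (norm (stf gauss (\<lambda>t. atom gauss z t - atom gauss (q (m + M)) t) w)) \<le> W w"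
        unfolding stf_atom_diff W_def by (simp add: mult_ac)
    qed
  next
    show "AE w in lborel. (\<lambda>m. norm (stf gauss (\<lambda>t. atom gauss z t - atom gauss (q (m + M)) t) w)) \<longlonglongrightarrow> 0 * norm w"
    proof (rule AE_I2)
      fix w :: "'a \<times> 'a"
      have "(\<lambda>m. stf gauss (atom gauss (q (m + M))) w) \<longlonglongrightarrow> stf gauss (atom gauss z) w"
        by (rule continuous_on_tendsto_compose[OF continuous_on_stf_atom LIMSEQ_ignore_initial_segment[OF q]]) auto
      from tendsto_norm[OF tendsto_diff[OF tendsto_const[of "stf gauss (atom gauss z) w"] this]]
      show "(\<lambda>m. norm (stf gauss (\<lambda>t. atom gauss z t - atom gauss (q (m + M)) t) w)) \<longlonglongrightarrow> 0 * norm w"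
        unfolding stf_atom_diff by simp
    qed
  qed simp
  then have "(\<lambda>m. stf_norm gauss (\<lambda>t. atom gauss z t - atom gauss (q (m + M)) t)) \<longlonglongrightarrow> 0"
    by (simp add: stf_norm_def)
  then show ?thesis by (rule LIMSEQ_offset)
qed

lemma conj_linear_onD:
  "conj_linear_on X k \<Longrightarrow> f \<in> X \<Longrightarrow> g \<in> X \<Longrightarrow> k (\<lambda>x. a * f x + b * g x) = cnj a * k f + cnj b * k g"
  by (simp add: conj_linear_on_def)

text \<open>Membership is carried through the induction because conjugate-linearity is available
  only inside the space.\<close>

lemma conj_linear_on_sum_zero:
  assumes k: "conj_linear_on (feichtinger gauss) k" and S: "finite S"
    and h: "\<And>q. q \<in> S \<Longrightarrow> h q \<in> feichtinger gauss" "\<And>q. q \<in> S \<Longrightarrow> k (h q) = 0"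
  shows "(\<lambda>t. \<Sum>q\<in>S. c q * h q t) \<in> feichtinger gauss \<and> k (\<lambda>t. \<Sum>q\<in>S. c q * h q t) = 0"
  using S h
proof (induction S rule: finite_induct)
  case empty
  \<comment> \<open>The empty sum has to be presented as a combination of two members of the
    space.\<close>
  have 1: "(\<lambda>t. 0 * atom gauss 0 t + 0 * atom gauss 0 t) \<in> feichtinger gauss"
    by (rule feichtinger_add_scale[OF window_gauss atom_gauss_feichtinger atom_gauss_feichtinger])
  have 2: "k (\<lambda>t. 0 * atom gauss 0 t + 0 * atom gauss 0 t) = cnj 0 * k (atom gauss 0) + cnj 0 * k (atom gauss 0)"
    by (rule conj_linear_onD[OF k atom_gauss_feichtinger atom_gauss_feichtinger])
  from 1 2 show ?case by simp
next
  case (insert q S)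
  then have i: "(\<lambda>t. \<Sum>q\<in>S. c q * h q t) \<in> feichtinger gauss" "k (\<lambda>t. \<Sum>q\<in>S. c q * h q t) = 0" by auto
  have q: "h q \<in> feichtinger gauss" "k (h q) = 0" using insert.prems by auto
  have e: "(\<lambda>t. \<Sum>q\<in>insert q S. c q * h q t) = (\<lambda>t. c q * h q t + 1 * (\<Sum>q\<in>S. c q * h q t))"
    using insert by simp
  have "k (\<lambda>t. c q * h q t + 1 * (\<Sum>q\<in>S. c q * h q t)) = cnj (c q) * k (h q) + cnj 1 * k (\<lambda>t. \<Sum>q\<in>S. c q * h q t)"
    by (rule conj_linear_onD[OF k q(1) i(1)])
  then show ?case unfolding e using feichtinger_add_scale[OF window_gauss q(1) i(1), of "c q" 1] i q by simp
qed

text \<open>Replacing \<open>\<pi>(z)g\<close> in the expansion of \<open>f\<close> by \<open>\<pi>(r\<^sub>m z)g\<close>, with simple functions \<open>r\<^sub>m\<close> converging to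
  the identity, turns the integral into a finite sum, and the error tends to zero in \<open>M\<^sup>1\<close>.\<close>

lemma zero_on_atoms_imp_zero:
  fixes k :: "('a::euclidean_space \<Rightarrow> complex) \<Rightarrow> complex"
  assumes k: "conj_linear_on (feichtinger gauss) k"
    and C: "\<And>f. f \<in> feichtinger gauss \<Longrightarrow> norm (k f) \<le> C * stf_norm gauss f"
    and z: "\<And>z. k (atom gauss z) = 0"
    and f: "f \<in> feichtinger gauss"
  shows "k f = 0"
proof -
  let ?a = "gcoef f"
  have a: "integrable lborel ?a" by (rule gauss_expansion(1)[OF f])
  obtain r :: "nat \<Rightarrow> 'a \<times> 'a \<Rightarrow> 'a \<times> 'a" where r: "\<And>m. simple_function lborel (r m)" "\<And>z. (\<lambda>m. r m z) \<longlonglongrightarrow> z"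
  proof -
    have "(\<lambda>z. z) \<in> borel_measurable (lborel :: ('a \<times> 'a) measure)" by simp
    from borel_measurable_implies_sequence_metric[OF this, of 0]
    obtain F :: "nat \<Rightarrow> 'a \<times> 'a \<Rightarrow> 'a \<times> 'a" where "\<forall>m. simple_function lborel (F m)" "\<forall>z\<in>space lborel. (\<lambda>m. F m z) \<longlonglongrightarrow> z"
      by blast
    then show ?thesis by (intro that[of F]) (simp_all add: space_borel del: split_paired_All)
  qed
  have rm: "r m \<in> borel_measurable borel" for m
    using borel_measurable_simple_function[OF r(1)[of m]] by simp
  define F where "F m t = (LINT z|lborel. ?a z * (1 * atom gauss (r m z) t))" for m t
  have F: "F m \<in> feichtinger gauss" for m
    unfolding F_def
    by (rule atomic_synthesis(1)[OF a rm _ _ window_gauss window_gauss stf_schwartz_integrable[OF gauss_schwartz gauss_schwartz]]) auto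
  have kF: "k (F m) = 0" for m
  proof -
    let ?S = "range (r m)"
    have S: "finite ?S" using r(1)[of m] by (simp add: simple_function_def)
    have i: "integrable lborel (\<lambda>z. ?a z * indicator (r m -` {q}) z)" for q
    proof (rule integrable_times_bounded[OF a, where B=1])
      have "r m -` {q} \<in> sets borel" using measurable_sets[OF rm[of m], of "{q}"] by simp
      then show "indicator (r m -` {q}) \<in> borel_measurable borel" by simp
    qed (simp add: indicator_def)
    have "F m = (\<lambda>t. \<Sum>q\<in>?S. (LINT z|lborel. ?a z * indicator (r m -` {q}) z) * atom gauss q t)"
    proof
      fix t
      have e: "?a z * (1 * atom gauss (r m z) t) = (\<Sum>q\<in>?S. (?a z * indicator (r m -` {q}) z) * atom gauss q t)" for z
      proof -
        have "(\<Sum>q\<in>?S. (?a z * indicator (r m -` {q}) z) * atom gauss q t) =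
            (\<Sum>q\<in>?S. if q = r m z then ?a z * atom gauss q t else 0)"
          by (intro sum.cong refl) (auto simp: indicator_def)
        then show ?thesis using S by (simp add: sum.delta')
      qed
      show "F m t = (\<Sum>q\<in>?S. (LINT z|lborel. ?a z * indicator (r m -` {q}) z) * atom gauss q t)"
        unfolding F_def e using i by (subst Bochner_Integration.integral_sum) auto
    qed
    then show ?thesis
      using conj_linear_on_sum_zero[OF k S atom_gauss_feichtinger z] by simp
  qed
  define d where "d m z = stf_norm gauss (\<lambda>t. atom gauss z t - atom gauss (r m z) t)" for m z
  define n where "n = stf_norm gauss (gauss :: 'a \<Rightarrow> complex)"
  have i: "integrable lborel (stf gauss (atom gauss z))" for z :: "'a \<times> 'a"
    by (rule feichtingerD(3)[OF atom_gauss_feichtinger])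
  have stfi: "integrable lborel (stf gauss (\<lambda>t. atom gauss z t - atom gauss q t))" for z q :: "'a \<times> 'a"
    unfolding stf_atom_diff[abs_def] using i by (intro Bochner_Integration.integrable_diff)
  have dn: "d m z \<le> 2 * n" for m z
  proof -
    have "d m z \<le> (LINT w|lborel. norm (stf gauss (atom gauss z) w) + norm (stf gauss (atom gauss (r m z)) w))"
      unfolding d_def stf_norm_def using stfi i
      by (intro integral_mono) (auto simp: stf_atom_diff norm_triangle_ineq4)
    also have "\<dots> = 2 * n" using i by (simp add: n_def stf_norm_atom flip: stf_norm_def)
    finally show ?thesis .
  qed
  have um: "(\<lambda>(z, t). atom gauss z t - atom gauss (r m z) t) \<in> borel_measurable borel" for m
    using borel_measurable_diff[OF atom_family_measurable[OF gauss_measurable measurable_ident_sets[OF refl]]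
        atom_family_measurable[OF gauss_measurable rm[of m]]]
    by (simp add: split_beta')
  have ia: "integrable lborel (\<lambda>z. ?a z * atom gauss (s z) t)" if s: "s \<in> borel_measurable borel" for s t
  proof (rule integrable_times_bounded[OF a, where B=1])
    have "(\<lambda>z. atom gauss z t) \<in> borel_measurable borel"
      unfolding atom_def by (intro borel_measurable_continuous_onI continuous_intros)
    from measurable_compose[OF s this] show "(\<lambda>z. atom gauss (s z) t) \<in> borel_measurable borel" .
  qed (simp add: norm_atom norm_gauss_le)
  \<comment> \<open>The coefficients 1 and -1 are kept explicit to match the linear combinations in
    \<open>conj_linear_onD\<close> and \<open>feichtinger_add_scale\<close>.\<close>
  have diff: "(\<lambda>t. 1 * f t + (-1) * F m t) = (\<lambda>t. LINT z|lborel. ?a z * (atom gauss z t - atom gauss (r m z) t))" for m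
    using ia[OF rm[of m]] ia[OF measurable_ident_sets[OF refl]]
    by (simp add: fun_eq_iff gauss_expansion(2)[OF f] F_def right_diff_distrib)
  have nd: "stf_norm gauss (\<lambda>t. 1 * f t + (-1) * F m t) \<le> (LINT z|lborel. norm (?a z) * d m z)" for m
    unfolding diff stf_norm_def d_def
  proof (rule synthesis(4)[OF a um _ _ _ _ gauss_measurable norm_gauss_le stfi])
    show "continuous_on UNIV (\<lambda>t. atom gauss z t - atom gauss (r m z) t)" for z
      by (intro continuous_on_diff continuous_on_atom windowD(1) window_gauss)
    show "norm (atom gauss z t - atom gauss (r m z) t) \<le> 2" for z t
    proof -
      have "norm (atom gauss z t - atom gauss (r m z) t) \<le> 1 + 1"
        by (rule order_trans[OF norm_triangle_ineq4 add_mono]) (simp_all add: norm_atom norm_gauss_le)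
      then show ?thesis by simp
    qed
    have ig: "integrable lborel (atom gauss q)" for q :: "'a \<times> 'a" by (rule integrable_atom[OF integrable_gauss])
    show ii: "integrable lborel (\<lambda>t. atom gauss z t - atom gauss (r m z) t)" for z
      by (intro Bochner_Integration.integrable_diff ig)
    show "(LINT t|lborel. norm (atom gauss z t - atom gauss (r m z) t)) \<le> 2 * (LINT t|lborel. norm (gauss (t::'a)))" for z
    proof -
      have "(LINT t|lborel. norm (atom gauss z t - atom gauss (r m z) t)) \<le> (LINT t|lborel. norm (atom gauss z t) + norm (atom gauss (r m z) t))"
        using ii ig by (intro integral_mono) (auto simp: norm_triangle_ineq4)
      also have "\<dots> = 2 * (LINT t|lborel. norm (gauss (t::'a)))"
        using ig by (simp add: integral_norm_atom)
      finally show ?thesis .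
    qed
    show "(LINT w|lborel. norm (stf gauss (\<lambda>t. atom gauss z t - atom gauss (r m z) t) w)) \<le> 2 * n" for z
      using dn[of m z] by (simp add: d_def stf_norm_def)
  qed
  \<comment> \<open>Here the pointwise form of the bound in \<open>synthesis\<close> pays off:
    \<open>d m z\<close> tends to 0 for each z and is at most 2n.\<close>
  have lim: "(\<lambda>m. LINT z|lborel. norm (?a z) * d m z) \<longlonglongrightarrow> (LINT z|lborel. norm (?a z) * 0)"
  proof (rule integral_dominated_convergence)
    show "integrable lborel (\<lambda>z. norm (?a z) * (2 * n))" using a by simp
    have [measurable]: "?a \<in> borel_measurable borel" using a by auto
    have [measurable]: "d m \<in> borel_measurable borel" for m
      unfolding d_def stf_norm_def by (rule stf_family_measurable(2)[OF um gauss_measurable])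
    show "(\<lambda>z. norm (?a z) * d m z) \<in> borel_measurable lborel" for m by measurable
    show "AE z in lborel. (\<lambda>m. norm (?a z) * d m z) \<longlonglongrightarrow> norm (?a z) * 0"
      unfolding d_def by (intro AE_I2 tendsto_mult tendsto_const stf_norm_atom_diff_tendsto r)
    show "AE z in lborel. norm (norm (?a z) * d m z) \<le> norm (?a z) * (2 * n)" for m
    proof (rule AE_I2)
      fix z
      have "0 \<le> d m z" unfolding d_def by (rule stf_norm_nonneg)
      then show "norm (norm (?a z) * d m z) \<le> norm (?a z) * (2 * n)"
        using mult_left_mono[OF dn[of m z] norm_ge_zero[of "?a z"]] by (simp add: abs_mult)
    qed
  qed simp
  have le: "norm (k f) \<le> \<bar>C\<bar> * (LINT z|lborel. norm (?a z) * d m z)" for m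
  proof -
    have "k (\<lambda>t. 1 * f t + (-1) * F m t) = cnj 1 * k f + cnj (-1) * k (F m)"
      by (rule conj_linear_onD[OF k f F])
    then have "norm (k f) = norm (k (\<lambda>t. 1 * f t + (-1) * F m t))" by (simp add: kF)
    also have "\<dots> \<le> C * stf_norm gauss (\<lambda>t. 1 * f t + (-1) * F m t)"
      by (rule C[OF feichtinger_add_scale[OF window_gauss f F]])
    also have "\<dots> \<le> \<bar>C\<bar> * stf_norm gauss (\<lambda>t. 1 * f t + (-1) * F m t)"
      by (intro mult_right_mono stf_norm_nonneg) simp
    also have "\<dots> \<le> \<bar>C\<bar> * (LINT z|lborel. norm (?a z) * d m z)"
      by (intro mult_left_mono nd) simp
    finally show ?thesis .
  qed
  have "(\<lambda>m. \<bar>C\<bar> * (LINT z|lborel. norm (?a z) * d m z)) \<longlonglongrightarrow> \<bar>C\<bar> * (LINT z|lborel. norm (?a z) * 0)"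
    by (intro tendsto_mult tendsto_const lim)
  then have "norm (k f) \<le> \<bar>C\<bar> * (LINT z|lborel. norm (?a z) * 0)"
    by (rule LIMSEQ_le_const) (use le in blast)
  then show ?thesis by simp
qed

section \<open>Equality of the operators\<close>

lemma stack_unstack [simp]: "stack (unstack v) = v"
  by (auto simp: stack_def unstack_def vec_eq_iff split: sum.split)

lemma unstack_stack [simp]: "unstack (stack p) = p"
  by (simp add: stack_def unstack_def prod_eq_iff vec_eq_iff)

lemma linear_stack: "linear stack"
  by (auto simp: linear_iff stack_def vec_eq_iff split: sum.split)

lemma linear_unstack: "linear unstack"
  by (auto simp: linear_iff unstack_def vec_eq_iff)

text \<open>Composition on the right is contravariant, hence the reversed order of the
  matrices.\<close>

lemma coord_change_mult: "coord_change A (coord_change B \<Phi>) = coord_change (B ** A) \<Phi>"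
  by (simp add: fun_eq_iff coord_change_def matrix_vector_mul_assoc)

lemma coord_change_id: "coord_change (mat 1) \<Phi> = \<Phi>"
  by (simp add: fun_eq_iff coord_change_def)

lemma matrix_inv_mult:
  fixes A :: "real^'m::finite^'m"
  assumes "invertible A"
  shows "A ** matrix_inv A = mat 1" "matrix_inv A ** A = mat 1"
  using someI_ex[of "\<lambda>A'. A ** A' = mat 1 \<and> A' ** A = mat 1"] assms
  unfolding invertible_def matrix_inv_def by auto

lemma matrix_inv_eq:
  fixes A B :: "real^'m::finite^'m"
  assumes AB: "A ** B = mat 1" "B ** A = mat 1"
  shows "matrix_inv A = B"
proof -
  have "invertible A" using AB unfolding invertible_def by blast
  from matrix_inv_mult[OF this]
  show ?thesis by (metis AB(2) matrix_mul_assoc matrix_mul_lid matrix_mul_rid)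
qed

lemma stf_bounded_coord_change:
  fixes A :: "real^('n::finite + 'n)^('n + 'n)"
  assumes "invertible A"
  shows "stf_bounded (coord_change A)"
proof -
  define L :: "real^('n::finite + 'n)^('n + 'n) \<Rightarrow> (real^'n) \<times> (real^'n) \<Rightarrow> (real^'n) \<times> (real^'n)"
    where "L C = (\<lambda>p. unstack (C *v stack p))" for C
  have "linear (L C)" for C
    unfolding L_def using linear_compose[OF linear_compose[OF linear_stack matrix_vector_mul_linear] linear_unstack, of C]
    by (simp add: o_def)
  moreover have "L A (L (matrix_inv A) p) = p" "L (matrix_inv A) (L A p) = p" for p
    by (simp_all add: L_def matrix_vector_mul_assoc matrix_inv_mult[OF assms])
  ultimately have "stf_bounded (\<lambda>f p. f (L A p))" by (intro stf_bounded_linear_change[of "L A" "L (matrix_inv A)"])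
  then show ?thesis by (simp add: L_def coord_change_def[abs_def])
qed

lemma Minf_conj_linear_bounded:
  assumes \<psi>: "\<psi> \<in> schwartz" "\<psi> \<noteq> (\<lambda>z. 0)" and \<sigma>: "\<sigma> \<in> Minf \<psi>"
  shows "conj_linear_on (feichtinger gauss) \<sigma>"
    and "\<exists>C\<ge>0. \<forall>f\<in>feichtinger gauss. norm (\<sigma> f) \<le> C * stf_norm gauss f"
proof -
  show "conj_linear_on (feichtinger gauss) \<sigma>"
    using \<sigma> by (simp add: Minf_def M1_eq_feichtinger[OF \<psi>])
  obtain C where C: "\<forall>f\<in>feichtinger gauss. norm (\<sigma> f) \<le> C * M1_norm \<psi> f"
    using \<sigma> by (auto simp: Minf_def M1_eq_feichtinger[OF \<psi>])
  obtain D where D: "0 \<le> D" "\<forall>f\<in>feichtinger gauss. M1_norm \<psi> f \<le> D * stf_norm gauss f"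
    by (rule M1_norm_le_stf_norm[OF \<psi>(1)])
  have "norm (\<sigma> f) \<le> (\<bar>C\<bar> * D) * stf_norm gauss f" if f: "f \<in> feichtinger gauss" for f
  proof -
    have "norm (\<sigma> f) \<le> C * M1_norm \<psi> f" using C f by blast
    also have "\<dots> \<le> \<bar>C\<bar> * M1_norm \<psi> f" by (intro mult_right_mono) (auto simp: M1_norm_def)
    also have "\<dots> \<le> \<bar>C\<bar> * (D * stf_norm gauss f)" using D f by (intro mult_left_mono) auto
    finally show ?thesis by (simp add: mult.assoc)
  qed
  then show "\<exists>C\<ge>0. \<forall>f\<in>feichtinger gauss. norm (\<sigma> f) \<le> C * stf_norm gauss f"
    using D(1) by (intro exI[of _ "\<bar>C\<bar> * D"]) simp
qed

lemma conj_linear_bounded_compose: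
  fixes T :: "('a::euclidean_space \<Rightarrow> complex) \<Rightarrow> 'b::euclidean_space \<Rightarrow> complex"
  assumes k: "conj_linear_on (feichtinger gauss) k" "\<exists>C\<ge>0. \<forall>f\<in>feichtinger gauss. norm (k f) \<le> C * stf_norm gauss f"
    and T: "stf_bounded T" "\<And>f h a b. f \<in> feichtinger gauss \<Longrightarrow> h \<in> feichtinger gauss \<Longrightarrow>
      T (\<lambda>t. a * f t + b * h t) = (\<lambda>t. a * T f t + b * T h t)"
  shows "conj_linear_on (feichtinger gauss) (\<lambda>f. k (T f))"
    and "\<exists>C\<ge>0. \<forall>f\<in>feichtinger gauss. norm (k (T f)) \<le> C * stf_norm gauss f"
proof -
  show "conj_linear_on (feichtinger gauss) (\<lambda>f. k (T f))"
    unfolding conj_linear_on_def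
  proof (intro ballI allI)
    fix f h :: "'a \<Rightarrow> complex" and a b assume f: "f \<in> feichtinger gauss" and h: "h \<in> feichtinger gauss"
    show "k (T (\<lambda>x. a * f x + b * h x)) = cnj a * k (T f) + cnj b * k (T h)"
      unfolding T(2)[OF f h] by (rule conj_linear_onD[OF k(1) stf_boundedD[OF T(1) f] stf_boundedD[OF T(1) h]])
  qed
  obtain C where C: "C \<ge> 0" "\<And>f. f \<in> feichtinger gauss \<Longrightarrow> norm (k f) \<le> C * stf_norm gauss f" using k(2) by blast
  obtain D where D: "D \<ge> 0" "\<And>f. f \<in> feichtinger gauss \<Longrightarrow> stf_norm gauss (T f) \<le> D * stf_norm gauss f"
    using T(1) unfolding stf_bounded_def by blast
  have "norm (k (T f)) \<le> (C * D) * stf_norm gauss f" if f: "f \<in> feichtinger gauss" for f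
    using order_trans[OF C(2)[OF stf_boundedD[OF T(1) f]] mult_left_mono[OF D(2)[OF f] C(1)]] by (simp add: mult.assoc)
  then show "\<exists>C\<ge>0. \<forall>f\<in>feichtinger gauss. norm (k (T f)) \<le> C * stf_norm gauss f"
    using C D by (intro exI[of _ "C * D"]) simp
qed

theorem proposition8:
  fixes \<phi> :: "real^'n \<Rightarrow> complex"
    and \<psi> :: "(real^'n) \<times> (real^'n) \<Rightarrow> complex"
    and A B :: "real^('n + 'n)^('n + 'n)"
    and \<sigma> \<rho> :: "((real^'n) \<times> (real^'n) \<Rightarrow> complex) \<Rightarrow> complex"
  assumes "\<phi> \<in> schwartz" and "\<phi> \<noteq> (\<lambda>x. 0)"
    and "\<psi> \<in> schwartz" and "\<psi> \<noteq> (\<lambda>z. 0)"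
    and "invertible A" and "invertible B"
    and "\<sigma> \<in> Minf \<psi>" and "\<rho> \<in> Minf \<psi>"
  shows "matrix_op \<phi> A \<sigma> = matrix_op \<phi> B \<rho> \<longleftrightarrow>
    \<sigma> = (\<lambda>\<Phi>. complex_of_real (\<bar>det A\<bar> / \<bar>det B\<bar>) *
           fourier2_dist \<psi> (coord_change_dist \<psi> (matrix_inv B ** A) (fourier2_inv_dist \<psi> \<rho>)) \<Phi>)"
    (is "?L \<longleftrightarrow> \<sigma> = ?R")
proof -
  let ?X = "feichtinger gauss :: ((real^'n) \<times> (real^'n) \<Rightarrow> complex) set"
  note A = matrix_inv_mult[OF assms(5)] and B = matrix_inv_mult[OF assms(6)]
  have X: "M1 \<psi> = ?X" by (rule M1_eq_feichtinger[OF assms(3,4)])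
  have Y: "M1 \<phi> = feichtinger gauss" by (rule M1_eq_feichtinger[OF assms(1,2)])
  let ?C = "matrix_inv B ** A" and ?D = "matrix_inv A ** B"
  have CD: "?C ** ?D = mat 1" "?D ** ?C = mat 1"
    by (metis A B matrix_mul_assoc matrix_mul_lid)+
  then have invC: "matrix_inv ?C = ?D" and "invertible ?D"
    by (auto intro: matrix_inv_eq simp: invertible_def)
  have invA: "invertible (matrix_inv A)" using A unfolding invertible_def by blast
  note bdd = stf_boundedD[OF stf_bounded_fourier2] stf_boundedD[OF stf_bounded_fourier2_inv]
    stf_boundedD[OF stf_bounded_coord_change]
  have 1: "det (matrix_inv B) * det B = 1" using B(2) det_mul[of "matrix_inv B" B] by simp
  then have "det B \<noteq> 0" by auto
  moreover from this have "det (matrix_inv B) = 1 / det B" using 1 by (simp add: eq_divide_eq)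
  moreover have "det (matrix_inv A) * det A = 1" using A(2) det_mul[of "matrix_inv A" A] by simp
  then have "det A \<noteq> 0" by auto
  \<comment> \<open>The product is |det A| / |det B| times the inverse of |det A| / |det B|.\<close>
  ultimately have det: "complex_of_real (\<bar>det A\<bar> / \<bar>det B\<bar>) * complex_of_real (inverse \<bar>det ?C\<bar>) = 1"
    by (simp add: det_mul abs_mult flip: of_real_mult)
  \<comment> \<open>With the scalars cancelled, unfolding the dualities leaves \<open>\<rho>\<close>
    at a transformed function; the matrix is D, the inverse of C, because
    \<open>coord_change_dist\<close> acts through the inverse.\<close>
  have R: "?R \<Phi> = \<rho> (fourier2 (coord_change ?D (fourier2_inv \<Phi>)))" if \<Phi>: "\<Phi> \<in> ?X" for \<Phi>
  proof -
    have "?R \<Phi> = complex_of_real (\<bar>det A\<bar> / \<bar>det B\<bar>) * (complex_of_real (inverse \<bar>det ?C\<bar>) *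
        \<rho> (fourier2 (coord_change ?D (fourier2_inv \<Phi>))))"
      using \<Phi> bdd(2)[OF \<Phi>] bdd(3)[OF \<open>invertible ?D\<close> bdd(2)[OF \<Phi>]]
      by (simp only: fourier2_dist_def coord_change_dist_def fourier2_inv_dist_def X invC if_True)
    then show ?thesis by (simp only: mult.assoc[symmetric] det mult_1_left)
  qed
  show ?thesis
  proof
    assume L: ?L
    define k where "k F = \<sigma> (fourier2 (coord_change A F)) - \<rho> (fourier2 (coord_change B F))" for F
    have lin: "fourier2 (coord_change M (\<lambda>t. a * f t + b * h t)) =
        (\<lambda>t. a * fourier2 (coord_change M f) t + b * fourier2 (coord_change M h) t)"
      if "invertible M" "f \<in> ?X" "h \<in> ?X" for M :: "real^('n + 'n)^('n + 'n)" and f h a b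
    proof -
      have "coord_change M (\<lambda>t. a * f t + b * h t) = (\<lambda>p. a * coord_change M f p + b * coord_change M h p)"
        by (simp add: fun_eq_iff coord_change_def)
      then show ?thesis by (simp only: fourier2_add_scale[OF bdd(3)[OF that(1,2)] bdd(3)[OF that(1,3)]])
    qed
    note bT = stf_bounded_compose[OF stf_bounded_fourier2 stf_bounded_coord_change]
    note kA = conj_linear_bounded_compose[OF Minf_conj_linear_bounded[OF assms(3,4,7)] bT[OF assms(5)] lin[OF assms(5)]]
    note kB = conj_linear_bounded_compose[OF Minf_conj_linear_bounded[OF assms(3,4,8)] bT[OF assms(6)] lin[OF assms(6)]]
    have k1: "conj_linear_on ?X k"
      unfolding conj_linear_on_def
    proof (intro ballI allI)
      fix f h a b assume f: "f \<in> ?X" and h: "h \<in> ?X"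
      have "\<sigma> (fourier2 (coord_change A (\<lambda>t. a * f t + b * h t))) =
          cnj a * \<sigma> (fourier2 (coord_change A f)) + cnj b * \<sigma> (fourier2 (coord_change A h))"
        by (rule conj_linear_onD[OF kA(1) f h])
      moreover have "\<rho> (fourier2 (coord_change B (\<lambda>t. a * f t + b * h t))) =
          cnj a * \<rho> (fourier2 (coord_change B f)) + cnj b * \<rho> (fourier2 (coord_change B h))"
        by (rule conj_linear_onD[OF kB(1) f h])
      ultimately show "k (\<lambda>t. a * f t + b * h t) = cnj a * k f + cnj b * k h"
        by (simp add: k_def right_diff_distrib)
    qed
    obtain CA CB where CAB: "\<And>f. f \<in> ?X \<Longrightarrow> norm (\<sigma> (fourier2 (coord_change A f))) \<le> CA * stf_norm gauss f"
      "\<And>f. f \<in> ?X \<Longrightarrow> norm (\<rho> (fourier2 (coord_change B f))) \<le> CB * stf_norm gauss f"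
      using kA(2) kB(2) by blast
    have k2: "norm (k f) \<le> (CA + CB) * stf_norm gauss f" if "f \<in> ?X" for f
      unfolding k_def distrib_right by (rule order_trans[OF norm_triangle_ineq4 add_mono[OF CAB[OF that]]])
    have k3: "k (atom gauss z) = 0" for z
    proof -
      obtain x y \<omega> \<eta> where z: "z = ((x, y), (\<omega>, \<eta>))" by (metis prod.collapse)
      \<comment> \<open>\<open>matrix_op\<close> feeds its arguments to \<open>matrix_wigner\<close>
        in swapped order, so the atom of the second tensor factor comes first.\<close>
      have "matrix_op \<phi> A \<sigma> (atom gauss (y, - \<eta>)) (atom gauss (x, \<omega>)) = matrix_op \<phi> B \<rho> (atom gauss (y, - \<eta>)) (atom gauss (x, \<omega>))"
        using L by simp
      then show ?thesis
        by (simp add: k_def z atom_gauss_tensor matrix_op_def Y atom_gauss_feichtinger matrix_wigner_def)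
    qed
    have k0: "k F = 0" if "F \<in> ?X" for F by (rule zero_on_atoms_imp_zero[OF k1 k2 k3 that])
    show "\<sigma> = ?R"
    proof
      fix \<Phi>
      show "\<sigma> \<Phi> = ?R \<Phi>"
      proof (cases "\<Phi> \<in> ?X")
        case True
        \<comment> \<open>At this argument the term with A collapses to
          \<open>\<sigma> \<Phi>\<close>, and in the term with B the coordinate changes combine to
          the one by D.\<close>
        have "k (coord_change (matrix_inv A) (fourier2_inv \<Phi>)) = 0"
          by (intro k0 bdd True invA)
        then show ?thesis
          unfolding R[OF True] by (simp add: k_def coord_change_mult A coord_change_id fourier2_fourier2_inv[OF True])
      next
        case False
        \<comment> \<open>Outside \<open>M1 \<psi>\<close> both functionals have the conventional
          value 0.\<close>
        then show ?thesis using assms(7) by (simp add: Minf_def X fourier2_dist_def)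
      qed
    qed
  next
    assume \<sigma>: "\<sigma> = ?R"
    show ?L
    proof (intro ext)
      fix f g
      show "matrix_op \<phi> A \<sigma> f g = matrix_op \<phi> B \<rho> f g"
      proof (cases "f \<in> M1 \<phi> \<and> g \<in> M1 \<phi>")
        case True
        define T where "T = tensor_conj g f"
        have T: "T \<in> ?X" unfolding T_def using True by (simp add: Y tensor_conj_feichtinger)
        have AT: "coord_change A T \<in> ?X" by (rule bdd(3)[OF assms(5) T])
        \<comment> \<open>In this direction \<Phi> is a Wigner distribution: the inverse transform
          undoes \<open>fourier2\<close>, and the change by A followed by D is the change by
          B.\<close>
        have "A ** ?D = B" by (metis A(1) matrix_mul_assoc matrix_mul_lid)
        then have RT: "?R (fourier2 (coord_change A T)) = \<rho> (fourier2 (coord_change B T))"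
          unfolding R[OF bdd(1)[OF AT]] by (simp add: fourier2_inv_fourier2[OF AT] coord_change_mult)
        have "\<sigma> (fourier2 (coord_change A T)) = \<rho> (fourier2 (coord_change B T))"
          by (rule trans[OF fun_cong[OF \<sigma>] RT])
        then show ?thesis using True by (simp add: matrix_op_def matrix_wigner_def T_def)
      qed (auto simp: matrix_op_def)
    qed
  qed
qed

end
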